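(* Let $a,b,c$ be positive numbers with $a<b<c$, $b-a<c_0<a$, $\lfloor c/b\rfloor\ge2$ and $0<c_1<2a-b$, where $c_0=c-\lfloor c/b\rfloor b$ and $c_1=\lfloor c/b\rfloor b-\lfloor\lfloor c/b\rfloor b/a\rfloor a$. Suppose $a/b\notin\mathbb Q$. Then $\mathcal G(\chi_{[0,c)},a\mathbb Z\times\mathbb Z/b)$ is not a Gabor frame if and only if there exist nonnegative integers $d_1,d_2$ such that (a) $X:=c-(d_1+1)(\lfloor c/b\rfloor+1)(b-a)-(d_2+1)\lfloor c/b\rfloor(b-a)$ belongs to $a\mathbb Z$ and $X\ne a$; (b) $\lfloor c/b\rfloor b+(d_1+1)(b-a)<c<\lfloor c/b\rfloor b+b-(d_2+1)(b-a)$; (c) $\#E_{a,b,c}=d_1$, where, with $m=\big((d_1+d_2+1)c_1-c_0+(d_1+1)(b-a)\big)/a$, $$E_{a,b,c}=\big\{n\in\mathbb Z\cap[1,d_1+d_2+1]:\ n(c_1-m(b-a))\in[0,c_0-(d_1+1)(b-a))+(a-(d_1+d_2+1)(b-a))\mathbb Z\big\}.$$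
   Context: For $\phi\in L^2(\mathbb R)$ and $a,b>0$, the Gabor system is $\mathcal G(\phi,a\mathbb Z\times\mathbb Z/b)=\{e^{-2\pi i n t/b}\phi(t-ma): (m,n)\in\mathbb Z\times\mathbb Z\}$. It is called a Gabor frame if it is a frame for $L^2(\mathbb R)$: there are constants $0<A\le B<\infty$ such that $A\|f\|_2^2\le\sum_{\psi\in\mathcal G}|\langle f,\psi\rangle|^2\le B\|f\|_2^2$ for all $f\in L^2(\mathbb R)$. $\chi_E$ is the indicator function of $E$, $\lfloor x\rfloor$ is the integer part of $x$, $\#$ denotes cardinality, and for a set $A$ and $r\in\mathbb R$, $A+r\mathbb Z=\{x+rk:x\in A,k\in\mathbb Z\}$. *)

theory Defs
  imports "HOL-Analysis.Analysis"
begin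

definition square_integrable :: "(real \<Rightarrow> complex) \<Rightarrow> bool" where
  "square_integrable f \<longleftrightarrow> f \<in> borel_measurable lborel \<and>
     integrable lborel (\<lambda>t. (cmod (f t))\<^sup>2)"

definition L2_inner :: "(real \<Rightarrow> complex) \<Rightarrow> (real \<Rightarrow> complex) \<Rightarrow> complex" where
  "L2_inner f g = (LINT t|lborel. f t * cnj (g t))"

definition L2_norm_sq :: "(real \<Rightarrow> complex) \<Rightarrow> real" where
  "L2_norm_sq f = (LINT t|lborel. (cmod (f t))\<^sup>2)"

definition gabor_atom :: "(real \<Rightarrow> complex) \<Rightarrow> real \<Rightarrow> real \<Rightarrow> int \<times> int \<Rightarrow> real \<Rightarrow> complex" where
  "gabor_atom \<phi> a b mn t =
     exp (- 2 * of_real pi * \<i> * of_int (snd mn) * of_real t / of_real b) * \<phi> (t - of_int (fst mn) * a)"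

definition is_frame :: "('i \<Rightarrow> real \<Rightarrow> complex) \<Rightarrow> bool" where
  "is_frame \<psi> \<longleftrightarrow> (\<exists>A B::real. 0 < A \<and> A \<le> B \<and>
     (\<forall>f. square_integrable f \<longrightarrow>
        ennreal (A * L2_norm_sq f) \<le> (\<Sum>\<^sub>\<infinity>i. ennreal ((cmod (L2_inner f (\<psi> i)))\<^sup>2)) \<and>
        (\<Sum>\<^sub>\<infinity>i. ennreal ((cmod (L2_inner f (\<psi> i)))\<^sup>2)) \<le> ennreal (B * L2_norm_sq f)))"

definition gabor_frame :: "(real \<Rightarrow> complex) \<Rightarrow> real \<Rightarrow> real \<Rightarrow> bool" where
  "gabor_frame \<phi> a b \<longleftrightarrow> is_frame (gabor_atom \<phi> a b)"

definition plus_rZ :: "real set \<Rightarrow> real \<Rightarrow> real set" where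
  "plus_rZ A r = {x + r * of_int k | x k. x \<in> A}"

end

(* For a point t put W_m(t) = sum of f over (t + bZ) in [ma, ma + c). By Parseval in the modulation
   variable the frame operator becomes b times the sum over m of the integral over [0, b) of |W_m|^2, so the frame property is
   a uniform lower bound for sequences on the cosets t + bZ. Passing from W_m to W_{m+1} replaces a
   point x by R x, except that points of a hole disappear and points of a gap appear; modulo a,
   R is a piecewise translation which closes the hole and opens the gap. Let S be the set of
   points whose two-sided R-orbit avoids hole and gap.

   If some N is such that no two points of a coset in a window survive N steps, then f is recovered
   from boundedly many window sums, and there is a frame. Otherwise, by irrationality of a/b, every
   coset has two points of S in [0, c). Collapsing the complement of S turns R modulo a
   into a rotation by theta modulo L. Comparing lengths of collapsed intervals along an orbit of the
   rotation shows that exactly N = d1 + d2 + 1 intervals of length b - a are collapsed,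
   to the points theta, ..., N theta, the last one being the image c0' of the hole. This
   gives (b) and (c), and b X / a is the measure of S in [0, c), which is at least 2b.

   Conversely, under the conditions one inserts gaps of length b - a at theta, ..., N theta into the
   rotation by theta modulo L. The image is a set of points avoiding hole and gap.
   Here X / a is the index of Z theta + Z L in Za + Zb; being at least 2 it yields two distinct R-orbits
   on the coset bZ. The difference of their indicators has vanishing window sums, so there is no frame. *)

theory Submission
  imports Defs
begin

section \<open>Fourier series on one period\<close>

text \<open>Modulo \<open>a\<close>, adding \<open>b\<close> is adding \<open>d = b - a\<close>. The
  hole is therefore \<open>[c0 - d, c0)\<close> and the gap \<open>[c1, c1 + d)\<close>,
  \<open>c1\<close> being the residue of \<open>k b\<close>. The number of collapsed intervals is
  forced by a conservation law: the length collapsed to \<open>n \<theta>\<close> gains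
  \<open>d\<close> at \<open>n = 1\<close> and changes again only where the class of the hole is
  met. Distinct multiples of \<open>\<theta>\<close> are incongruent and all these lengths fit into
  one period, so the gap, carried along by \<open>R\<close>, must end in the hole after finitely
  many steps. The integers of the statement are counts: \<open>d1\<close> and \<open>d2\<close> are
  the numbers of collapsed intervals before and after the hole in one period, \<open>m\<close> is
  the number of turns of \<open>\<theta>, ..., N \<theta>\<close> modulo \<open>L\<close>, and
  \<open>X = a j\<close> with \<open>j b = p L + \<theta> + c0'\<close>. This is positive, so
  \<open>X \<noteq> a\<close> says \<open>j \<ge> 2\<close>. Half-open intervals are used
  throughout: every condition is then stable under small shifts to the right, which lets one coset
  stand for a set of positive measure and lets failure of survival spread by density.\<close>

locale fourier =
  fixes b :: real
  assumes b_pos: "0 < b"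
begin

definition M :: "real measure" where "M = restrict_space lborel {0..<b}"

definition e :: "int \<Rightarrow> real \<Rightarrow> complex" where
  "e n t = cis (2 * pi * of_int n * t / b)"

lemma space_M [simp]: "space M = {0..<b}"
  by (simp add: M_def space_restrict_space)

lemma measurable_M: "f \<in> borel_measurable borel \<Longrightarrow> f \<in> borel_measurable M"
  unfolding M_def by (rule measurable_restrict_space1) simp

lemma emeasure_M_space: "emeasure M (space M) = ennreal b"
  using b_pos by (simp add: M_def emeasure_restrict_space space_restrict_space)

lemma finite_measure_M: "finite_measure M"
  by (rule finite_measureI) (use emeasure_M_space in simp)

lemma e_add: "e (n + m) t = e n t * e m t"
  by (simp add: e_def cis_mult ring_distribs add_divide_distrib)

lemma e_0 [simp]: "e 0 t = 1"
  by (simp add: e_def)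

lemma cnj_e: "cnj (e n t) = e (- n) t"
  by (simp add: e_def cis_cnj)

lemma norm_e [simp]: "cmod (e n t) = 1"
  by (simp add: e_def)

lemma continuous_e: "continuous_on A (e n)"
proof -
  have "continuous_on A (\<lambda>t. 2 * pi * of_int n * t * inverse b)"
    by (intro continuous_on_mult continuous_on_const continuous_on_id)
  then have "continuous_on A (\<lambda>t. cis (2 * pi * of_int n * t * inverse b))"
    by (rule continuous_on_cis)
  then show ?thesis by (simp add: e_def[abs_def] divide_inverse)
qed

lemma e_borel [measurable]: "e n \<in> borel_measurable borel"
  by (rule borel_measurable_continuous_onI[OF continuous_e])

lemma e_shift: "e n (t + of_int j * b) = e n t"
proof -
  have "2 * pi * of_int n * (t + of_int j * b) / b = 2 * pi * of_int n * t / b + 2 * pi * of_int (n * j)"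
    using b_pos by (simp add: field_simps)
  then have "e n (t + of_int j * b) = cis (2 * pi * of_int n * t / b + 2 * pi * of_int (n * j))"
    unfolding e_def by (rule arg_cong)
  also have "\<dots> = cis (2 * pi * of_int n * t / b) * cis (2 * pi * of_int (n * j))"
    by (rule cis_mult[symmetric])
  also have "cis (2 * pi * of_int (n * j)) = 1"
    by (rule cis_multiple_2pi) simp
  finally show ?thesis by (simp add: e_def)
qed

lemma integrable_M_e: "integrable M (e n)"
proof -
  interpret finite_measure M by (rule finite_measure_M)
  show ?thesis
    by (rule integrable_const_bound[where B=1]) (auto intro!: measurable_M)
qed

lemma integral_M_e: "(LINT t|M. e n t) = (if n = 0 then of_real b else 0)"
proof (cases "n = 0")
  case True
  then show ?thesis
    using b_pos by (simp add: e_def M_def measure_restrict_space space_restrict_space scaleR_conv_of_real)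
next
  case False
  define w :: complex where "w = \<i> * of_real (2 * pi * of_int n / b)"
  have w0: "w \<noteq> 0" using False b_pos by (simp add: w_def)
  have e_exp: "e n t = exp (w * of_real t)" for t
    by (simp add: e_def w_def cis_conv_exp algebra_simps)
  have "((\<lambda>t. exp (w * of_real t) / w) has_vector_derivative e n t) (at t within A)" for t A
  proof -
    have "((\<lambda>z. exp (w * z) / w) has_field_derivative e n t) (at (of_real t))"
      using w0 by (auto intro!: derivative_eq_intros simp: e_exp)
    then show ?thesis by (rule has_vector_derivative_real_field)
  qed
  then have "has_bochner_integral lborel (\<lambda>x. indicator {0..b} x *\<^sub>R e n x)
      (exp (w * of_real b) / w - exp (w * of_real 0) / w)"
    using b_pos by (intro has_bochner_integral_FTC_Icc continuous_e) auto
  then have "(LINT x|lborel. indicator {0..b} x *\<^sub>R e n x) = (e n b - e n 0) / w"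
    by (simp add: has_bochner_integral_iff e_exp diff_divide_distrib)
  also have "e n b = e n 0" using e_shift[of n 0 1] by simp
  finally have *: "(LINT x|lborel. indicator {0..b} x *\<^sub>R e n x) = 0" by simp
  have "(LINT t|M. e n t) = (LINT x|lborel. indicator {0..<b} x *\<^sub>R e n x)"
    by (simp add: M_def integral_restrict_space set_lebesgue_integral_def)
  also have "\<dots> = (LINT x|lborel. indicator {0..b} x *\<^sub>R e n x)"
  proof (rule integral_cong_AE)
    show "AE x in lborel. indicator {0..<b} x *\<^sub>R e n x = indicator {0..b} x *\<^sub>R e n x"
      using AE_lborel_singleton[of b]
      by eventually_elim (auto simp: indicator_def)
  qed measurable
  finally show ?thesis using * False by simp
qed

text \<open>An inductive predicate instead of a coefficient family: closure under products, needed
  for the polynomials of Stone-Weierstrass, becomes a double induction. \<open>trig_sum_form\<close>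
  recovers coefficients when they are wanted.\<close>

inductive trig :: "(real \<Rightarrow> complex) \<Rightarrow> bool" where
  mono: "trig (\<lambda>t. z * e n t)"
| add: "trig f \<Longrightarrow> trig g \<Longrightarrow> trig (\<lambda>t. f t + g t)"

lemma trig_const: "trig (\<lambda>t. z)"
  using trig.mono[of z 0] by simp

lemma trig_mult_mono: "trig f \<Longrightarrow> trig (\<lambda>t. z * e n t * f t)"
proof (induction rule: trig.induct)
  case (mono w m)
  show ?case using trig.mono[of "z * w" "n + m"] by (simp add: e_add mult_ac)
next
  case (add f g)
  then show ?case using trig.add by (simp add: distrib_left)
qed

lemma trig_mult: "trig f \<Longrightarrow> trig g \<Longrightarrow> trig (\<lambda>t. f t * g t)"
proof (induction rule: trig.induct)
  case (mono w m)
  then show ?case by (rule trig_mult_mono)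
next
  case (add f g)
  then show ?case using trig.add by (simp add: distrib_right)
qed

lemma trig_cmult: "trig f \<Longrightarrow> trig (\<lambda>t. z * f t)"
  using trig_mult[OF trig_const] .

lemma trig_borel: "trig f \<Longrightarrow> f \<in> borel_measurable borel"
  by (induction rule: trig.induct) measurable

lemma trig_sum_form:
  assumes "trig f"
  obtains F \<alpha> where "finite F" "f = (\<lambda>t. \<Sum>n\<in>F. \<alpha> n * e n t)"
proof -
  have "\<exists>F \<alpha>. finite F \<and> (\<forall>n. n \<notin> F \<longrightarrow> \<alpha> n = 0) \<and> f = (\<lambda>t. \<Sum>n\<in>F. \<alpha> n * e n t)"
    using assms
  proof (induction rule: trig.induct)
    case (mono z n)
    show ?case
      by (rule exI[of _ "{n}"], rule exI[of _ "\<lambda>m. if m = n then z else 0"]) auto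
  next
    case (add f g)
    from add.IH(1) obtain F \<alpha> where F: "finite F" "\<forall>n. n \<notin> F \<longrightarrow> \<alpha> n = 0"
      "f = (\<lambda>t. \<Sum>n\<in>F. \<alpha> n * e n t)" by (elim exE conjE)
    from add.IH(2) obtain G \<beta> where G: "finite G" "\<forall>n. n \<notin> G \<longrightarrow> \<beta> n = 0"
      "g = (\<lambda>t. \<Sum>n\<in>G. \<beta> n * e n t)" by (elim exE conjE)
    have "f t + g t = (\<Sum>n\<in>F \<union> G. (\<alpha> n + \<beta> n) * e n t)" for t
    proof -
      have "f t = (\<Sum>n\<in>F \<union> G. \<alpha> n * e n t)"
        unfolding F(3) by (rule sum.mono_neutral_left) (use F G in auto)
      moreover have "g t = (\<Sum>n\<in>F \<union> G. \<beta> n * e n t)"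
        unfolding G(3) by (rule sum.mono_neutral_left) (use F G in auto)
      ultimately show ?thesis by (simp add: sum.distrib distrib_right)
    qed
    then have "(\<lambda>t. f t + g t) = (\<lambda>t. \<Sum>n\<in>F \<union> G. (\<alpha> n + \<beta> n) * e n t)" by (rule ext)
    moreover have "finite (F \<union> G)" using F G by simp
    moreover have "\<forall>n. n \<notin> F \<union> G \<longrightarrow> \<alpha> n + \<beta> n = 0" using F G by simp
    ultimately show ?case by (intro exI[of _ "F \<union> G"] exI[of _ "\<lambda>n. \<alpha> n + \<beta> n"] conjI)
  qed
  with that show ?thesis by blast
qed

lemma trig_real_polynomial:
  fixes P :: "complex \<Rightarrow> real"
  assumes "real_polynomial_function P"
  shows "trig (\<lambda>t. of_real (P (e 1 t)))"
  using assms
proof (induction rule: real_polynomial_function.induct)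
  case (linear h)
  interpret bounded_linear h by fact
  define \<alpha> where "\<alpha> = h 1" 
  define \<beta> where "\<beta> = h \<i>"
  have "h z = Re z * \<alpha> + Im z * \<beta>" for z
  proof -
    have "h z = h (Re z *\<^sub>R 1 + Im z *\<^sub>R \<i>)" by (rule arg_cong[where f=h]) (simp add: complex_eq_iff)
    also have "\<dots> = Re z * \<alpha> + Im z * \<beta>" by (simp only: add scaleR \<alpha>_def \<beta>_def real_scaleR_def)
    finally show ?thesis .
  qed
  \<comment> \<open>\<open>\<alpha> Re z + \<beta> Im z\<close> is the real part of
    \<open>(\<alpha> - i \<beta>) z\<close>, that is, half the sum of this number and its
    conjugate.\<close>
  then have "of_real (h z) = Complex (\<alpha> / 2) (- \<beta> / 2) * z + Complex (\<alpha> / 2) (\<beta> / 2) * cnj z" for z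
    by (simp add: complex_eq_iff field_simps)
  then have "(\<lambda>t. of_real (h (e 1 t))) =
      (\<lambda>t. Complex (\<alpha> / 2) (- \<beta> / 2) * e 1 t + Complex (\<alpha> / 2) (\<beta> / 2) * e (- 1) t)"
    by (simp add: cnj_e)
  then show ?case using trig.add[OF trig.mono trig.mono] by simp
next
  case (const c)
  then show ?case by (rule trig_const)
next
  case (add f g)
  then show ?case using trig.add by simp
next
  case (mult f g)
  then show ?case using trig_mult by simp
qed

section \<open>Density of trigonometric polynomials in the L2 space of one period\<close>

definition appr :: "(real \<Rightarrow> complex) \<Rightarrow> bool" where
  "appr g \<longleftrightarrow> g \<in> borel_measurable M \<and>
     (\<forall>r>0. \<exists>p. trig p \<and> (\<integral>\<^sup>+t. ennreal ((cmod (g t - p t))\<^sup>2) \<partial>M) < ennreal r)"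

lemma norm_add_square_le: "(cmod (x + y))\<^sup>2 \<le> 2 * (cmod x)\<^sup>2 + 2 * (cmod y)\<^sup>2"
proof -
  have "(cmod (x + y))\<^sup>2 \<le> (cmod x + cmod y)\<^sup>2"
    by (intro power_mono norm_triangle_ineq) auto
  also have "\<dots> \<le> 2 * (cmod x)\<^sup>2 + 2 * (cmod y)\<^sup>2"
    using zero_le_power2[of "cmod x - cmod y"] by (simp add: power2_eq_square algebra_simps)
  finally show ?thesis .
qed

text \<open>The thresholds \<open>r / 4\<close> match the factors 2 in
  \<open>norm_add_square_le\<close>: two terms, each doubled, stay below
  \<open>r / 2 + r / 2\<close>.\<close>

lemma nn_integral_norm_add_square:
  assumes [measurable]: "f \<in> borel_measurable M" "g \<in> borel_measurable M"
    and f: "(\<integral>\<^sup>+t. ennreal ((cmod (f t))\<^sup>2) \<partial>M) < ennreal (r / 4)"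
    and g: "(\<integral>\<^sup>+t. ennreal ((cmod (g t))\<^sup>2) \<partial>M) < ennreal (r / 4)"
  shows "(\<integral>\<^sup>+t. ennreal ((cmod (f t + g t))\<^sup>2) \<partial>M) < ennreal r"
proof -
  have "(\<integral>\<^sup>+t. ennreal ((cmod (f t + g t))\<^sup>2) \<partial>M)
      \<le> (\<integral>\<^sup>+t. 2 * ennreal ((cmod (f t))\<^sup>2) + 2 * ennreal ((cmod (g t))\<^sup>2) \<partial>M)"
  proof (rule nn_integral_mono)
    fix t
    have "ennreal ((cmod (f t + g t))\<^sup>2) \<le> ennreal (2 * (cmod (f t))\<^sup>2 + 2 * (cmod (g t))\<^sup>2)"
      by (intro ennreal_leI norm_add_square_le)
    then show "ennreal ((cmod (f t + g t))\<^sup>2) \<le> 2 * ennreal ((cmod (f t))\<^sup>2) + 2 * ennreal ((cmod (g t))\<^sup>2)"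
      by (simp add: ennreal_plus ennreal_mult)
  qed
  also have "\<dots> = 2 * (\<integral>\<^sup>+t. ennreal ((cmod (f t))\<^sup>2) \<partial>M) + 2 * (\<integral>\<^sup>+t. ennreal ((cmod (g t))\<^sup>2) \<partial>M)"
    by (simp add: nn_integral_add nn_integral_cmult)
  also have "\<dots> < ennreal r"
  proof -
    obtain x where x: "(\<integral>\<^sup>+t. ennreal ((cmod (f t))\<^sup>2) \<partial>M) = ennreal x" "0 \<le> x"
      using f by (metis ennreal_cases infinity_ennreal_def not_less_iff_gr_or_eq top.not_eq_extremum ennreal_less_top less_trans)
    obtain y where y: "(\<integral>\<^sup>+t. ennreal ((cmod (g t))\<^sup>2) \<partial>M) = ennreal y" "0 \<le> y"
      using g by (metis ennreal_cases infinity_ennreal_def not_less_iff_gr_or_eq top.not_eq_extremum ennreal_less_top less_trans)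
    have "x < r / 4" "y < r / 4" using f g x y by (auto simp: ennreal_less_iff)
    then have "2 * x + 2 * y < r" by simp
    then have "ennreal (2 * x + 2 * y) < ennreal r" using x(2) y(2) by (intro ennreal_lessI) auto
    then show ?thesis using x y by (simp add: ennreal_plus ennreal_mult)
  qed
  finally show ?thesis .
qed

lemma appr_close:
  assumes "g \<in> borel_measurable M"
    and "\<And>r. 0 < r \<Longrightarrow> \<exists>h. appr h \<and> (\<integral>\<^sup>+t. ennreal ((cmod (g t - h t))\<^sup>2) \<partial>M) < ennreal r"
  shows "appr g"
  unfolding appr_def
proof (intro conjI allI impI)
  fix r :: real assume "0 < r"
  then obtain h where h: "appr h" "(\<integral>\<^sup>+t. ennreal ((cmod (g t - h t))\<^sup>2) \<partial>M) < ennreal (r / 4)"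
    using assms(2)[of "r / 4"] by auto
  then obtain p where p: "trig p" "(\<integral>\<^sup>+t. ennreal ((cmod (h t - p t))\<^sup>2) \<partial>M) < ennreal (r / 4)"
    using \<open>0 < r\<close> unfolding appr_def by (metis divide_pos_pos zero_less_numeral)
  have [measurable]: "h \<in> borel_measurable M" "p \<in> borel_measurable M" "g \<in> borel_measurable M"
    using h p assms(1) trig_borel measurable_M by (auto simp: appr_def)
  have "(\<integral>\<^sup>+t. ennreal ((cmod ((g t - h t) + (h t - p t)))\<^sup>2) \<partial>M) < ennreal r"
    by (rule nn_integral_norm_add_square) (use h p in auto)
  then show "\<exists>p. trig p \<and> (\<integral>\<^sup>+t. ennreal ((cmod (g t - p t))\<^sup>2) \<partial>M) < ennreal r"
    using p(1) by auto
qed (rule assms(1))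

lemma appr_trig: "trig p \<Longrightarrow> appr p"
  unfolding appr_def by (intro conjI allI impI exI[of _ p] measurable_M trig_borel) simp_all

lemma appr_add:
  assumes "appr f" "appr g"
  shows "appr (\<lambda>t. f t + g t)"
  unfolding appr_def
proof (intro conjI allI impI)
  have [measurable]: "f \<in> borel_measurable M" "g \<in> borel_measurable M" using assms by (simp_all add: appr_def)
  show "(\<lambda>t. f t + g t) \<in> borel_measurable M" by measurable
next
  fix r :: real assume "0 < r"
  then have r: "0 < r / 4" by simp
  obtain p where p: "trig p" "(\<integral>\<^sup>+t. ennreal ((cmod (f t - p t))\<^sup>2) \<partial>M) < ennreal (r / 4)"
    using assms(1) r unfolding appr_def by blast
  obtain q where q: "trig q" "(\<integral>\<^sup>+t. ennreal ((cmod (g t - q t))\<^sup>2) \<partial>M) < ennreal (r / 4)"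
    using assms(2) r unfolding appr_def by blast
  have [measurable]: "f \<in> borel_measurable M" "p \<in> borel_measurable M" "g \<in> borel_measurable M" "q \<in> borel_measurable M"
    using assms p q trig_borel measurable_M by (auto simp: appr_def)
  have "(\<integral>\<^sup>+t. ennreal ((cmod ((f t - p t) + (g t - q t)))\<^sup>2) \<partial>M) < ennreal r"
    by (rule nn_integral_norm_add_square) (use p q in auto)
  then show "\<exists>p. trig p \<and> (\<integral>\<^sup>+t. ennreal ((cmod (f t + g t - p t))\<^sup>2) \<partial>M) < ennreal r"
    using trig.add[OF p(1) q(1)] by (intro exI[of _ "\<lambda>t. p t + q t"]) (simp add: algebra_simps)
qed

lemma appr_cmult:
  assumes "appr f"
  shows "appr (\<lambda>t. z * f t)"
proof (cases "z = 0")
  case True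
  then show ?thesis using appr_trig[OF trig_const[of 0]] by simp
next
  case False
  have [measurable]: "f \<in> borel_measurable M" using assms by (simp add: appr_def)
  show ?thesis
    unfolding appr_def
  proof (intro conjI allI impI)
    show "(\<lambda>t. z * f t) \<in> borel_measurable M" by measurable
    fix r :: real assume "0 < r"
    then have "0 < r / (cmod z)\<^sup>2" using False by simp
    then obtain p where p: "trig p" "(\<integral>\<^sup>+t. ennreal ((cmod (f t - p t))\<^sup>2) \<partial>M) < ennreal (r / (cmod z)\<^sup>2)"
      using assms unfolding appr_def by metis
    have [measurable]: "f \<in> borel_measurable M" "p \<in> borel_measurable M"
      using assms p trig_borel measurable_M by (auto simp: appr_def)
    have "(\<integral>\<^sup>+t. ennreal ((cmod (z * f t - z * p t))\<^sup>2) \<partial>M)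
        = (\<integral>\<^sup>+t. ennreal ((cmod z)\<^sup>2) * ennreal ((cmod (f t - p t))\<^sup>2) \<partial>M)"
      by (intro nn_integral_cong) (simp add: right_diff_distrib[symmetric] norm_mult power_mult_distrib ennreal_mult)
    also have "\<dots> = ennreal ((cmod z)\<^sup>2) * (\<integral>\<^sup>+t. ennreal ((cmod (f t - p t))\<^sup>2) \<partial>M)"
      by (simp add: nn_integral_cmult)
    also have "\<dots> < ennreal ((cmod z)\<^sup>2) * ennreal (r / (cmod z)\<^sup>2)"
      using p(2) False by (intro ennreal_mult_strict_left_mono) auto
    also have "\<dots> = ennreal r"
      using False \<open>0 < r\<close> by (simp add: ennreal_mult[symmetric])
    finally show "\<exists>p. trig p \<and> (\<integral>\<^sup>+t. ennreal ((cmod (z * f t - p t))\<^sup>2) \<partial>M) < ennreal r"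
      using trig_cmult[OF p(1)] by blast
  qed
qed

lemma appr_sum: "finite I \<Longrightarrow> (\<And>i. i \<in> I \<Longrightarrow> appr (f i)) \<Longrightarrow> appr (\<lambda>t. \<Sum>i\<in>I. f i t)"
proof (induction rule: finite_induct)
  case empty
  then show ?case using appr_trig[OF trig_const[of 0]] by simp
next
  case (insert i I)
  have "appr (f i)" by (rule insert.prems) simp
  moreover have "appr (\<lambda>t. \<Sum>i\<in>I. f i t)" by (rule insert.IH, rule insert.prems) simp
  ultimately have "appr (\<lambda>t. f i t + (\<Sum>i\<in>I. f i t))" by (rule appr_add)
  then show ?case by (simp only: sum.insert[OF insert.hyps])
qed

lemma appr_limit:
  assumes g: "g \<in> borel_measurable M" and h: "\<And>i. appr (h i)"
    and lim: "\<And>t. t \<in> space M \<Longrightarrow> (\<lambda>i. h i t) \<longlonglongrightarrow> g t"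
    and dom: "\<And>i t. t \<in> space M \<Longrightarrow> (cmod (g t - h i t))\<^sup>2 \<le> w t"
    and w: "w \<in> borel_measurable M" "(\<integral>\<^sup>+t. ennreal (w t) \<partial>M) < \<infinity>"
  shows "appr g"
proof (rule appr_close[OF g])
  fix r :: real assume r: "0 < r"
  have hm [measurable]: "h i \<in> borel_measurable M" for i using h by (auto simp: appr_def)
  note [measurable] = g w(1)
  have "(\<lambda>i. \<integral>\<^sup>+t. ennreal ((cmod (g t - h i t))\<^sup>2) \<partial>M) \<longlonglongrightarrow> (\<integral>\<^sup>+t. 0 \<partial>M)"
  proof (rule nn_integral_dominated_convergence[where w="\<lambda>t. ennreal (w t)"])
    show "AE t in M. ennreal ((cmod (g t - h j t))\<^sup>2) \<le> ennreal (w t)" for j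
      using dom by (auto intro!: AE_I2 ennreal_leI)
    show "AE t in M. (\<lambda>i. ennreal ((cmod (g t - h i t))\<^sup>2)) \<longlonglongrightarrow> 0"
    proof (rule AE_I2)
      fix t assume "t \<in> space M"
      then have "(\<lambda>i. (cmod (g t - h i t))\<^sup>2) \<longlonglongrightarrow> (cmod (g t - g t))\<^sup>2"
        using lim by (intro tendsto_intros) auto
      then show "(\<lambda>i. ennreal ((cmod (g t - h i t))\<^sup>2)) \<longlonglongrightarrow> 0"
        using tendsto_ennrealI by fastforce
    qed
  qed (use w in auto)
  then have "(\<lambda>i. \<integral>\<^sup>+t. ennreal ((cmod (g t - h i t))\<^sup>2) \<partial>M) \<longlonglongrightarrow> 0" by simp
  then have "eventually (\<lambda>i. (\<integral>\<^sup>+t. ennreal ((cmod (g t - h i t))\<^sup>2) \<partial>M) < ennreal r) sequentially"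
    using r by (intro order_tendstoD(2)) auto
  then show "\<exists>h. appr h \<and> (\<integral>\<^sup>+t. ennreal ((cmod (g t - h t))\<^sup>2) \<partial>M) < ennreal r"
    using h by (auto simp: eventually_sequentially)
qed

lemma nn_integral_M_const_finite: "(\<integral>\<^sup>+t. ennreal r \<partial>M) < \<infinity>"
  using emeasure_M_space by (simp add: ennreal_mult_less_top)

text \<open>Stone-Weierstrass on the unit circle. A function of the shape \<open>G (e 1 t)\<close>
  is periodic by construction, so no boundary condition at \<open>0\<close> and \<open>b\<close>
  arises.\<close>

lemma appr_continuous:
  fixes G :: "complex \<Rightarrow> real"
  assumes "continuous_on UNIV G"
  shows "appr (\<lambda>t. of_real (G (e 1 t)))"
proof -
  have "\<exists>P. real_polynomial_function P \<and> (\<forall>z\<in>sphere 0 1. \<bar>G z - P z\<bar> < inverse (real (Suc i)))" for i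
    using Stone_Weierstrass_real_polynomial_function[of "sphere 0 1" G "inverse (real (Suc i))"]
      continuous_on_subset[OF assms] by (metis compact_sphere inverse_positive_iff_positive of_nat_0_less_iff subset_UNIV zero_less_Suc)
  then obtain P where P: "\<And>i. real_polynomial_function (P i)"
      "\<And>i z. z \<in> sphere 0 1 \<Longrightarrow> \<bar>G z - P i z\<bar> < inverse (real (Suc i))" by metis
  have Pe: "\<bar>G (e 1 t) - P i (e 1 t)\<bar> < inverse (real (Suc i))" for i t
    using P(2) by simp
  show ?thesis
  proof (rule appr_limit[where h="\<lambda>i t. of_real (P i (e 1 t))" and w="\<lambda>_. 1"])
    have [measurable]: "G \<in> borel_measurable borel" using assms by (rule borel_measurable_continuous_onI)
    show "(\<lambda>t. complex_of_real (G (e 1 t))) \<in> borel_measurable M"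
      by (intro measurable_M) measurable
    show "appr (\<lambda>t. complex_of_real (P i (e 1 t)))" for i
      by (intro appr_trig trig_real_polynomial P)
    show "(\<lambda>i. complex_of_real (P i (e 1 t))) \<longlonglongrightarrow> complex_of_real (G (e 1 t))" for t
    proof (intro tendsto_of_real)
      have "(\<lambda>i. P i (e 1 t) - G (e 1 t)) \<longlonglongrightarrow> 0"
        by (rule tendsto_rabs_zero_cancel, rule tendsto_sandwich[OF _ _ tendsto_const LIMSEQ_inverse_real_of_nat])
          (use Pe in \<open>auto intro!: always_eventually simp: abs_minus_commute less_imp_le\<close>)
      then show "(\<lambda>i. P i (e 1 t)) \<longlonglongrightarrow> G (e 1 t)" by (simp add: LIM_zero_iff)
    qed
    show "(cmod (complex_of_real (G (e 1 t)) - complex_of_real (P i (e 1 t))))\<^sup>2 \<le> 1" for i t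
    proof -
      have "\<bar>G (e 1 t) - P i (e 1 t)\<bar> \<le> 1"
        using Pe[of t i] by (smt (verit) inverse_le_1_iff of_nat_Suc of_nat_0_le_iff)
      then show ?thesis
        by (simp add: abs_square_le_1 flip: of_real_diff)
    qed
    show "(\<integral>\<^sup>+t. ennreal 1 \<partial>M) < \<infinity>" by (rule nn_integral_M_const_finite)
  qed auto
qed

text \<open>The functions \<open>h i\<close> are continuous cut-offs, equal to 1 on \<open>C\<close>
  and to 0 where \<open>i * infdist z C\<close> is at least 1. Closedness makes the distance
  positive off \<open>C\<close>, so they converge to the indicator everywhere.\<close>

lemma appr_indicator_closed:
  fixes C :: "complex set"
  assumes "closed C"
  shows "appr (\<lambda>t. indicator C (e 1 t))"
\<comment> \<open>\<open>infdist\<close> to the empty set is 0, so the cut-offs would be constantly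
  1 there.\<close>
proof (cases "C = {}")
  case True
  then show ?thesis using appr_trig[OF trig_const[of 0]] by simp
next
  case False
  define h where "h i z = max 0 (1 - real i * infdist z C)" for i :: nat and z
  have h01: "0 \<le> h i z" "h i z \<le> 1" for i z using infdist_nonneg[of z C] by (auto simp: h_def)
  show ?thesis
  proof (rule appr_limit[where h="\<lambda>i t. of_real (h i (e 1 t))" and w="\<lambda>_. 1"])
    have [measurable]: "C \<in> sets borel" using assms by (rule borel_closed)
    show "(\<lambda>t. indicator C (e 1 t) :: complex) \<in> borel_measurable M"
      by (intro measurable_M) measurable
    show "appr (\<lambda>t. complex_of_real (h i (e 1 t)))" for i
      unfolding h_def by (intro appr_continuous continuous_intros)
    show "(\<lambda>i. complex_of_real (h i (e 1 t))) \<longlonglongrightarrow> indicator C (e 1 t)" for t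
    proof (cases "e 1 t \<in> C")
      case True
      then show ?thesis by (simp add: h_def)
    next
      case False
      then have pos: "0 < infdist (e 1 t) C"
        using assms \<open>C \<noteq> {}\<close> by (metis in_closed_iff_infdist_zero infdist_nonneg less_le)
      obtain n where n: "real n * infdist (e 1 t) C > 1"
        using reals_Archimedean3[OF pos] by blast
      have "\<forall>\<^sub>F i in sequentially. complex_of_real (h i (e 1 t)) = 0"
        using eventually_ge_at_top[of n]
      proof eventually_elim
        case (elim i)
        have "1 < real n * infdist (e 1 t) C" by (rule n)
        also have "\<dots> \<le> real i * infdist (e 1 t) C" using elim pos by (intro mult_right_mono) auto
        finally show ?case by (simp add: h_def)
      qed
      then show ?thesis using False by (simp add: tendsto_eventually)
    qed
    show "(cmod (indicator C (e 1 t) - complex_of_real (h i (e 1 t))))\<^sup>2 \<le> 1" for i t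
    proof -
      have "indicator C (e 1 t) - complex_of_real (h i (e 1 t)) = of_real (indicator C (e 1 t) - h i (e 1 t))"
        by (simp add: indicator_def)
      moreover have "\<bar>indicator C (e 1 t) - h i (e 1 t)\<bar> \<le> 1"
        using h01[of i "e 1 t"] by (auto simp: indicator_def)
      ultimately show ?thesis by (simp only: norm_of_real abs_square_le_1 abs_abs)
    qed
    show "(\<integral>\<^sup>+t. ennreal 1 \<partial>M) < \<infinity>" by (rule nn_integral_M_const_finite)
  qed auto
qed

text \<open>Dynkin's argument: the closed sets are an intersection-stable generator, and
  \<open>appr\<close> passes to complements by linearity and to disjoint countable unions by
  dominated convergence.\<close>

lemma appr_indicator_borel:
  fixes E :: "complex set"
  assumes "E \<in> sets borel"
  shows "appr (\<lambda>t. indicator E (e 1 t))"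
proof -
  have "Int_stable (Collect closed :: complex set set)" 
    by (auto simp: Int_stable_def)
  moreover have "Collect closed \<subseteq> Pow (UNIV :: complex set)" by simp
  moreover have "E \<in> sigma_sets UNIV (Collect closed)"
    using assms by (simp add: borel_eq_closed sets_measure_of)
  ultimately show ?thesis
  proof (induction rule: sigma_sets_induct_disjoint)
    case (basic A)
    then show ?case by (simp add: appr_indicator_closed)
  next
    case empty
    then show ?case using appr_indicator_closed[of "{}"] by simp
  next
    case (compl A)
    have "appr (\<lambda>t. 1 + (- 1) * indicator A (e 1 t))"
      by (intro appr_add appr_cmult compl appr_trig trig_const)
    moreover have "(\<lambda>t. indicator (UNIV - A) (e 1 t)) = (\<lambda>t. 1 + (- 1) * indicator A (e 1 t) :: complex)"
      by (auto simp: fun_eq_iff indicator_def)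
    ultimately show ?case by simp
  next
    case (union A)
    define h :: "nat \<Rightarrow> real \<Rightarrow> complex" where "h n t = (\<Sum>i<n. indicator (A i) (e 1 t))" for n t
    have h_eq: "h n t = indicator (\<Union>i<n. A i) (e 1 t)" for n t
      unfolding h_def using union(1)
      by (subst indicator_UN_disjoint) (auto simp: disjoint_family_on_def)
    have A [measurable]: "A i \<in> sets borel" for i
      using union(2) by (auto simp: borel_eq_closed sets_measure_of)
    show ?case
    proof (rule appr_limit[where h=h and w="\<lambda>_. 1"])
      have [measurable]: "\<Union> (range A) \<in> sets borel" using A by blast
      show "(\<lambda>t. indicator (\<Union> (range A)) (e 1 t) :: complex) \<in> borel_measurable M"
        by (intro measurable_M) measurable
      show "appr (h i)" for i
        unfolding h_def by (intro appr_sum union) auto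
      show "(\<lambda>i. h i t) \<longlonglongrightarrow> indicator (\<Union> (range A)) (e 1 t)" for t
        unfolding h_eq by (rule LIMSEQ_indicator_UN)
      show "(cmod (indicator (\<Union> (range A)) (e 1 t) - h i t))\<^sup>2 \<le> 1" for i t
        unfolding h_eq by (auto simp: indicator_def)
      show "(\<integral>\<^sup>+t. ennreal 1 \<partial>M) < \<infinity>" by (rule nn_integral_M_const_finite)
    qed auto
  qed
qed

lemma appr_simple_function:
  assumes "simple_function borel F"
  shows "appr (\<lambda>t. F (e 1 t))"
proof -
  have fin: "finite (range F)" and sets: "\<And>y. F -` {y} \<in> sets borel"
    using simple_functionD[OF assms] by auto
  have "F (e 1 t) = (\<Sum>y\<in>range F. y * indicator (F -` {y}) (e 1 t))" for t
  proof -
    have "(\<Sum>y\<in>range F. y * indicator (F -` {y}) (e 1 t)) = (\<Sum>y\<in>range F. if y = F (e 1 t) then y else 0)"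
      by (intro sum.cong) (auto simp: indicator_def)
    then show ?thesis using fin by simp
  qed
  moreover have "appr (\<lambda>t. \<Sum>y\<in>range F. y * indicator (F -` {y}) (e 1 t))"
    by (rule appr_sum[OF fin], rule appr_cmult, rule appr_indicator_borel, rule sets)
  ultimately show ?thesis by presburger
qed

lemma Arg2pi_measurable [measurable]: "Arg2pi \<in> borel_measurable borel"
proof -
  have c: "continuous_on (- \<real>\<^sub>\<ge>\<^sub>0) Arg2pi"
    by (auto intro!: continuous_at_imp_continuous_on continuous_at_Arg2pi)
  have "(\<lambda>z. if z \<in> \<real>\<^sub>\<ge>\<^sub>0 then 0 else Arg2pi z) \<in> borel_measurable borel"
    by (rule borel_measurable_continuous_on_if) (use c in auto)
  moreover have "(\<lambda>z. if z \<in> \<real>\<^sub>\<ge>\<^sub>0 then 0 else Arg2pi z) = Arg2pi"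
    by (auto simp: fun_eq_iff Arg2pi_eq_0 complex_nonneg_Reals_iff complex_is_Real_iff)
  ultimately show ?thesis by simp
qed

text \<open>On \<open>{0..<b}\<close> the map \<open>e 1\<close> has the Borel inverse
  \<open>h\<close>, built from the argument. So \<open>g\<close> is a Borel function of
  \<open>e 1 t\<close>, and simple functions on the circle approximate it.\<close>

lemma appr_L2:
  assumes [measurable]: "g \<in> borel_measurable borel"
    and fin: "(\<integral>\<^sup>+t. ennreal ((cmod (g t))\<^sup>2) \<partial>M) < \<infinity>"
  shows "appr g"
proof -
  define h where "h z = Arg2pi z * b / (2 * pi)" for z
  have [measurable]: "h \<in> borel_measurable borel" unfolding h_def[abs_def] by measurable
  have h: "h (e 1 t) = t" if "t \<in> {0..<b}" for t
  proof -
    have "Arg2pi (e 1 t) = 2 * pi * t / b"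
      by (rule Arg2pi_unique[where r=1]) (use that b_pos in \<open>auto simp: e_def cis_conv_exp field_simps\<close>)
    then show ?thesis using b_pos by (simp add: h_def)
  qed
  have "(\<lambda>z. g (h z)) \<in> borel_measurable borel" by measurable
  from borel_measurable_implies_sequence_metric[OF this, of 0]
  obtain F where F: "\<And>i. simple_function borel (F i)" "\<And>z. (\<lambda>i. F i z) \<longlonglongrightarrow> g (h z)"
    "\<And>i z. cmod (F i z) \<le> 2 * cmod (g (h z))" by (auto simp: dist_norm)
  show ?thesis
  \<comment> \<open>The simple functions satisfy \<open>|F| \<le> 2 |g|\<close>, hence
    \<open>|g - F| \<le> 3 |g|\<close>; squaring gives the factor 9.\<close>
  proof (rule appr_limit[where h="\<lambda>i t. F i (e 1 t)" and w="\<lambda>t. 9 * (cmod (g t))\<^sup>2"])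
    show "g \<in> borel_measurable M" by (rule measurable_M) measurable
    show "appr (\<lambda>t. F i (e 1 t))" for i by (rule appr_simple_function[OF F(1)])
    show "(\<lambda>i. F i (e 1 t)) \<longlonglongrightarrow> g t" if "t \<in> space M" for t
      using F(2)[of "e 1 t"] h[of t] that by simp
    show "(cmod (g t - F i (e 1 t)))\<^sup>2 \<le> 9 * (cmod (g t))\<^sup>2" if "t \<in> space M" for i t
    proof -
      have "cmod (g t - F i (e 1 t)) \<le> cmod (g t) + cmod (F i (e 1 t))" by (rule norm_triangle_ineq4)
      also have "\<dots> \<le> 3 * cmod (g t)" using F(3)[of i "e 1 t"] h[of t] that by simp
      finally have "(cmod (g t - F i (e 1 t)))\<^sup>2 \<le> (3 * cmod (g t))\<^sup>2" by (intro power_mono) auto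
      then show ?thesis by (simp add: power_mult_distrib)
    qed
    show "(\<lambda>t. 9 * (cmod (g t))\<^sup>2) \<in> borel_measurable M" by (rule measurable_M) measurable
    have [measurable]: "(\<lambda>t. ennreal ((cmod (g t))\<^sup>2)) \<in> borel_measurable M" by (rule measurable_M) measurable
    have "(\<integral>\<^sup>+t. ennreal (9 * (cmod (g t))\<^sup>2) \<partial>M) = (\<integral>\<^sup>+t. 9 * ennreal ((cmod (g t))\<^sup>2) \<partial>M)"
      by (simp add: ennreal_mult)
    also have "\<dots> = 9 * (\<integral>\<^sup>+t. ennreal ((cmod (g t))\<^sup>2) \<partial>M)" by (rule nn_integral_cmult) measurable
    also have "\<dots> < \<infinity>" using fin by (simp add: ennreal_mult_less_top)
    finally show "(\<integral>\<^sup>+t. ennreal (9 * (cmod (g t))\<^sup>2) \<partial>M) < \<infinity>" .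
  qed
qed

end

text \<open>Bridge between the \<open>infsum\<close> in the definition of a frame and integrals over
  \<open>count_space\<close>, for which sums and integrals are interchanged by Tonelli.\<close>

lemma nn_integral_count_space_eq_infsum:
  fixes f :: "'i::countable \<Rightarrow> ennreal"
  shows "(\<integral>\<^sup>+i. f i \<partial>count_space UNIV) = (\<Sum>\<^sub>\<infinity>i. f i)"
proof (rule antisym)
  have sup: "(\<Sum>\<^sub>\<infinity>i. f i) = (SUP F\<in>{F. finite F \<and> F \<subseteq> UNIV}. sum f F)"
    by (rule nonneg_infsum_complete) simp
  define R where "R = range (to_nat :: 'i \<Rightarrow> nat)"
  have "(\<integral>\<^sup>+i. f i \<partial>count_space UNIV) = (\<integral>\<^sup>+n. f (from_nat n) \<partial>count_space R)"
    using nn_integral_bij_count_space[of to_nat "UNIV :: 'i set" R "\<lambda>n. f (from_nat n)"]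
    by (simp add: R_def inj_on_imp_bij_betw)
  also have "\<dots> = (\<integral>\<^sup>+n. f (from_nat n) * indicator R n \<partial>count_space UNIV)"
    by (simp add: nn_integral_count_space_indicator)
  also have "\<dots> = (\<Sum>n. f (from_nat n) * indicator R n)"
    by (rule nn_integral_count_space_nat)
  also have "\<dots> \<le> (\<Sum>\<^sub>\<infinity>i. f i)"
  proof (rule suminf_le_const)
    fix n
    have "(\<Sum>k<n. f (from_nat k) * indicator R k) = (\<Sum>k\<in>{..<n} \<inter> R. f (from_nat k))"
      by (simp add: sum.inter_restrict indicator_def if_distrib cong: if_cong)
    also have "\<dots> = sum f (from_nat ` ({..<n} \<inter> R))"
      by (subst sum.reindex) (auto simp: R_def intro!: inj_onI)
    also have "\<dots> \<le> (\<Sum>\<^sub>\<infinity>i. f i)"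
      unfolding sup by (rule SUP_upper) auto
    finally show "(\<Sum>k<n. f (from_nat k) * indicator R k) \<le> (\<Sum>\<^sub>\<infinity>i. f i)" .
  qed simp
  finally show "(\<integral>\<^sup>+i. f i \<partial>count_space UNIV) \<le> (\<Sum>\<^sub>\<infinity>i. f i)" .
  show "(\<Sum>\<^sub>\<infinity>i. f i) \<le> (\<integral>\<^sup>+i. f i \<partial>count_space UNIV)"
    unfolding sup
  proof (rule SUP_least)
    fix F :: "'i set" assume "F \<in> {F. finite F \<and> F \<subseteq> UNIV}"
    then have "sum f F = (\<integral>\<^sup>+i. f i \<partial>count_space F)"
      by (simp add: nn_integral_count_space_finite)
    also have "\<dots> = (\<integral>\<^sup>+i. f i * indicator F i \<partial>count_space UNIV)"
      by (simp add: nn_integral_count_space_indicator)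
    also have "\<dots> \<le> (\<integral>\<^sup>+i. f i \<partial>count_space UNIV)"
      by (intro nn_integral_mono) (simp add: indicator_def)
    finally show "sum f F \<le> (\<integral>\<^sup>+i. f i \<partial>count_space UNIV)" .
  qed
qed

lemma nn_integral_count_space_le:
  fixes f :: "'i::countable \<Rightarrow> ennreal"
  assumes "\<And>F. finite F \<Longrightarrow> sum f F \<le> B"
  shows "(\<integral>\<^sup>+i. f i \<partial>count_space UNIV) \<le> B"
  unfolding nn_integral_count_space_eq_infsum
  by (subst nonneg_infsum_complete) (auto intro!: SUP_least assms)

lemma sum_le_nn_integral_count_space:
  fixes f :: "'i::countable \<Rightarrow> ennreal"
  assumes "finite F"
  shows "sum f F \<le> (\<integral>\<^sup>+i. f i \<partial>count_space UNIV)"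
  unfolding nn_integral_count_space_eq_infsum
  by (subst nonneg_infsum_complete) (use assms in \<open>auto intro!: SUP_upper\<close>)

section \<open>Orthogonality and Parseval's identity\<close>

context fourier
begin

definition fourier_coeff :: "(real \<Rightarrow> complex) \<Rightarrow> int \<Rightarrow> complex" where
  "fourier_coeff g n = (LINT t|M. g t * cnj (e n t))"

lemma e_measurable_M [measurable]: "e n \<in> borel_measurable M"
  by (rule measurable_M) measurable

lemma integrable_mult_bounded:
  assumes g [measurable]: "g \<in> borel_measurable M" and sq: "integrable M (\<lambda>t. (cmod (g t))\<^sup>2)"
    and q [measurable]: "q \<in> borel_measurable M" and B: "\<And>t. cmod (q t) \<le> B"
  shows "integrable M (\<lambda>t. g t * q t)"
proof (rule Bochner_Integration.integrable_bound)
  interpret finite_measure M by (rule finite_measure_M)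
  show "integrable M (\<lambda>t. B * (1 + (cmod (g t))\<^sup>2))"
    using sq by (intro integrable_mult_right Bochner_Integration.integrable_add) auto
  have "norm (g t * q t) \<le> norm (B * (1 + (cmod (g t))\<^sup>2))" for t
  proof -
    have "0 \<le> B" using B[of t] norm_ge_zero order_trans by blast
    have "cmod (g t) \<le> 1 + (cmod (g t))\<^sup>2"
      using zero_le_power2[of "cmod (g t) - 1"] norm_ge_zero[of "g t"] unfolding power2_diff
      by (smt (verit) mult_cancel_left1 one_power2)
    then have "cmod (g t) * cmod (q t) \<le> (1 + (cmod (g t))\<^sup>2) * B"
      using B[of t] by (intro mult_mono) auto
    also have "\<dots> = norm (B * (1 + (cmod (g t))\<^sup>2))" using \<open>0 \<le> B\<close> by (simp add: abs_mult mult.commute)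
    finally show ?thesis by (simp add: norm_mult)
  qed
  then show "AE t in M. norm (g t * q t) \<le> norm (B * (1 + (cmod (g t))\<^sup>2))" by simp
qed measurable

lemma integral_trig_square:
  assumes "finite F"
  shows "(LINT t|M. (cmod (\<Sum>n\<in>F. \<alpha> n * e n t))\<^sup>2) = (\<Sum>n\<in>F. b * (cmod (\<alpha> n))\<^sup>2)"
proof -
  have "complex_of_real (LINT t|M. (cmod (\<Sum>n\<in>F. \<alpha> n * e n t))\<^sup>2)
      = (LINT t|M. complex_of_real ((cmod (\<Sum>n\<in>F. \<alpha> n * e n t))\<^sup>2))"
    by (rule integral_complex_of_real[symmetric])
  also have "\<dots> = (LINT t|M. (\<Sum>n\<in>F. \<Sum>m\<in>F. (\<alpha> n * cnj (\<alpha> m)) * e (n - m) t))"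
  proof (rule arg_cong[where f="integral\<^sup>L M"], rule ext)
    fix t
    have "complex_of_real ((cmod (\<Sum>n\<in>F. \<alpha> n * e n t))\<^sup>2) = (\<Sum>n\<in>F. \<alpha> n * e n t) * (\<Sum>m\<in>F. cnj (\<alpha> m) * e (- m) t)"
      by (simp only: complex_norm_square) (simp add: cnj_e)
    also have "\<dots> = (\<Sum>n\<in>F. \<Sum>m\<in>F. (\<alpha> n * e n t) * (cnj (\<alpha> m) * e (- m) t))"
      by (rule sum_product)
    also have "\<dots> = (\<Sum>n\<in>F. \<Sum>m\<in>F. (\<alpha> n * cnj (\<alpha> m)) * e (n - m) t)"
      using e_add by (intro sum.cong) (simp_all add: mult_ac flip: add_uminus_conv_diff)
    finally show "complex_of_real ((cmod (\<Sum>n\<in>F. \<alpha> n * e n t))\<^sup>2) = (\<Sum>n\<in>F. \<Sum>m\<in>F. (\<alpha> n * cnj (\<alpha> m)) * e (n - m) t)" .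
  qed
  also have "\<dots> = (\<Sum>n\<in>F. \<Sum>m\<in>F. (\<alpha> n * cnj (\<alpha> m)) * (if n = m then of_real b else 0))"
    by (simp add: integral_M_e integrable_M_e Bochner_Integration.integral_sum cong: if_cong)
  also have "\<dots> = (\<Sum>n\<in>F. (\<alpha> n * cnj (\<alpha> n)) * of_real b)"
    using assms by (simp add: if_distrib[where f="\<lambda>x. _ * x"] cong: if_cong)
  also have "\<dots> = complex_of_real (\<Sum>n\<in>F. b * (cmod (\<alpha> n))\<^sup>2)"
    by (simp only: of_real_sum of_real_mult complex_norm_square mult_ac)
  finally show ?thesis by (simp only: of_real_eq_iff)
qed

text \<open>The coefficients are arbitrary because there are two uses: the projection coefficients
  give Bessel's inequality, those of a close trigonometric polynomial give the converse
  inequality.\<close>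

lemma bessel_identity:
  assumes g [measurable]: "g \<in> borel_measurable M" and sq: "integrable M (\<lambda>t. (cmod (g t))\<^sup>2)"
    and F: "finite F"
  shows "integrable M (\<lambda>t. (cmod (g t - (\<Sum>n\<in>F. \<alpha> n * e n t)))\<^sup>2)"
    and "(LINT t|M. (cmod (g t - (\<Sum>n\<in>F. \<alpha> n * e n t)))\<^sup>2)
      = (LINT t|M. (cmod (g t))\<^sup>2) + (\<Sum>n\<in>F. b * (cmod (\<alpha> n))\<^sup>2 - 2 * Re (cnj (\<alpha> n) * fourier_coeff g n))"
proof -
  interpret finite_measure M by (rule finite_measure_M)
  define p where "p t = (\<Sum>n\<in>F. \<alpha> n * e n t)" for t
  have [measurable]: "p \<in> borel_measurable M" unfolding p_def[abs_def] by measurable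
  have "(\<lambda>t. cnj (p t)) = (\<lambda>t. \<Sum>n\<in>F. cnj (\<alpha> n) * e (- n) t)"
    by (simp add: p_def fun_eq_iff cnj_e)
  then have cp: "(\<lambda>t. cnj (p t)) \<in> borel_measurable M" by simp
  have p_le: "cmod (p t) \<le> (\<Sum>n\<in>F. cmod (\<alpha> n))" for t
    unfolding p_def using sum_norm_le[of F "\<lambda>n. \<alpha> n * e n t" "\<lambda>n. cmod (\<alpha> n)"] by (simp add: norm_mult)
  have ip: "integrable M (\<lambda>t. (cmod (p t))\<^sup>2)"
  proof (rule integrable_const_bound[where B="(\<Sum>n\<in>F. cmod (\<alpha> n))\<^sup>2"])
    show "AE t in M. norm ((cmod (p t))\<^sup>2) \<le> (\<Sum>n\<in>F. cmod (\<alpha> n))\<^sup>2"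
      using p_le by (auto intro!: AE_I2 power_mono)
  qed measurable
  have igp: "integrable M (\<lambda>t. g t * cnj (p t))"
    by (rule integrable_mult_bounded[OF g sq cp]) (use p_le in simp)
  have ige: "integrable M (\<lambda>t. g t * cnj (e n t))" for n
    by (rule integrable_mult_bounded[OF g sq, where B=1]) (auto simp: cnj_e)
  define q where "q t = Re (g t * cnj (p t))" for t
  have iq: "integrable M q" unfolding q_def[abs_def] by (rule integrable_Re[OF igp])
  have eq: "(cmod (g t - p t))\<^sup>2 = (cmod (g t))\<^sup>2 + (cmod (p t))\<^sup>2 - 2 * q t" for t
    unfolding q_def by (simp only: cmod_power2) (simp add: power2_eq_square algebra_simps)
  show "integrable M (\<lambda>t. (cmod (g t - (\<Sum>n\<in>F. \<alpha> n * e n t)))\<^sup>2)"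
    unfolding p_def[symmetric] eq using sq ip iq by auto
  have "(LINT t|M. g t * cnj (p t)) = (LINT t|M. (\<Sum>n\<in>F. cnj (\<alpha> n) * (g t * cnj (e n t))))"
    by (simp add: p_def sum_distrib_left mult_ac)
  also have "\<dots> = (\<Sum>n\<in>F. cnj (\<alpha> n) * fourier_coeff g n)"
    using ige by (simp add: fourier_coeff_def)
  finally have gp: "(LINT t|M. g t * cnj (p t)) = (\<Sum>n\<in>F. cnj (\<alpha> n) * fourier_coeff g n)" .
  have "(LINT t|M. (cmod (g t - p t))\<^sup>2)
      = (LINT t|M. (cmod (g t))\<^sup>2) + (LINT t|M. (cmod (p t))\<^sup>2) - 2 * (LINT t|M. q t)"
    unfolding eq using sq ip iq by simp
  also have "(LINT t|M. q t) = Re (\<Sum>n\<in>F. cnj (\<alpha> n) * fourier_coeff g n)"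
    unfolding q_def gp[symmetric] by (rule integral_Re[OF igp])
  also have "(LINT t|M. (cmod (p t))\<^sup>2) = (\<Sum>n\<in>F. b * (cmod (\<alpha> n))\<^sup>2)"
    unfolding p_def by (rule integral_trig_square[OF F])
  finally show "(LINT t|M. (cmod (g t - (\<Sum>n\<in>F. \<alpha> n * e n t)))\<^sup>2)
      = (LINT t|M. (cmod (g t))\<^sup>2) + (\<Sum>n\<in>F. b * (cmod (\<alpha> n))\<^sup>2 - 2 * Re (cnj (\<alpha> n) * fourier_coeff g n))"
    by (simp add: p_def sum_subtractf sum_distrib_left)
qed

text \<open>The coefficients are not normalised and each \<open>e n\<close> has squared norm
  \<open>b\<close>; this is the factor \<open>b\<close>.\<close>

theorem parseval:
  assumes g: "g \<in> borel_measurable borel"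
    and fin: "(\<integral>\<^sup>+t. ennreal ((cmod (g t))\<^sup>2) \<partial>M) < \<infinity>"
  shows "(\<integral>\<^sup>+n. ennreal ((cmod (fourier_coeff g n))\<^sup>2) \<partial>count_space UNIV)
    = ennreal b * (\<integral>\<^sup>+t. ennreal ((cmod (g t))\<^sup>2) \<partial>M)"
proof -
  have gM [measurable]: "g \<in> borel_measurable M" using g by (rule measurable_M)
  have sq: "integrable M (\<lambda>t. (cmod (g t))\<^sup>2)"
    using fin by (intro integrableI_nonneg) auto
  define I where "I = (LINT t|M. (cmod (g t))\<^sup>2)"
  have I0: "0 \<le> I" unfolding I_def by simp
  have nnI: "(\<integral>\<^sup>+t. ennreal ((cmod (g t))\<^sup>2) \<partial>M) = ennreal I"
    unfolding I_def using sq by (intro nn_integral_eq_integral) auto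
  show ?thesis
    unfolding nnI
  proof (rule antisym)
    show "(\<integral>\<^sup>+n. ennreal ((cmod (fourier_coeff g n))\<^sup>2) \<partial>count_space UNIV) \<le> ennreal b * ennreal I"
    proof (rule nn_integral_count_space_le)
      fix F :: "int set" assume F: "finite F"
      \<comment> \<open>Division by \<open>b\<close>, the squared norm of \<open>e n\<close>, makes
        the subtracted sum the orthogonal projection of \<open>g\<close>.\<close>
      have "0 \<le> (LINT t|M. (cmod (g t - (\<Sum>n\<in>F. (fourier_coeff g n / b) * e n t)))\<^sup>2)"
        by (rule integral_nonneg_AE) simp
      also have "\<dots> = I + (\<Sum>n\<in>F. b * (cmod (fourier_coeff g n / b))\<^sup>2 - 2 * Re (cnj (fourier_coeff g n / b) * fourier_coeff g n))"
        unfolding I_def by (rule bessel_identity(2)[OF gM sq F])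
      also have "\<dots> = I + (\<Sum>n\<in>F. - (cmod (fourier_coeff g n))\<^sup>2 / b)"
      proof -
        have "b * (cmod (z / b))\<^sup>2 - 2 * Re (cnj (z / b) * z) = - (cmod z)\<^sup>2 / b" for z :: complex
          using b_pos by (simp only: cmod_power2) (simp add: power2_eq_square field_simps)
        then show ?thesis by presburger
      qed
      also have "\<dots> = I - (\<Sum>n\<in>F. (cmod (fourier_coeff g n))\<^sup>2) / b"
        by (simp add: sum_negf sum_divide_distrib)
      finally have "(\<Sum>n\<in>F. (cmod (fourier_coeff g n))\<^sup>2) \<le> b * I"
        using b_pos by (simp add: field_simps)
      then have "ennreal (\<Sum>n\<in>F. (cmod (fourier_coeff g n))\<^sup>2) \<le> ennreal (b * I)" by (rule ennreal_leI)
      then show "(\<Sum>n\<in>F. ennreal ((cmod (fourier_coeff g n))\<^sup>2)) \<le> ennreal b * ennreal I"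
        using b_pos I0 by (simp add: ennreal_mult)
    qed
    show "ennreal b * ennreal I \<le> (\<integral>\<^sup>+n. ennreal ((cmod (fourier_coeff g n))\<^sup>2) \<partial>count_space UNIV)"
    proof (rule ennreal_le_epsilon)
      fix r :: real assume r: "0 < r"
      then obtain p where p: "trig p" "(\<integral>\<^sup>+t. ennreal ((cmod (g t - p t))\<^sup>2) \<partial>M) < ennreal (r / b)"
        using appr_L2[OF g fin] b_pos unfolding appr_def by (meson divide_pos_pos)
      from trig_sum_form[OF p(1)] obtain F \<alpha> where F: "finite F" "p = (\<lambda>t. \<Sum>n\<in>F. \<alpha> n * e n t)" .
      have "(LINT t|M. (cmod (g t - (\<Sum>n\<in>F. \<alpha> n * e n t)))\<^sup>2) < r / b"
      proof -
        have "(\<integral>\<^sup>+t. ennreal ((cmod (g t - p t))\<^sup>2) \<partial>M) = ennreal (LINT t|M. (cmod (g t - p t))\<^sup>2)"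
          unfolding F(2) using bessel_identity(1)[OF gM sq F(1)] by (intro nn_integral_eq_integral) auto
        then show ?thesis using p(2) r b_pos by (simp add: F(2) ennreal_less_iff)
      qed
      also have "(LINT t|M. (cmod (g t - (\<Sum>n\<in>F. \<alpha> n * e n t)))\<^sup>2)
          = I + (\<Sum>n\<in>F. b * (cmod (\<alpha> n))\<^sup>2 - 2 * Re (cnj (\<alpha> n) * fourier_coeff g n))"
        unfolding I_def by (rule bessel_identity(2)[OF gM sq F(1)])
      finally have "I + (\<Sum>n\<in>F. b * (cmod (\<alpha> n))\<^sup>2 - 2 * Re (cnj (\<alpha> n) * fourier_coeff g n)) < r / b" .
      moreover have "(\<Sum>n\<in>F. - (cmod (fourier_coeff g n))\<^sup>2 / b) \<le> (\<Sum>n\<in>F. b * (cmod (\<alpha> n))\<^sup>2 - 2 * Re (cnj (\<alpha> n) * fourier_coeff g n))"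
      proof (rule sum_mono)
        fix n
        \<comment> \<open>Completing the square: no choice of coefficients does better than
          \<open>fourier_coeff g n / b\<close>.\<close>
        have "0 \<le> (cmod (b * \<alpha> n - fourier_coeff g n))\<^sup>2 / b" using b_pos by simp
        also have "\<dots> = b * (cmod (\<alpha> n))\<^sup>2 - 2 * Re (cnj (\<alpha> n) * fourier_coeff g n) + (cmod (fourier_coeff g n))\<^sup>2 / b"
          using b_pos by (simp only: cmod_power2) (simp add: power2_eq_square field_simps)
        finally show "- (cmod (fourier_coeff g n))\<^sup>2 / b \<le> b * (cmod (\<alpha> n))\<^sup>2 - 2 * Re (cnj (\<alpha> n) * fourier_coeff g n)" by simp
      qed
      ultimately have "I + (\<Sum>n\<in>F. - (cmod (fourier_coeff g n))\<^sup>2 / b) < r / b" by linarith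
      then have "I - (\<Sum>n\<in>F. (cmod (fourier_coeff g n))\<^sup>2) / b < r / b"
        by (simp add: sum_negf sum_divide_distrib)
      then have "b * (I - (\<Sum>n\<in>F. (cmod (fourier_coeff g n))\<^sup>2) / b) < b * (r / b)"
        using b_pos by (rule mult_strict_left_mono)
      then have "b * I \<le> (\<Sum>n\<in>F. (cmod (fourier_coeff g n))\<^sup>2) + r"
        using b_pos by (simp add: right_diff_distrib)
      then have "ennreal (b * I) \<le> ennreal ((\<Sum>n\<in>F. (cmod (fourier_coeff g n))\<^sup>2) + r)" by (rule ennreal_leI)
      also have "\<dots> = (\<Sum>n\<in>F. ennreal ((cmod (fourier_coeff g n))\<^sup>2)) + ennreal r"
        using r by (simp add: sum_nonneg)
      also have "\<dots> \<le> (\<integral>\<^sup>+n. ennreal ((cmod (fourier_coeff g n))\<^sup>2) \<partial>count_space UNIV) + ennreal r"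
        by (intro add_right_mono sum_le_nn_integral_count_space F)
      finally show "ennreal b * ennreal I \<le> (\<integral>\<^sup>+n. ennreal ((cmod (fourier_coeff g n))\<^sup>2) \<partial>count_space UNIV) + ennreal r"
        using b_pos I0 by (simp add: ennreal_mult)
    qed
  qed
qed

end

section \<open>Reduction of the frame property to fibres\<close>

lemma finite_int_window:
  fixes b :: real
  assumes "0 < b"
  shows "finite {j::int. x \<le> t + of_int j * b \<and> t + of_int j * b < x + c}"
    and "card {j::int. x \<le> t + of_int j * b \<and> t + of_int j * b < x + c} \<le> nat \<lceil>c / b\<rceil>"
proof -
  have sub: "{j::int. x \<le> t + of_int j * b \<and> t + of_int j * b < x + c} \<subseteq> {\<lceil>(x - t) / b\<rceil>..<\<lceil>(x - t) / b + c / b\<rceil>}"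
  proof (clarify)
    fix j :: int assume j: "x \<le> t + of_int j * b" "t + of_int j * b < x + c"
    then have "(x - t) / b \<le> of_int j" "of_int j < (x - t) / b + c / b"
      using assms by (simp_all add: field_simps)
    then show "j \<in> {\<lceil>(x - t) / b\<rceil>..<\<lceil>(x - t) / b + c / b\<rceil>}"
      by (simp add: ceiling_le_iff less_ceiling_iff)
  qed
  then show "finite {j::int. x \<le> t + of_int j * b \<and> t + of_int j * b < x + c}"
    by (rule finite_subset) simp
  have "card {j::int. x \<le> t + of_int j * b \<and> t + of_int j * b < x + c} \<le> card {\<lceil>(x - t) / b\<rceil>..<\<lceil>(x - t) / b + c / b\<rceil>}"
    using sub by (intro card_mono) auto
  also have "\<dots> = nat (\<lceil>(x - t) / b + c / b\<rceil> - \<lceil>(x - t) / b\<rceil>)" by simp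
  also have "\<dots> \<le> nat \<lceil>c / b\<rceil>"
    using ceiling_add_le[of "(x - t) / b" "c / b"] by (intro nat_mono) simp
  finally show "card {j::int. x \<le> t + of_int j * b \<and> t + of_int j * b < x + c} \<le> nat \<lceil>c / b\<rceil>" .
qed

lemma finite_int_window_left:
  fixes a :: real
  assumes "0 < a"
  shows "finite {m::int. of_int m * a \<le> t \<and> t < of_int m * a + c}"
    and "card {m::int. of_int m * a \<le> t \<and> t < of_int m * a + c} \<le> nat \<lceil>c / a\<rceil>"
proof -
  have sub: "{m::int. of_int m * a \<le> t \<and> t < of_int m * a + c} \<subseteq> {\<lfloor>t / a - c / a\<rfloor><..\<lfloor>t / a\<rfloor>}"
  proof (clarify)
    fix m :: int assume m: "of_int m * a \<le> t" "t < of_int m * a + c"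
    then have "of_int m \<le> t / a" "t / a - c / a < of_int m"
      using assms by (simp_all add: field_simps)
    then show "m \<in> {\<lfloor>t / a - c / a\<rfloor><..\<lfloor>t / a\<rfloor>}"
      by (simp add: le_floor_iff floor_less_iff)
  qed
  then show "finite {m::int. of_int m * a \<le> t \<and> t < of_int m * a + c}"
    by (rule finite_subset) simp
  have "card {m::int. of_int m * a \<le> t \<and> t < of_int m * a + c} \<le> card {\<lfloor>t / a - c / a\<rfloor><..\<lfloor>t / a\<rfloor>}"
    using sub by (intro card_mono) auto
  also have "\<dots> = nat (\<lfloor>t / a\<rfloor> - \<lfloor>t / a - c / a\<rfloor>)" by simp
  also have "\<dots> \<le> nat \<lceil>c / a\<rceil>"
  proof (rule nat_mono)
    show "\<lfloor>t / a\<rfloor> - \<lfloor>t / a - c / a\<rfloor> \<le> \<lceil>c / a\<rceil>" by linarith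
  qed
  finally show "card {m::int. of_int m * a \<le> t \<and> t < of_int m * a + c} \<le> nat \<lceil>c / a\<rceil>" .
qed

lemma borel_measurable_count_space_integral:
  fixes f :: "'i::countable \<Rightarrow> 'a \<Rightarrow> ennreal"
  assumes [measurable]: "\<And>i. f i \<in> borel_measurable M"
  shows "(\<lambda>s. \<integral>\<^sup>+i. f i s \<partial>count_space UNIV) \<in> borel_measurable M"
proof -
  define R where "R = range (to_nat :: 'i \<Rightarrow> nat)"
  have "(\<integral>\<^sup>+i. f i s \<partial>count_space UNIV) = (\<Sum>n. f (from_nat n) s * indicator R n)" for s
  proof -
    have "(\<integral>\<^sup>+i. f i s \<partial>count_space UNIV) = (\<integral>\<^sup>+n. f (from_nat n) s \<partial>count_space R)"
      using nn_integral_bij_count_space[of to_nat "UNIV :: 'i set" R "\<lambda>n. f (from_nat n) s"]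
      by (simp add: R_def inj_on_imp_bij_betw)
    then show ?thesis
      by (simp add: nn_integral_count_space_indicator nn_integral_count_space_nat)
  qed
  then show ?thesis by simp
qed

locale gabor = fourier b for b :: real +
  fixes a c :: real
  assumes a_pos: "0 < a" and c_pos: "0 < c"
begin

definition window :: "real \<Rightarrow> int \<Rightarrow> int set" where
  "window s m = {j. of_int m * a \<le> s + of_int j * b \<and> s + of_int j * b < of_int m * a + c}"

definition winsum :: "real \<Rightarrow> (int \<Rightarrow> complex) \<Rightarrow> int \<Rightarrow> complex" where
  "winsum s x m = (\<Sum>j\<in>window s m. x j)"

lemma finite_window [simp]: "finite (window s m)"
  unfolding window_def by (rule finite_int_window(1)[OF b_pos])

definition fiber :: "(real \<Rightarrow> complex) \<Rightarrow> real \<Rightarrow> int \<Rightarrow> complex" where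
  "fiber f s j = f (s + of_int j * b)"

text \<open>A finite set of indices that serves all \<open>s\<close> of the period at once, so that
  a sum over an \<open>s\<close>-dependent set becomes a fixed finite sum of measurable
  functions.\<close>

definition window_range :: "int \<Rightarrow> int set" where
  "window_range m = {\<lfloor>of_int m * a / b\<rfloor> - 1..\<lceil>(of_int m * a + c) / b\<rceil>}"

lemma window_subset_range: "s \<in> {0..<b} \<Longrightarrow> window s m \<subseteq> window_range m"
proof
  fix j assume s: "s \<in> {0..<b}" and "j \<in> window s m"
  then have j: "of_int m * a \<le> s + of_int j * b" "s + of_int j * b < of_int m * a + c"
    by (auto simp: window_def)
  have "of_int m * a / b < 1 + of_int j" "of_int j \<le> (of_int m * a + c) / b"
    using j s b_pos by (simp_all add: field_simps)
  then show "j \<in> window_range m" unfolding window_range_def atLeastAtMost_iff by linarith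
qed

text \<open>A version of \<open>winsum s (fiber f s) m\<close> that is Borel on the whole line, and not only on the period.\<close>

definition wfun :: "(real \<Rightarrow> complex) \<Rightarrow> int \<Rightarrow> real \<Rightarrow> complex" where
  "wfun f m s = (\<Sum>j\<in>window_range m. f (s + of_int j * b) *
     indicator {of_int m * a..<of_int m * a + c} (s + of_int j * b))"

lemma wfun_eq: "s \<in> {0..<b} \<Longrightarrow> wfun f m s = winsum s (fiber f s) m"
proof -
  assume s: "s \<in> {0..<b}"
  have "winsum s (fiber f s) m = (\<Sum>j\<in>window s m. f (s + of_int j * b) *
     indicator {of_int m * a..<of_int m * a + c} (s + of_int j * b))"
    unfolding winsum_def fiber_def by (intro sum.cong) (auto simp: window_def)
  also have "\<dots> = wfun f m s"
    unfolding wfun_def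
    by (rule sum.mono_neutral_left) (use window_subset_range[OF s] in \<open>auto simp: window_range_def window_def indicator_def\<close>)
  finally show ?thesis by simp
qed

lemma wfun_measurable:
  assumes [measurable]: "f \<in> borel_measurable borel"
  shows "wfun f m \<in> borel_measurable borel"
  unfolding wfun_def[abs_def] by measurable

lemma integral_shift_M:
  fixes h :: "real \<Rightarrow> complex"
  shows "(LINT t|lborel. indicator {of_int j * b..<of_int j * b + b} t *\<^sub>R h t) = (LINT s|M. h (s + of_int j * b))"
proof -
  have "(LINT t|lborel. indicator {of_int j * b..<of_int j * b + b} t *\<^sub>R h t)
      = (LINT s|lborel. indicator {of_int j * b..<of_int j * b + b} (of_int j * b + 1 * s) *\<^sub>R h (of_int j * b + 1 * s))"
    using lborel_integral_real_affine[of 1 "\<lambda>t. indicator {of_int j * b..<of_int j * b + b} t *\<^sub>R h t" "of_int j * b"] by simp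
  also have "\<dots> = (LINT s|lborel. indicator {0..<b} s *\<^sub>R h (s + of_int j * b))"
    by (intro Bochner_Integration.integral_cong) (auto simp: indicator_def add.commute)
  also have "\<dots> = (LINT s|M. h (s + of_int j * b))"
    by (simp add: M_def integral_restrict_space set_lebesgue_integral_def)
  finally show ?thesis .
qed

lemma nn_integral_shift_M:
  fixes h :: "real \<Rightarrow> ennreal"
  assumes [measurable]: "h \<in> borel_measurable borel"
  shows "(\<integral>\<^sup>+t. h t * indicator {of_int j * b..<of_int j * b + b} t \<partial>lborel) = (\<integral>\<^sup>+s. h (s + of_int j * b) \<partial>M)"
proof -
  have "(\<integral>\<^sup>+t. h t * indicator {of_int j * b..<of_int j * b + b} t \<partial>lborel)
      = (\<integral>\<^sup>+s. h (of_int j * b + 1 * s) * indicator {of_int j * b..<of_int j * b + b} (of_int j * b + 1 * s) \<partial>lborel)"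
    by (subst nn_integral_real_affine[where c=1 and t="of_int j * b"]) auto
  also have "\<dots> = (\<integral>\<^sup>+s. h (s + of_int j * b) * indicator {0..<b} s \<partial>lborel)"
    by (intro nn_integral_cong) (auto simp: indicator_def add.commute)
  also have "\<dots> = (\<integral>\<^sup>+s. h (s + of_int j * b) \<partial>M)"
    by (simp add: M_def nn_integral_restrict_space)
  finally show ?thesis .
qed

lemma floor_div_b_eq: "(\<lfloor>t / b\<rfloor> = j) \<longleftrightarrow> t \<in> {of_int j * b..<of_int j * b + b}"
  using b_pos by (simp add: floor_eq_iff field_simps)

lemma indicator_period:
  "indicator {of_int j * b..<of_int j * b + b} t = (if j = \<lfloor>t / b\<rfloor> then 1 else 0)"
  unfolding indicator_def floor_div_b_eq[symmetric] by auto

lemma nn_integral_periodize: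
  fixes h :: "real \<Rightarrow> ennreal"
  assumes [measurable]: "h \<in> borel_measurable borel"
  shows "(\<integral>\<^sup>+t. h t \<partial>lborel) = (\<integral>\<^sup>+s. \<integral>\<^sup>+j. h (s + of_int j * b) \<partial>count_space UNIV \<partial>M)"
proof -
  have "(\<integral>\<^sup>+t. h t \<partial>lborel) = (\<integral>\<^sup>+t. \<integral>\<^sup>+j. h t * indicator {of_int j * b..<of_int j * b + b} t \<partial>count_space (UNIV :: int set) \<partial>lborel)"
  proof (intro nn_integral_cong)
    fix t :: real
    have "(\<integral>\<^sup>+j. h t * indicator {of_int j * b..<of_int j * b + b} t \<partial>count_space (UNIV :: int set))
        = (\<integral>\<^sup>+j. h t * indicator {\<lfloor>t / b\<rfloor>} j \<partial>count_space (UNIV :: int set))"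
      unfolding indicator_period by (intro nn_integral_cong) (auto simp: indicator_def)
    also have "\<dots> = h t" by (simp add: nn_integral_cmult)
    finally show "h t = (\<integral>\<^sup>+j. h t * indicator {of_int j * b..<of_int j * b + b} t \<partial>count_space (UNIV :: int set))" by simp
  qed
  also have "\<dots> = (\<integral>\<^sup>+j. \<integral>\<^sup>+t. h t * indicator {of_int j * b..<of_int j * b + b} t \<partial>lborel \<partial>count_space (UNIV :: int set))"
    by (rule nn_integral_count_space_nn_integral) auto
  also have "\<dots> = (\<integral>\<^sup>+j. \<integral>\<^sup>+s. h (s + of_int j * b) \<partial>M \<partial>count_space (UNIV :: int set))"
    by (intro nn_integral_cong nn_integral_shift_M assms)
  also have "\<dots> = (\<integral>\<^sup>+s. \<integral>\<^sup>+j. h (s + of_int j * b) \<partial>count_space (UNIV :: int set) \<partial>M)"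
    by (rule nn_integral_count_space_nn_integral[symmetric]) (auto intro!: measurable_M)
  finally show ?thesis .
qed

text \<open>Meant for integrands supported in one window: a finite \<open>J\<close> meets all their
  periods, and the interchange is finite additivity.\<close>

lemma integral_periodize:
  fixes h :: "real \<Rightarrow> complex"
  assumes h: "integrable lborel h" and J: "finite J" "\<And>t. h t \<noteq> 0 \<Longrightarrow> \<lfloor>t / b\<rfloor> \<in> J"
  shows "(LINT t|lborel. h t) = (LINT s|M. (\<Sum>j\<in>J. h (s + of_int j * b)))"
proof -
  have int: "integrable lborel (\<lambda>t. indicator {of_int j * b..<of_int j * b + b} t *\<^sub>R h t)" for j :: int
    by (rule integrable_mult_indicator[OF _ h]) simp
  have "h t = (\<Sum>j\<in>J. indicator {of_int j * b..<of_int j * b + b} t *\<^sub>R h t)" for t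
  proof -
    have "(\<Sum>j\<in>J. indicator {of_int j * b..<of_int j * b + b} t *\<^sub>R h t) = (\<Sum>j\<in>J. if j = \<lfloor>t / b\<rfloor> then h t else 0)"
      unfolding indicator_period by (intro sum.cong) auto
    also have "\<dots> = h t" using J by auto
    finally show ?thesis by simp
  qed
  then have "(LINT t|lborel. h t) = (LINT t|lborel. (\<Sum>j\<in>J. indicator {of_int j * b..<of_int j * b + b} t *\<^sub>R h t))"
    by presburger
  also have "\<dots> = (\<Sum>j\<in>J. LINT s|M. h (s + of_int j * b))"
    using int by (simp add: Bochner_Integration.integral_sum integral_shift_M)
  also have "\<dots> = (LINT s|M. (\<Sum>j\<in>J. h (s + of_int j * b)))"
  proof (rule Bochner_Integration.integral_sum[symmetric])
    fix j assume "j \<in> J"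
    have "integrable lborel (\<lambda>s. indicator {of_int j * b..<of_int j * b + b} (of_int j * b + 1 * s) *\<^sub>R h (of_int j * b + 1 * s))"
      using int[of j] by (subst (asm) lborel_integrable_real_affine_iff[of 1 _ "of_int j * b", symmetric]) auto
    moreover have "(\<lambda>s. indicator {of_int j * b..<of_int j * b + b} (of_int j * b + 1 * s) *\<^sub>R h (of_int j * b + 1 * s))
        = (\<lambda>s. indicator {0..<b} s *\<^sub>R h (s + of_int j * b))"
      by (auto simp: indicator_def add.commute fun_eq_iff)
    ultimately have "integrable lborel (\<lambda>s. indicator {0..<b} s *\<^sub>R h (s + of_int j * b))" by simp
    then show "integrable M (\<lambda>s. h (s + of_int j * b))"
      by (simp add: M_def integrable_restrict_space set_integrable_def)
  qed
  finally show ?thesis .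
qed

text \<open>The modulation has period \<open>b\<close>, so it is constant along a coset and leaves
  the sum over \<open>j\<close>. Conjugating the atom yields \<open>e n\<close>, the conjugate of
  \<open>e (- n)\<close>; hence the sign.\<close>

lemma L2_inner_atom:
  assumes f: "square_integrable f"
  shows "L2_inner f (gabor_atom (indicator {0..<c}) a b (m, n)) = fourier_coeff (wfun f m) (- n)"
proof -
  have fm [measurable]: "f \<in> borel_measurable borel" and f2: "integrable lborel (\<lambda>t. (cmod (f t))\<^sup>2)"
    using f by (simp_all add: square_integrable_def)
  define I where "I = {of_int m * a..<of_int m * a + c}"
  have [measurable]: "I \<in> sets borel" by (simp add: I_def)
  define h where "h t = f t * e n t * indicator I t" for t
  have "f t * cnj (gabor_atom (indicator {0..<c}) a b (m, n) t) = h t" for t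
  proof -
    have "cnj (gabor_atom (indicator {0..<c}) a b (m, n) t) = e n t * indicator I t"
      by (auto simp: gabor_atom_def h_def e_def cis_conv_exp exp_cnj I_def indicator_def algebra_simps)
    then show ?thesis by (simp add: h_def)
  qed
  then have "L2_inner f (gabor_atom (indicator {0..<c}) a b (m, n)) = (LINT t|lborel. h t)"
    by (simp add: L2_inner_def)
  also have "\<dots> = (LINT s|M. (\<Sum>j\<in>window_range m. h (s + of_int j * b)))"
  proof (rule integral_periodize)
    show "integrable lborel h"
    proof (rule Bochner_Integration.integrable_bound)
      have "integrable lborel (indicator I :: real \<Rightarrow> real)"
        by (rule integrable_real_indicator) (use c_pos in \<open>auto simp: I_def\<close>)
      then show "integrable lborel (\<lambda>t. indicator I t + (cmod (f t))\<^sup>2)"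
        using f2 by (rule Bochner_Integration.integrable_add)
      show "h \<in> borel_measurable lborel" unfolding h_def[abs_def] by measurable
      have "norm (h t) \<le> norm (indicator I t + (cmod (f t))\<^sup>2)" for t
      proof -
        have "2 * cmod (f t) \<le> 1 + (cmod (f t))\<^sup>2"
          using zero_le_power2[of "cmod (f t) - 1"] unfolding power2_diff by simp
        then have "cmod (f t) \<le> 1 + (cmod (f t))\<^sup>2" using norm_ge_zero[of "f t"] by linarith
        then show ?thesis by (auto simp: h_def norm_mult indicator_def)
      qed
      then show "AE t in lborel. norm (h t) \<le> norm (indicator I t + (cmod (f t))\<^sup>2)" by simp
    qed
    show "finite (window_range m)" by (simp add: window_range_def)
    show "\<lfloor>t / b\<rfloor> \<in> window_range m" if "h t \<noteq> 0" for t
    proof -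
      have t: "t \<in> I" using that by (auto simp: h_def indicator_def)
      define s where "s = t - of_int \<lfloor>t / b\<rfloor> * b"
      have "s \<in> {0..<b}" using floor_div_b_eq[of t "\<lfloor>t / b\<rfloor>"] by (simp add: s_def)
      moreover have "\<lfloor>t / b\<rfloor> \<in> window s m" using t by (simp add: window_def s_def I_def)
      ultimately show ?thesis using window_subset_range by blast
    qed
  qed
  also have "\<dots> = fourier_coeff (wfun f m) (- n)"
  proof -
    have "h (s + of_int j * b) = f (s + of_int j * b) *
        indicator {of_int m * a..<of_int m * a + c} (s + of_int j * b) * cnj (e (- n) s)" for s j
      unfolding h_def e_shift by (simp add: cnj_e I_def)
    then show ?thesis by (simp add: fourier_coeff_def wfun_def sum_distrib_right)
  qed
  finally show ?thesis .
qed

lemma norm_sum_square_le: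
  fixes x :: "'i \<Rightarrow> complex"
  shows "(cmod (\<Sum>j\<in>A. x j))\<^sup>2 \<le> real (card A) * (\<Sum>j\<in>A. (cmod (x j))\<^sup>2)"
proof -
  have "(cmod (\<Sum>j\<in>A. x j))\<^sup>2 \<le> (\<Sum>j\<in>A. cmod (x j))\<^sup>2"
    by (intro power_mono norm_sum) auto
  also have "\<dots> \<le> (\<Sum>j\<in>A. 1\<^sup>2) * (\<Sum>j\<in>A. (cmod (x j))\<^sup>2)"
    using Cauchy_Schwarz_ineq_sum[of "\<lambda>_. 1" "\<lambda>j. cmod (x j)" A] by simp
  finally show ?thesis by simp
qed

text \<open>Cauchy-Schwarz on a window costs its number of points, exchanging the two sums costs the
  number of windows through a point; the two factors bound these numbers.\<close>

definition K :: real where "K = real (nat \<lceil>c / b\<rceil>) * real (nat \<lceil>c / a\<rceil>)"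

lemma K_pos: "0 < K"
  using a_pos b_pos c_pos by (simp add: K_def)

lemma winsum_upper:
  "(\<integral>\<^sup>+m. ennreal ((cmod (winsum s x m))\<^sup>2) \<partial>count_space UNIV)
    \<le> ennreal K * (\<integral>\<^sup>+j. ennreal ((cmod (x j))\<^sup>2) \<partial>count_space UNIV)"
proof -
  define k1 where "k1 = nat \<lceil>c / b\<rceil>"
  define k2 where "k2 = nat \<lceil>c / a\<rceil>"
  have "ennreal ((cmod (winsum s x m))\<^sup>2) \<le> ennreal k1 * (\<integral>\<^sup>+j. ennreal ((cmod (x j))\<^sup>2) * indicator (window s m) j \<partial>count_space UNIV)" for m
  proof -
    have "(cmod (winsum s x m))\<^sup>2 \<le> real (card (window s m)) * (\<Sum>j\<in>window s m. (cmod (x j))\<^sup>2)"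
      unfolding winsum_def by (rule norm_sum_square_le)
    also have "\<dots> \<le> real k1 * (\<Sum>j\<in>window s m. (cmod (x j))\<^sup>2)"
      using finite_int_window(2)[OF b_pos, of "of_int m * a" s c]
      by (intro mult_right_mono sum_nonneg) (auto simp: window_def k1_def)
    finally have "ennreal ((cmod (winsum s x m))\<^sup>2) \<le> ennreal (real k1 * (\<Sum>j\<in>window s m. (cmod (x j))\<^sup>2))"
      by (rule ennreal_leI)
    also have "\<dots> = ennreal k1 * (\<Sum>j\<in>window s m. ennreal ((cmod (x j))\<^sup>2))"
      by (simp add: ennreal_mult sum_nonneg)
    also have "(\<Sum>j\<in>window s m. ennreal ((cmod (x j))\<^sup>2)) = (\<integral>\<^sup>+j. ennreal ((cmod (x j))\<^sup>2) * indicator (window s m) j \<partial>count_space UNIV)"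
      by (simp add: nn_integral_count_space_finite flip: nn_integral_count_space_indicator)
    finally show ?thesis .
  qed
  then have "(\<integral>\<^sup>+m. ennreal ((cmod (winsum s x m))\<^sup>2) \<partial>count_space UNIV)
      \<le> (\<integral>\<^sup>+m. ennreal k1 * (\<integral>\<^sup>+j. ennreal ((cmod (x j))\<^sup>2) * indicator (window s m) j \<partial>count_space UNIV) \<partial>count_space UNIV)"
    by (intro nn_integral_mono)
  also have "\<dots> = ennreal k1 * (\<integral>\<^sup>+m. (\<integral>\<^sup>+j. ennreal ((cmod (x j))\<^sup>2) * indicator (window s m) j \<partial>count_space UNIV) \<partial>count_space UNIV)"
    by (rule nn_integral_cmult) simp
  also have "(\<integral>\<^sup>+m. (\<integral>\<^sup>+j. ennreal ((cmod (x j))\<^sup>2) * indicator (window s m) j \<partial>count_space UNIV) \<partial>count_space UNIV)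
      = (\<integral>\<^sup>+j. (\<integral>\<^sup>+m. ennreal ((cmod (x j))\<^sup>2) * indicator (window s m) j \<partial>count_space UNIV) \<partial>count_space UNIV)"
    by (rule nn_integral_count_space_nn_integral) auto
  also have "\<dots> \<le> (\<integral>\<^sup>+j. ennreal k2 * ennreal ((cmod (x j))\<^sup>2) \<partial>count_space UNIV)"
  proof (intro nn_integral_mono)
    fix j
    define S where "S = {m::int. of_int m * a \<le> s + of_int j * b \<and> s + of_int j * b < of_int m * a + c}"
    have S: "finite S" "card S \<le> k2"
      unfolding S_def k2_def by (rule finite_int_window_left[OF a_pos])+
    have "(\<integral>\<^sup>+m. ennreal ((cmod (x j))\<^sup>2) * indicator (window s m) j \<partial>count_space UNIV)
        = (\<integral>\<^sup>+m. ennreal ((cmod (x j))\<^sup>2) * indicator S m \<partial>count_space UNIV)"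
      by (intro nn_integral_cong) (auto simp: S_def window_def indicator_def)
    also have "\<dots> = (\<Sum>m\<in>S. ennreal ((cmod (x j))\<^sup>2))"
      using nn_integral_count_space_indicator[of S "\<lambda>_. ennreal ((cmod (x j))\<^sup>2)"]
        nn_integral_count_space_finite[OF S(1), of "\<lambda>_. ennreal ((cmod (x j))\<^sup>2)"] by (simp only: NO_MATCH_def)
    also have "\<dots> = ennreal (card S) * ennreal ((cmod (x j))\<^sup>2)"
      by (simp only: sum_constant ennreal_of_nat_eq_real_of_nat)
    also have "\<dots> \<le> ennreal k2 * ennreal ((cmod (x j))\<^sup>2)"
      using S by (intro mult_right_mono ennreal_leI) auto
    finally show "(\<integral>\<^sup>+m. ennreal ((cmod (x j))\<^sup>2) * indicator (window s m) j \<partial>count_space UNIV)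
      \<le> ennreal k2 * ennreal ((cmod (x j))\<^sup>2)" .
  qed
  also have "\<dots> = ennreal k2 * (\<integral>\<^sup>+j. ennreal ((cmod (x j))\<^sup>2) \<partial>count_space UNIV)"
    by (rule nn_integral_cmult) simp
  finally show ?thesis
    by (simp add: K_def k1_def k2_def ennreal_mult mult.assoc mult_left_mono)
qed

lemma norm_sq_fiber:
  assumes "square_integrable f"
  shows "ennreal (L2_norm_sq f) = (\<integral>\<^sup>+s. \<integral>\<^sup>+j. ennreal ((cmod (fiber f s j))\<^sup>2) \<partial>count_space UNIV \<partial>M)"
proof -
  have fm [measurable]: "f \<in> borel_measurable borel" and f2: "integrable lborel (\<lambda>t. (cmod (f t))\<^sup>2)"
    using assms by (simp_all add: square_integrable_def)
  have "ennreal (L2_norm_sq f) = (\<integral>\<^sup>+t. ennreal ((cmod (f t))\<^sup>2) \<partial>lborel)"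
    unfolding L2_norm_sq_def using f2 by (intro nn_integral_eq_integral[symmetric]) auto
  also have "\<dots> = (\<integral>\<^sup>+s. \<integral>\<^sup>+j. ennreal ((cmod (f (s + of_int j * b)))\<^sup>2) \<partial>count_space UNIV \<partial>M)"
    by (rule nn_integral_periodize) measurable
  finally show ?thesis by (simp add: fiber_def)
qed

lemma gabor_sum:
  assumes "square_integrable f"
  shows "(\<Sum>\<^sub>\<infinity>i. ennreal ((cmod (L2_inner f (gabor_atom (indicator {0..<c}) a b i)))\<^sup>2))
    = ennreal b * (\<integral>\<^sup>+s. \<integral>\<^sup>+m. ennreal ((cmod (winsum s (fiber f s) m))\<^sup>2) \<partial>count_space UNIV \<partial>M)"
proof -
  have fm [measurable]: "f \<in> borel_measurable borel"
    using assms by (simp_all add: square_integrable_def)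
  note [measurable] = wfun_measurable[OF fm]
  have wM [measurable]: "wfun f m \<in> borel_measurable M" for m by (rule measurable_M) measurable
  have eq: "(\<integral>\<^sup>+s. \<integral>\<^sup>+m. ennreal ((cmod (wfun f m s))\<^sup>2) \<partial>count_space UNIV \<partial>M)
      = (\<integral>\<^sup>+s. \<integral>\<^sup>+m. ennreal ((cmod (winsum s (fiber f s) m))\<^sup>2) \<partial>count_space UNIV \<partial>M)"
    by (intro nn_integral_cong) (simp add: wfun_eq)
  have swap: "(\<integral>\<^sup>+s. \<integral>\<^sup>+m. ennreal ((cmod (wfun f m s))\<^sup>2) \<partial>count_space UNIV \<partial>M)
      = (\<integral>\<^sup>+m. \<integral>\<^sup>+s. ennreal ((cmod (wfun f m s))\<^sup>2) \<partial>M \<partial>count_space UNIV)"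
    by (rule nn_integral_count_space_nn_integral) auto
  have "(\<integral>\<^sup>+s. \<integral>\<^sup>+m. ennreal ((cmod (winsum s (fiber f s) m))\<^sup>2) \<partial>count_space UNIV \<partial>M)
      \<le> (\<integral>\<^sup>+s. ennreal K * (\<integral>\<^sup>+j. ennreal ((cmod (fiber f s j))\<^sup>2) \<partial>count_space UNIV) \<partial>M)"
    by (intro nn_integral_mono winsum_upper)
  also have "\<dots> = ennreal K * (\<integral>\<^sup>+s. \<integral>\<^sup>+j. ennreal ((cmod (fiber f s j))\<^sup>2) \<partial>count_space UNIV \<partial>M)"
    unfolding fiber_def
    by (intro nn_integral_cmult) (auto intro!: measurable_M borel_measurable_count_space_integral)
  also have "\<dots> < \<infinity>"
    unfolding norm_sq_fiber[OF assms, symmetric] by (simp add: ennreal_mult_less_top)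
  \<comment> \<open>\<open>parseval\<close> asks for square integrability of every
    \<open>wfun f m\<close> on the period; the upper estimate \<open>winsum_upper\<close> supplies
    it.\<close>
  finally have fin: "(\<integral>\<^sup>+m. \<integral>\<^sup>+s. ennreal ((cmod (wfun f m s))\<^sup>2) \<partial>M \<partial>count_space UNIV) < \<infinity>"
    using eq swap by simp
  have fin': "(\<integral>\<^sup>+s. ennreal ((cmod (wfun f m s))\<^sup>2) \<partial>M) < \<infinity>" for m
    using sum_le_nn_integral_count_space[of "{m}" "\<lambda>m. \<integral>\<^sup>+s. ennreal ((cmod (wfun f m s))\<^sup>2) \<partial>M"] fin
    by (simp add: le_less_trans)
  have "(\<Sum>\<^sub>\<infinity>i. ennreal ((cmod (L2_inner f (gabor_atom (indicator {0..<c}) a b i)))\<^sup>2))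
      = (\<integral>\<^sup>+i. ennreal ((cmod (L2_inner f (gabor_atom (indicator {0..<c}) a b i)))\<^sup>2) \<partial>count_space UNIV)"
    by (rule nn_integral_count_space_eq_infsum[symmetric])
  also have "\<dots> = (\<integral>\<^sup>+m. \<integral>\<^sup>+n. ennreal ((cmod (L2_inner f (gabor_atom (indicator {0..<c}) a b (m, n))))\<^sup>2) \<partial>count_space UNIV \<partial>count_space UNIV)"
    by (rule nn_integral_fst_count_space[symmetric])
  also have "\<dots> = (\<integral>\<^sup>+m. \<integral>\<^sup>+n. ennreal ((cmod (fourier_coeff (wfun f m) (- n)))\<^sup>2) \<partial>count_space UNIV \<partial>count_space UNIV)"
    by (simp add: L2_inner_atom[OF assms])
  also have "\<dots> = (\<integral>\<^sup>+m. \<integral>\<^sup>+n. ennreal ((cmod (fourier_coeff (wfun f m) n))\<^sup>2) \<partial>count_space UNIV \<partial>count_space UNIV)"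
  proof (rule nn_integral_cong)
    fix m
    have bij: "bij_betw uminus (UNIV :: int set) UNIV" by (rule bij_uminus)
    show "(\<integral>\<^sup>+n. ennreal ((cmod (fourier_coeff (wfun f m) (- n)))\<^sup>2) \<partial>count_space UNIV) = (\<integral>\<^sup>+n. ennreal ((cmod (fourier_coeff (wfun f m) n))\<^sup>2) \<partial>count_space UNIV)"
      by (rule nn_integral_bij_count_space[OF bij])
  qed
  also have "\<dots> = (\<integral>\<^sup>+m. ennreal b * (\<integral>\<^sup>+s. ennreal ((cmod (wfun f m s))\<^sup>2) \<partial>M) \<partial>count_space UNIV)"
    by (intro nn_integral_cong parseval wfun_measurable fm fin')
  also have "\<dots> = ennreal b * (\<integral>\<^sup>+m. \<integral>\<^sup>+s. ennreal ((cmod (wfun f m s))\<^sup>2) \<partial>M \<partial>count_space UNIV)"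
    by (rule nn_integral_cmult) simp
  finally show ?thesis using eq swap by simp
qed

lemma gabor_frame_if:
  assumes C: "0 < C" and fib: "\<And>s x. (\<integral>\<^sup>+j. ennreal ((cmod (x j))\<^sup>2) \<partial>count_space UNIV)
      \<le> ennreal C * (\<integral>\<^sup>+m. ennreal ((cmod (winsum s x m))\<^sup>2) \<partial>count_space UNIV)"
  shows "gabor_frame (indicator {0..<c}) a b"
  unfolding gabor_frame_def is_frame_def
proof (intro exI conjI allI impI)
  define A where "A = b / C"
  \<comment> \<open>The maximum secures \<open>A \<le> B\<close>, which \<open>is_frame\<close>
    requires.\<close>
  define B where "B = max A (b * K)"
  show "0 < A" using b_pos C by (simp add: A_def)
  show "A \<le> B" by (simp add: B_def)
  fix f assume f: "square_integrable f"
  then have [measurable]: "f \<in> borel_measurable borel" by (simp add: square_integrable_def)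
  have sm: "(\<lambda>s. \<integral>\<^sup>+m. ennreal ((cmod (wfun f m s))\<^sup>2) \<partial>count_space UNIV) \<in> borel_measurable M"
  proof (rule borel_measurable_count_space_integral)
    fix m
    have [measurable]: "wfun f m \<in> borel_measurable M" by (intro measurable_M wfun_measurable) measurable
    show "(\<lambda>s. ennreal ((cmod (wfun f m s))\<^sup>2)) \<in> borel_measurable M" by measurable
  qed
  have fm: "(\<lambda>s. \<integral>\<^sup>+j. ennreal ((cmod (fiber f s j))\<^sup>2) \<partial>count_space UNIV) \<in> borel_measurable M"
    unfolding fiber_def by (rule borel_measurable_count_space_integral, rule measurable_M) measurable
  define W where "W = (\<integral>\<^sup>+s. \<integral>\<^sup>+m. ennreal ((cmod (winsum s (fiber f s) m))\<^sup>2) \<partial>count_space UNIV \<partial>M)"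
  define N where "N = (\<integral>\<^sup>+s. \<integral>\<^sup>+j. ennreal ((cmod (fiber f s j))\<^sup>2) \<partial>count_space UNIV \<partial>M)"
  have W: "W = (\<integral>\<^sup>+s. \<integral>\<^sup>+m. ennreal ((cmod (wfun f m s))\<^sup>2) \<partial>count_space UNIV \<partial>M)"
    unfolding W_def by (intro nn_integral_cong) (simp add: wfun_eq)
  have nf: "ennreal (L2_norm_sq f) = N" unfolding N_def by (rule norm_sq_fiber[OF f])
  have nn: "0 \<le> L2_norm_sq f" by (simp add: L2_norm_sq_def)
  have "N \<le> (\<integral>\<^sup>+s. ennreal C * (\<integral>\<^sup>+m. ennreal ((cmod (winsum s (fiber f s) m))\<^sup>2) \<partial>count_space UNIV) \<partial>M)"
    unfolding N_def by (intro nn_integral_mono fib)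
  also have "\<dots> = (\<integral>\<^sup>+s. ennreal C * (\<integral>\<^sup>+m. ennreal ((cmod (wfun f m s))\<^sup>2) \<partial>count_space UNIV) \<partial>M)"
    by (intro nn_integral_cong) (simp add: wfun_eq)
  also have "\<dots> = ennreal C * W"
    unfolding W by (rule nn_integral_cmult[OF sm])
  finally have NW: "N \<le> ennreal C * W" .
  have "ennreal (A * L2_norm_sq f) = ennreal A * N"
    using nn \<open>0 < A\<close> by (simp add: ennreal_mult nf)
  also have "\<dots> \<le> ennreal A * (ennreal C * W)" by (intro mult_left_mono NW) simp
  also have "\<dots> = ennreal b * W"
    using C b_pos by (simp add: A_def mult.assoc[symmetric] ennreal_mult[symmetric])
  finally show "ennreal (A * L2_norm_sq f) \<le> (\<Sum>\<^sub>\<infinity>i. ennreal ((cmod (L2_inner f (gabor_atom (indicator {0..<c}) a b i)))\<^sup>2))"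
    unfolding gabor_sum[OF f] W_def .
  have "W \<le> (\<integral>\<^sup>+s. ennreal K * (\<integral>\<^sup>+j. ennreal ((cmod (fiber f s j))\<^sup>2) \<partial>count_space UNIV) \<partial>M)"
    unfolding W_def by (intro nn_integral_mono winsum_upper)
  also have "\<dots> = ennreal K * N"
    unfolding N_def by (rule nn_integral_cmult[OF fm])
  finally have WN: "W \<le> ennreal K * N" .
  have "ennreal b * W \<le> ennreal b * (ennreal K * N)" by (intro mult_left_mono WN) simp
  also have "\<dots> = ennreal (b * K * L2_norm_sq f)"
    using b_pos K_pos nn by (simp add: ennreal_mult nf mult.assoc)
  also have "\<dots> \<le> ennreal (B * L2_norm_sq f)"
    using nn by (intro ennreal_leI mult_right_mono) (simp_all add: B_def)
  finally show "(\<Sum>\<^sub>\<infinity>i. ennreal ((cmod (L2_inner f (gabor_atom (indicator {0..<c}) a b i)))\<^sup>2)) \<le> ennreal (B * L2_norm_sq f)"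
    unfolding gabor_sum[OF f] W_def .
qed

text \<open>Windows are half-open, so a small move of the coset to the right changes no membership
  among finitely many indices, simultaneously for all \<open>m\<close>.\<close>

lemma window_right_stable:
  assumes "finite S"
  obtains \<epsilon> where "0 < \<epsilon>" "\<epsilon> \<le> b"
    "\<And>s j m. 0 \<le> s \<Longrightarrow> s < \<epsilon> \<Longrightarrow> j \<in> S \<Longrightarrow> j \<in> window s m \<longleftrightarrow> j \<in> window 0 m"
proof -
  \<comment> \<open>The distances from \<open>j b\<close> to the next points strictly above it of
    the multiples of \<open>a\<close> and of their translates by \<open>c\<close>, the only places
    where membership changes.\<close>
  define g where "g j = min ((of_int \<lfloor>of_int j * b / a\<rfloor> + 1) * a - of_int j * b)
      ((of_int \<lfloor>(of_int j * b - c) / a\<rfloor> + 1) * a + c - of_int j * b)" for j :: int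
  have g: "0 < g j" for j
  proof -
    have "of_int j * b / a < of_int \<lfloor>of_int j * b / a\<rfloor> + 1"
      "(of_int j * b - c) / a < of_int \<lfloor>(of_int j * b - c) / a\<rfloor> + 1" by linarith+
    then show ?thesis using a_pos by (simp add: g_def field_simps)
  qed
  define \<epsilon> where "\<epsilon> = Min (insert b (g ` S))"
  have \<epsilon>: "\<epsilon> \<le> b" "\<And>j. j \<in> S \<Longrightarrow> \<epsilon> \<le> g j" "0 < \<epsilon>"
    using assms g b_pos by (auto simp: \<epsilon>_def)
  have eq: "j \<in> window s m \<longleftrightarrow> j \<in> window 0 m" if s: "0 \<le> s" "s < \<epsilon>" and j: "j \<in> S" for s j m
  proof -
    have sg: "s < (of_int \<lfloor>of_int j * b / a\<rfloor> + 1) * a - of_int j * b"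
      "s < (of_int \<lfloor>(of_int j * b - c) / a\<rfloor> + 1) * a + c - of_int j * b"
      using \<epsilon>(2)[OF j] s by (auto simp: g_def)
    have 1: "of_int m * a \<le> s + of_int j * b \<longleftrightarrow> of_int m * a \<le> of_int j * b"
    proof
      assume "of_int m * a \<le> s + of_int j * b"
      then have "of_int m * a < (of_int \<lfloor>of_int j * b / a\<rfloor> + 1) * a" using sg by linarith
      then have "real_of_int m < of_int (\<lfloor>of_int j * b / a\<rfloor> + 1)" using a_pos by simp
      then have "m \<le> \<lfloor>of_int j * b / a\<rfloor>" by linarith
      then show "of_int m * a \<le> of_int j * b" using a_pos by (simp add: le_floor_iff field_simps)
    qed (use s in linarith)
    have 2: "s + of_int j * b < of_int m * a + c \<longleftrightarrow> of_int j * b < of_int m * a + c"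
    proof
      assume "of_int j * b < of_int m * a + c"
      then have "(of_int j * b - c) / a < of_int m" using a_pos by (simp add: field_simps)
      then have "\<lfloor>(of_int j * b - c) / a\<rfloor> + 1 \<le> m" by linarith
      then have "real_of_int (\<lfloor>(of_int j * b - c) / a\<rfloor> + 1) \<le> of_int m" by (simp only: of_int_le_iff)
      then have "(of_int \<lfloor>(of_int j * b - c) / a\<rfloor> + 1) * a \<le> of_int m * a"
        using a_pos by (intro mult_right_mono) auto
      then show "s + of_int j * b < of_int m * a + c" using sg by linarith
    qed (use s in linarith)
    show ?thesis unfolding window_def using 1 2 by simp
  qed
  show ?thesis using that[OF \<epsilon>(3,1)] eq by blast
qed

text \<open>A sequence on the multiples of \<open>b\<close> is thickened to a function constant on
  each \<open>[j b, j b + \<epsilon>)\<close>. Both sides of the frame inequality acquire the factor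
  \<open>\<epsilon>\<close>, so the constant \<open>b / A\<close> does not depend on the sequence
  although \<open>\<epsilon>\<close> does.\<close>

lemma gabor_frame_fiber:
  assumes "gabor_frame (indicator {0..<c}) a b"
  obtains C where "0 < C" "\<And>x. finite {j. x j \<noteq> 0} \<Longrightarrow>
      (\<integral>\<^sup>+j. ennreal ((cmod (x j))\<^sup>2) \<partial>count_space UNIV)
      \<le> ennreal C * (\<integral>\<^sup>+m. ennreal ((cmod (winsum 0 x m))\<^sup>2) \<partial>count_space UNIV)"
proof -
  from assms obtain A where A: "0 < A" and low: "\<And>f. square_integrable f \<Longrightarrow> ennreal (A * L2_norm_sq f)
      \<le> (\<Sum>\<^sub>\<infinity>i. ennreal ((cmod (L2_inner f (gabor_atom (indicator {0..<c}) a b i)))\<^sup>2))"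
    unfolding gabor_frame_def is_frame_def by blast
  have "(\<integral>\<^sup>+j. ennreal ((cmod (x j))\<^sup>2) \<partial>count_space UNIV)
      \<le> ennreal (b / A) * (\<integral>\<^sup>+m. ennreal ((cmod (winsum 0 x m))\<^sup>2) \<partial>count_space UNIV)"
    if fin: "finite {j. x j \<noteq> 0}" for x
  proof -
    define S where "S = {j. x j \<noteq> 0}"
    have S: "finite S" using fin by (simp add: S_def)
    obtain \<epsilon> where \<epsilon>: "0 < \<epsilon>" "\<epsilon> \<le> b"
      "\<And>s j m. 0 \<le> s \<Longrightarrow> s < \<epsilon> \<Longrightarrow> j \<in> S \<Longrightarrow> j \<in> window s m \<longleftrightarrow> j \<in> window 0 m"
      using window_right_stable[OF S] by metis
    define f where "f t = (\<Sum>i\<in>S. x i * indicator {of_int i * b..<of_int i * b + \<epsilon>} t)" for t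
    have [measurable]: "f \<in> borel_measurable borel" unfolding f_def[abs_def] by measurable
    have fib: "fiber f s j = x j * indicator {0..<\<epsilon>} s" if "s \<in> {0..<b}" for s j
    proof -
      have "x i * indicator {of_int i * b..<of_int i * b + \<epsilon>} (s + of_int j * b) = (if i = j then x j * indicator {0..<\<epsilon>} s else 0)" for i
      proof (cases "i = j")
        case True
        then show ?thesis by (auto simp: indicator_def)
      next
        case False
        have "s + of_int j * b \<notin> {of_int i * b..<of_int i * b + \<epsilon>}"
        proof
          assume "s + of_int j * b \<in> {of_int i * b..<of_int i * b + \<epsilon>}"
          then have "\<lfloor>(s + of_int j * b) / b\<rfloor> = i" unfolding floor_div_b_eq using \<epsilon> by auto
          moreover have "\<lfloor>(s + of_int j * b) / b\<rfloor> = j" unfolding floor_div_b_eq using that by auto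
          ultimately show False using False by simp
        qed
        then show ?thesis using False by simp
      qed
      then have "fiber f s j = (\<Sum>i\<in>S. if i = j then x j * indicator {0..<\<epsilon>} s else 0)"
        unfolding fiber_def f_def by (intro sum.cong) auto
      also have "\<dots> = x j * indicator {0..<\<epsilon>} s"
        using S by (auto simp: S_def)
      finally show ?thesis .
    qed
    define X where "X = (\<integral>\<^sup>+j. ennreal ((cmod (x j))\<^sup>2) \<partial>count_space UNIV)"
    define Y where "Y = (\<integral>\<^sup>+m. ennreal ((cmod (winsum 0 x m))\<^sup>2) \<partial>count_space UNIV)"
    have eps: "(\<integral>\<^sup>+s. Z * indicator {0..<\<epsilon>} s \<partial>M) = Z * ennreal \<epsilon>" for Z
    proof -
      have "(\<integral>\<^sup>+s. Z * indicator {0..<\<epsilon>} s \<partial>M) = (\<integral>\<^sup>+s. Z * indicator {0..<\<epsilon>} s * indicator {0..<b} s \<partial>lborel)"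
        by (simp add: M_def nn_integral_restrict_space)
      also have "\<dots> = (\<integral>\<^sup>+s. Z * indicator {0..<\<epsilon>} s \<partial>lborel)"
        using \<epsilon> by (intro nn_integral_cong) (auto simp: indicator_def)
      also have "\<dots> = Z * ennreal \<epsilon>"
        using \<epsilon> by (simp add: nn_integral_cmult)
      finally show ?thesis .
    qed
    have "(\<integral>\<^sup>+s. \<integral>\<^sup>+j. ennreal ((cmod (fiber f s j))\<^sup>2) \<partial>count_space UNIV \<partial>M)
        = (\<integral>\<^sup>+s. X * indicator {0..<\<epsilon>} s \<partial>M)"
      by (intro nn_integral_cong) (auto simp: fib X_def indicator_def)
    then have N: "(\<integral>\<^sup>+s. \<integral>\<^sup>+j. ennreal ((cmod (fiber f s j))\<^sup>2) \<partial>count_space UNIV \<partial>M) = X * ennreal \<epsilon>"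
      using eps by simp
    have "X = (\<integral>\<^sup>+j. ennreal ((cmod (x j))\<^sup>2) * indicator S j \<partial>count_space UNIV)"
      unfolding X_def by (intro nn_integral_cong) (auto simp: S_def indicator_def)
    also have "\<dots> = (\<Sum>j\<in>S. ennreal ((cmod (x j))\<^sup>2))"
      using S by (simp add: nn_integral_count_space_finite flip: nn_integral_count_space_indicator)
    finally have "X < \<infinity>" by simp
    have sq: "square_integrable f"
      unfolding square_integrable_def
    proof
      show "integrable lborel (\<lambda>t. (cmod (f t))\<^sup>2)"
      proof (rule integrableI_nonneg)
        have "(\<integral>\<^sup>+t. ennreal ((cmod (f t))\<^sup>2) \<partial>lborel) = (\<integral>\<^sup>+s. \<integral>\<^sup>+j. ennreal ((cmod (f (s + of_int j * b)))\<^sup>2) \<partial>count_space UNIV \<partial>M)"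
          by (rule nn_integral_periodize) measurable
        also have "\<dots> = X * ennreal \<epsilon>" using N by (simp add: fiber_def)
        also have "\<dots> < \<infinity>" using \<open>X < \<infinity>\<close> by (simp add: ennreal_mult_less_top)
        finally show "(\<integral>\<^sup>+t. ennreal ((cmod (f t))\<^sup>2) \<partial>lborel) < \<infinity>" .
      qed auto
    qed measurable
    have "winsum s (fiber f s) m = winsum 0 x m * indicator {0..<\<epsilon>} s" if s: "s \<in> {0..<b}" for s m
    proof (cases "s < \<epsilon>")
      case False
      then show ?thesis using s by (simp add: winsum_def fib)
    next
      case True
      have "winsum s (fiber f s) m = (\<Sum>j\<in>window s m. x j)"
        using True s by (simp add: winsum_def fib)
      also have "\<dots> = (\<Sum>j\<in>window s m \<inter> S. x j)"
        by (intro sum.mono_neutral_right) (auto simp: S_def)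
      also have "window s m \<inter> S = window 0 m \<inter> S"
        using \<epsilon>(3)[of s] True s by auto
      also have "(\<Sum>j\<in>window 0 m \<inter> S. x j) = winsum 0 x m"
        unfolding winsum_def by (intro sum.mono_neutral_left) (auto simp: S_def)
      finally show ?thesis using True s by simp
    qed
    then have "(\<integral>\<^sup>+s. \<integral>\<^sup>+m. ennreal ((cmod (winsum s (fiber f s) m))\<^sup>2) \<partial>count_space UNIV \<partial>M)
        = (\<integral>\<^sup>+s. Y * indicator {0..<\<epsilon>} s \<partial>M)"
      by (intro nn_integral_cong) (auto simp: Y_def indicator_def)
    then have W: "(\<integral>\<^sup>+s. \<integral>\<^sup>+m. ennreal ((cmod (winsum s (fiber f s) m))\<^sup>2) \<partial>count_space UNIV \<partial>M) = Y * ennreal \<epsilon>"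
      using eps by simp
    have "ennreal A * (X * ennreal \<epsilon>) \<le> ennreal b * (Y * ennreal \<epsilon>)"
      using low[OF sq] A unfolding gabor_sum[OF sq] W
      by (simp add: ennreal_mult' norm_sq_fiber[OF sq] N)
    then have "ennreal (inverse (A * \<epsilon>)) * (ennreal A * (X * ennreal \<epsilon>)) \<le> ennreal (inverse (A * \<epsilon>)) * (ennreal b * (Y * ennreal \<epsilon>))"
      by (rule mult_left_mono) simp
    moreover have "ennreal (inverse (A * \<epsilon>)) * (ennreal A * (X * ennreal \<epsilon>)) = X"
    proof -
      have "ennreal (inverse (A * \<epsilon>)) * (ennreal A * (X * ennreal \<epsilon>)) = ennreal (inverse (A * \<epsilon>)) * ennreal A * ennreal \<epsilon> * X"
        by (simp add: mult_ac)
      also have "ennreal (inverse (A * \<epsilon>)) * ennreal A * ennreal \<epsilon> = 1"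
        using A \<epsilon>(1) by (simp add: ennreal_mult[symmetric] field_simps)
      finally show ?thesis by simp
    qed
    moreover have "ennreal (inverse (A * \<epsilon>)) * (ennreal b * (Y * ennreal \<epsilon>)) = ennreal (b / A) * Y"
    proof -
      have "ennreal (inverse (A * \<epsilon>)) * (ennreal b * (Y * ennreal \<epsilon>)) = ennreal (inverse (A * \<epsilon>)) * ennreal b * ennreal \<epsilon> * Y"
        by (simp add: mult_ac)
      also have "ennreal (inverse (A * \<epsilon>)) * ennreal b * ennreal \<epsilon> = ennreal (b / A)"
        using A \<epsilon> b_pos by (simp add: ennreal_mult[symmetric] field_simps)
      finally show ?thesis by simp
    qed
    ultimately show ?thesis by (simp add: X_def Y_def)
  qed
  then show ?thesis using that[of "b / A"] A b_pos by simp
qed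

end

section \<open>The dynamics of the shifted windows\<close>

text \<open>In the application \<open>k\<close> is the floor of \<open>c / b\<close> and
  \<open>p\<close> that of \<open>k b / a\<close>; here they enter only through \<open>c_eq\<close>,
  \<open>kb_eq\<close> and the bounds on \<open>c0\<close>, \<open>c1\<close> and
  \<open>k\<close>.\<close>

locale hole_dynamics = gabor b a c for b a c :: real +
  fixes k p :: int and c0 c1 :: real
  assumes a_less_b: "a < b" and c_eq: "c = of_int k * b + c0" and kb_eq: "of_int k * b = of_int p * a + c1"
    and c0_gt: "b - a < c0" and c0_less: "c0 < a" and k_ge: "2 \<le> k"
    and c1_pos: "0 < c1" and c1_less: "c1 < 2 * a - b" and irr: "a / b \<notin> \<rat>"
begin

abbreviation d :: real where "d \<equiv> b - a"

lemma d_pos: "0 < d"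
  using a_less_b by simp

lemma b_le_kb: "2 * b \<le> of_int k * b"
  using k_ge b_pos by (intro mult_right_mono) auto

lemma a_le_c: "a < c"
  using b_le_kb c_eq c0_gt a_less_b b_pos by linarith

section \<open>Residues modulo \<open>a\<close> and the maps \<open>R\<close> and
  \<open>Q\<close>\<close>

definition u :: "real \<Rightarrow> real" where "u x = x - of_int \<lfloor>x / a\<rfloor> * a"

lemma u_bounds: "0 \<le> u x" "u x < a"
  using floor_divide_lower[OF a_pos, of x] floor_divide_upper[OF a_pos, of x]
  by (simp_all add: u_def algebra_simps)

lemma floor_div_a_eq: "of_int i * a \<le> x \<Longrightarrow> x < of_int i * a + a \<Longrightarrow> \<lfloor>x / a\<rfloor> = i"
  using a_pos by (simp add: floor_eq_iff field_simps)

lemma u_eq: "0 \<le> r \<Longrightarrow> r < a \<Longrightarrow> x = of_int i * a + r \<Longrightarrow> u x = r"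
  using floor_div_a_eq[of i x] by (simp add: u_def)

lemma u_cases: obtains i where "x = of_int i * a + u x"
  by (metis u_def add.commute diff_add_cancel)

lemma u_shift [simp]: "u (x + of_int i * a) = u x"
proof -
  obtain j where j: "x = of_int j * a + u x" by (rule u_cases)
  show ?thesis
    by (rule u_eq[of _ _ "j + i"]) (use u_bounds[of x] j in \<open>auto simp: algebra_simps\<close>)
qed

lemma u_add: "0 \<le> u x + h \<Longrightarrow> u x + h < a \<Longrightarrow> u (x + h) = u x + h"
proof -
  assume h: "0 \<le> u x + h" "u x + h < a"
  obtain j where j: "x = of_int j * a + u x" by (rule u_cases)
  show ?thesis by (rule u_eq[OF h, of _ j]) (use j in linarith)
qed

text \<open>Passing from the window \<open>[m a, m a + c)\<close> to the next one loses the points of \<open>[m a, m a + a)\<close> and gains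
  those of \<open>[m a + c, m a + a + c)\<close>. On a coset of \<open>b \<int>\<close> at most one point is lost and at most one is gained.
  A lost point \<open>x\<close> outside the hole is replaced by \<open>R x\<close>, a lost point in the hole is not replaced, and a point
  in the gap is gained without a loss. Hence differences of consecutive window sums are
  \<open>f (R x) - f x\<close>, \<open>- f x\<close> and \<open>f y\<close> respectively. \<open>Q\<close> is the inverse of \<open>R\<close>.\<close>

definition hole :: "real \<Rightarrow> bool" where "hole x \<longleftrightarrow> c0 - d \<le> u x \<and> u x < c0"

definition gap :: "real \<Rightarrow> bool" where "gap y \<longleftrightarrow> u (y - of_int k * b) < d"

definition jump :: "real \<Rightarrow> int" where "jump x = (if u x < c0 - d then k + 1 else k)"

definition R :: "real \<Rightarrow> real" where "R x = x + of_int (jump x) * b"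

definition jumpQ :: "real \<Rightarrow> int" where "jumpQ y = (if u (y - of_int k * b) < c0 then k + 1 else k)"

definition Q :: "real \<Rightarrow> real" where "Q y = y - of_int (jumpQ y) * b"

lemma hole_shift [simp]: "hole (x + of_int i * a) \<longleftrightarrow> hole x"
  by (simp add: hole_def)

lemma u_shift_kb [simp]: "u (x + of_int i * a - of_int k * b) = u (x - of_int k * b)"
  using u_shift[of "x - of_int k * b" i] by (simp add: algebra_simps)

lemma gap_shift [simp]: "gap (x + of_int i * a) \<longleftrightarrow> gap x"
  by (simp add: gap_def)

lemma R_shift [simp]: "R (x + of_int i * a) = R x + of_int i * a"
  by (simp add: R_def jump_def)

lemma Q_shift [simp]: "Q (x + of_int i * a) = Q x + of_int i * a"
  by (simp add: Q_def jumpQ_def)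

text \<open>Read relative to \<open>k b\<close> and modulo \<open>a\<close>, \<open>R\<close> sends
  the residues \<open>[0, c0 - d)\<close> to \<open>[d, c0)\<close> and fixes
  \<open>[c0, a)\<close>. Together the images miss exactly \<open>[0, d)\<close>, which is the
  gap.\<close>

lemma R_not_gap:
  assumes "\<not> hole x"
  shows "\<not> gap (R x)" "Q (R x) = x"
proof -
  have "\<not> gap (R x) \<and> Q (R x) = x"
  proof (cases "u x < c0 - d")
    case True
    then have j: "jump x = k + 1" by (simp add: jump_def)
    have "R x - of_int k * b = (x + d) + of_int 1 * a"
      by (simp add: R_def j algebra_simps)
    moreover have "u ((x + d) + of_int 1 * a) = u x + d"
      unfolding u_shift by (rule u_add) (use True u_bounds[of x] d_pos c0_less in linarith)+
    ultimately have "u (R x - of_int k * b) = u x + d" by simp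
    then show ?thesis using True u_bounds[of x] by (simp add: gap_def Q_def jumpQ_def) (simp add: R_def j)
  next
    case False
    then have j: "jump x = k" by (simp add: jump_def)
    have "c0 \<le> u x" using assms False by (simp add: hole_def)
    moreover have "R x - of_int k * b = x" by (simp add: R_def j)
    ultimately show ?thesis using c0_gt by (simp add: gap_def Q_def jumpQ_def)
  qed
  then show "\<not> gap (R x)" "Q (R x) = x" by auto
qed

lemma Q_not_hole:
  assumes "\<not> gap y"
  shows "\<not> hole (Q y)" "R (Q y) = y"
proof -
  have "\<not> hole (Q y) \<and> R (Q y) = y"
  proof (cases "u (y - of_int k * b) < c0")
    case True
    then have j: "jumpQ y = k + 1" by (simp add: jumpQ_def)
    have "Q y = (y - of_int k * b + (- d)) + of_int (-1) * a"
      by (simp add: Q_def j algebra_simps)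
    moreover have "u ((y - of_int k * b + (- d)) + of_int (-1) * a) = u (y - of_int k * b) - d"
      unfolding u_shift 
      by (subst u_add) (use True assms u_bounds[of "y - of_int k * b"] d_pos c0_less in \<open>auto simp: gap_def\<close>)
    ultimately have uQ: "u (Q y) = u (y - of_int k * b) - d" by presburger
    then have "u (Q y) < c0 - d" using True by simp
    then show ?thesis by (simp add: hole_def R_def jump_def) (simp add: Q_def j)
  next
    case False
    then have "Q y = y - of_int k * b" by (simp add: Q_def jumpQ_def)
    then show ?thesis using False d_pos by (simp add: hole_def R_def jump_def)
  qed
  then show "\<not> hole (Q y)" "R (Q y) = y" by auto
qed

lemma R_window:
  assumes "\<not> hole x" "of_int m * a \<le> x" "x < of_int m * a + a"
  shows "of_int m * a + c \<le> R x" "R x < of_int m * a + a + c"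
proof -
  have "\<lfloor>x / a\<rfloor> = m" using assms floor_div_a_eq by blast
  then have x: "x = of_int m * a + u x" by (simp add: u_def)
  have "of_int m * a + c \<le> R x \<and> R x < of_int m * a + a + c"
  proof (cases "u x < c0 - d")
    case True
    then have "R x = of_int m * a + u x + of_int k * b + b" using x by (simp add: R_def jump_def algebra_simps)
    then show ?thesis using True u_bounds[of x] c_eq c0_less a_less_b by linarith
  next
    case False
    then have "R x = of_int m * a + u x + of_int k * b" "c0 \<le> u x" 
      using x assms by (simp_all add: R_def jump_def hole_def)
    then show ?thesis using u_bounds[of x] c_eq d_pos c0_gt by linarith
  qed
  then show "of_int m * a + c \<le> R x" "R x < of_int m * a + a + c" by auto
qed

lemma R_window_less: "\<not> hole x \<Longrightarrow> x < of_int m * a \<Longrightarrow> R x < of_int m * a + c"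
proof -
  assume x: "\<not> hole x" "x < of_int m * a"
  define i where "i = \<lfloor>x / a\<rfloor>"
  have i: "of_int i * a \<le> x" "x < of_int i * a + a" using u_bounds[of x] by (simp_all add: u_def i_def)
  have "of_int i * a < of_int m * a" using i x by linarith
  then have "real_of_int (i + 1) \<le> of_int m" using a_pos by simp
  then have "of_int (i + 1) * a \<le> of_int m * a" using a_pos by (intro mult_right_mono) auto
  then show ?thesis using R_window(2)[OF x(1) i] by (simp add: algebra_simps)
qed

lemma R_window_ge: "\<not> hole x \<Longrightarrow> of_int m * a \<le> x \<Longrightarrow> of_int m * a + c \<le> R x"
proof -
  assume x: "\<not> hole x" "of_int m * a \<le> x"
  define i where "i = \<lfloor>x / a\<rfloor>"
  have i: "of_int i * a \<le> x" "x < of_int i * a + a" using u_bounds[of x] by (simp_all add: u_def i_def)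
  have "real_of_int m \<le> x / a" using x a_pos by (simp add: field_simps)
  then have "m \<le> i" unfolding i_def by linarith
  then have "of_int m * a \<le> of_int i * a" using a_pos by (intro mult_right_mono) auto
  then show ?thesis using R_window(1)[OF x(1) i] by linarith
qed

lemma Q_window:
  assumes "\<not> gap y" "of_int m * a + c \<le> y" "y < of_int m * a + a + c"
  shows "of_int m * a \<le> Q y" "Q y < of_int m * a + a"
proof -
  note Q = Q_not_hole[OF assms(1)]
  show "of_int m * a \<le> Q y"
    using R_window_less[OF Q(1), of m] assms(2) Q(2) by linarith
  show "Q y < of_int m * a + a"
  proof (rule ccontr)
    assume "\<not> Q y < of_int m * a + a"
    then have "of_int (m + 1) * a + c \<le> y"
      using R_window_ge[OF Q(1), of "m + 1"] Q(2) by (simp add: algebra_simps)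
    then show False using assms(3) by (simp add: algebra_simps)
  qed
qed

section \<open>Points leaving and entering a window\<close>

lemma int_multiple_small: "\<bar>of_int j * b\<bar> < b \<Longrightarrow> j = 0"
proof -
  assume "\<bar>of_int j * b\<bar> < b"
  then have "\<bar>real_of_int j\<bar> < 1" using b_pos by (simp add: abs_mult)
  then show ?thesis by linarith
qed

definition leaving :: "real \<Rightarrow> int \<Rightarrow> int set" where
  "leaving t m = {j. of_int m * a \<le> t + of_int j * b \<and> t + of_int j * b < of_int m * a + a}"

definition entering :: "real \<Rightarrow> int \<Rightarrow> int set" where
  "entering t m = {j. of_int m * a + c \<le> t + of_int j * b \<and> t + of_int j * b < of_int m * a + a + c}"

lemma leaving_unique: "i \<in> leaving t m \<Longrightarrow> j \<in> leaving t m \<Longrightarrow> i = j"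
proof -
  assume "i \<in> leaving t m" "j \<in> leaving t m"
  then have "\<bar>of_int i * b - of_int j * b\<bar> < b" unfolding leaving_def mem_Collect_eq using a_less_b by linarith
  then have "i - j = 0" by (intro int_multiple_small) (simp add: left_diff_distrib)
  then show ?thesis by simp
qed

lemma entering_unique: "i \<in> entering t m \<Longrightarrow> j \<in> entering t m \<Longrightarrow> i = j"
proof -
  assume "i \<in> entering t m" "j \<in> entering t m"
  then have "\<bar>of_int i * b - of_int j * b\<bar> < b" unfolding entering_def mem_Collect_eq using a_less_b by linarith
  then have "i - j = 0" by (intro int_multiple_small) (simp add: left_diff_distrib)
  then show ?thesis by simp
qed

lemma leaving_R: "j \<in> leaving t m \<Longrightarrow> \<not> hole (t + of_int j * b) \<Longrightarrow> j + jump (t + of_int j * b) \<in> entering t m"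
proof -
  assume j: "j \<in> leaving t m" and h: "\<not> hole (t + of_int j * b)"
  have "t + of_int (j + jump (t + of_int j * b)) * b = R (t + of_int j * b)"
    by (simp add: R_def algebra_simps)
  then show ?thesis
    using R_window[OF h, of m] j unfolding entering_def leaving_def mem_Collect_eq by simp
qed

lemma entering_Q: "j \<in> entering t m \<Longrightarrow> \<not> gap (t + of_int j * b) \<Longrightarrow> j - jumpQ (t + of_int j * b) \<in> leaving t m"
proof -
  assume j: "j \<in> entering t m" and h: "\<not> gap (t + of_int j * b)"
  have "t + of_int (j - jumpQ (t + of_int j * b)) * b = Q (t + of_int j * b)"
    by (simp add: Q_def algebra_simps)
  then show ?thesis
    using Q_window[OF h, of m] j unfolding entering_def leaving_def mem_Collect_eq by simp
qed

text \<open>An entering point outside the gap comes by \<open>Q\<close> from a leaving point outside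
  the hole, which contradicts uniqueness of the leaving point. An entering gap point, moved back by
  \<open>k b\<close>, lies at distance less than \<open>b\<close> from the hole point on the same
  coset, so the two would coincide.\<close>

lemma leaving_hole:
  assumes i: "i \<in> leaving t m" and h: "hole (t + of_int i * b)"
  shows "entering t m = {}"
proof (rule ccontr)
  assume "entering t m \<noteq> {}"
  then obtain j where j: "j \<in> entering t m" by blast
  define x where "x = t + of_int i * b"
  define y where "y = t + of_int j * b"
  show False
  proof (cases "gap y")
    case False
    then have "j - jumpQ y \<in> leaving t m" using entering_Q[OF j] by (simp add: y_def)
    then have "i = j - jumpQ y" using leaving_unique i by blast
    moreover have "Q y = t + of_int (j - jumpQ y) * b" by (simp add: y_def Q_def algebra_simps)
    ultimately have "x = Q y" by (simp add: x_def)
    then show False using Q_not_hole(1)[OF False] h by (simp add: x_def)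
  next
    case True
    have "\<lfloor>x / a\<rfloor> = m" using i floor_div_a_eq unfolding leaving_def x_def by blast
    then have x: "x = of_int m * a + u x" by (simp add: u_def)
    have xb: "c0 - d \<le> u x" "u x < c0" using h by (simp_all add: hole_def x_def)
    define z where "z = y - of_int k * b"
    have z: "of_int m * a + c0 \<le> z" "z < of_int m * a + a + c0" 
      using j c_eq unfolding entering_def z_def y_def mem_Collect_eq by linarith+
    have uz: "u z < d" using True by (simp add: gap_def z_def)
    \<comment> \<open>Below \<open>m a + a\<close> the residue of \<open>z\<close> would be at least
      \<open>c0\<close>, which exceeds \<open>d\<close>.\<close>
    have z2: "of_int m * a + a \<le> z"
    proof (rule ccontr)
      assume "\<not> of_int m * a + a \<le> z"
      then have "u z = z - of_int m * a"
        using z c0_gt d_pos by (intro u_eq[of _ _ m]) auto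
      then show False using z uz c0_gt by simp
    qed
    have "u z = z - of_int m * a - a"
      using z z2 c0_less by (intro u_eq[of _ _ "m + 1"]) (auto simp: algebra_simps)
    then have "z < of_int m * a + a + d" using uz by simp
    then have "\<bar>z - x\<bar> < b" using x xb z2 c0_gt c0_less d_pos by linarith
    moreover have "z - x = of_int (j - k - i) * b" by (simp add: z_def x_def y_def algebra_simps)
    ultimately have "j - k - i = 0" by (intro int_multiple_small) simp
    then have "z = x" using \<open>z - x = of_int (j - k - i) * b\<close> by simp
    then show False using x xb z2 c0_less by linarith
  qed
qed

lemma entering_gap:
  assumes j: "j \<in> entering t m" and g: "gap (t + of_int j * b)"
  shows "leaving t m = {}"
proof (rule ccontr)
  assume "leaving t m \<noteq> {}"
  then obtain i where i: "i \<in> leaving t m" by blast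
  have nh: "\<not> hole (t + of_int i * b)" using leaving_hole[OF i] j by blast
  have "j = i + jump (t + of_int i * b)" using entering_unique[OF j leaving_R[OF i nh]] .
  then have "t + of_int j * b = R (t + of_int i * b)" by (simp add: R_def algebra_simps)
  then show False using R_not_gap(1)[OF nh] g by simp
qed

definition wsum :: "(real \<Rightarrow> complex) \<Rightarrow> int \<Rightarrow> real \<Rightarrow> complex" where
  "wsum f m t = winsum t (fiber f t) m"

lemma window_leaving_entering: "window t (m + 1) \<union> leaving t m = window t m \<union> entering t m"
  "window t (m + 1) \<inter> leaving t m = {}" "window t m \<inter> entering t m = {}"
  using a_le_c a_pos unfolding window_def leaving_def entering_def by (auto simp: algebra_simps)

lemma finite_leaving [simp]: "finite (leaving t m)" and finite_entering [simp]: "finite (entering t m)"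
proof -
  have "leaving t m \<subseteq> window t m \<union> entering t m" "entering t m \<subseteq> window t (m + 1) \<union> leaving t m" using window_leaving_entering(1)[of t m] by auto
  moreover have "leaving t m \<subseteq> window t m" using a_le_c by (auto simp: leaving_def window_def)
  ultimately show "finite (leaving t m)" "finite (entering t m)"
    by (metis finite_window finite_subset finite_Un)+
qed

lemma wsum_diff: "wsum f (m + 1) t - wsum f m t = (\<Sum>j\<in>entering t m. f (t + of_int j * b)) - (\<Sum>j\<in>leaving t m. f (t + of_int j * b))"
proof -
  have "wsum f (m + 1) t + (\<Sum>j\<in>leaving t m. f (t + of_int j * b)) = (\<Sum>j\<in>window t (m + 1) \<union> leaving t m. f (t + of_int j * b))"
    unfolding wsum_def winsum_def fiber_def using window_leaving_entering(2)[of t m] by (intro sum.union_disjoint[symmetric]) auto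
  also have "\<dots> = wsum f m t + (\<Sum>j\<in>entering t m. f (t + of_int j * b))"
    unfolding window_leaving_entering(1) wsum_def winsum_def fiber_def using window_leaving_entering(3)[of t m] by (intro sum.union_disjoint) auto
  finally show ?thesis by (simp add: algebra_simps)
qed

lemma leaving_floor: "0 \<in> leaving x \<lfloor>x / a\<rfloor>"
  using u_bounds[of x] by (simp add: leaving_def u_def)

lemma entering_floor: "0 \<in> entering y \<lfloor>(y - c) / a\<rfloor>"
  using u_bounds[of "y - c"] by (simp add: entering_def u_def)

lemma singleton_if_unique: "x \<in> A \<Longrightarrow> (\<And>y z. y \<in> A \<Longrightarrow> z \<in> A \<Longrightarrow> y = z) \<Longrightarrow> A = {x}"
  by blast

lemma wsum_step_R:
  assumes "\<not> hole x"
  shows "wsum f (\<lfloor>x / a\<rfloor> + 1) x - wsum f \<lfloor>x / a\<rfloor> x = f (R x) - f x"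
proof -
  have "leaving x \<lfloor>x / a\<rfloor> = {0}" using leaving_floor leaving_unique singleton_if_unique by blast
  moreover have "entering x \<lfloor>x / a\<rfloor> = {jump x}"
    using leaving_R[OF leaving_floor] assms entering_unique singleton_if_unique by force
  ultimately show ?thesis unfolding wsum_diff by (simp add: R_def)
qed

lemma wsum_step_hole:
  assumes "hole x"
  shows "wsum f (\<lfloor>x / a\<rfloor> + 1) x - wsum f \<lfloor>x / a\<rfloor> x = - f x"
proof -
  have "leaving x \<lfloor>x / a\<rfloor> = {0}" using leaving_floor leaving_unique singleton_if_unique by blast
  moreover have "entering x \<lfloor>x / a\<rfloor> = {}"
    using leaving_hole[OF leaving_floor] assms by force
  ultimately show ?thesis unfolding wsum_diff by simp
qed

lemma wsum_step_gap:
  assumes "gap y"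
  shows "wsum f (\<lfloor>(y - c) / a\<rfloor> + 1) y - wsum f \<lfloor>(y - c) / a\<rfloor> y = f y"
proof -
  have "entering y \<lfloor>(y - c) / a\<rfloor> = {0}" using entering_floor entering_unique singleton_if_unique by blast
  moreover have "leaving y \<lfloor>(y - c) / a\<rfloor> = {}"
    using entering_gap[OF entering_floor] assms by force
  ultimately show ?thesis unfolding wsum_diff by simp
qed

lemma window_shift: "j \<in> window (t + of_int i * b) m \<longleftrightarrow> j + i \<in> window t m"
  by (simp add: window_def algebra_simps)

text \<open>Window sums see only the coset, so the recursions along \<open>R\<close> and
  \<open>Q\<close> may keep the original base point.\<close>

lemma wsum_shift: "wsum f m (t + of_int i * b) = wsum f m t"
  unfolding wsum_def winsum_def fiber_def
  by (rule sum.reindex_bij_witness[where i="\<lambda>j. j - i" and j="\<lambda>j. j + i"])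
    (simp_all add: window_shift, simp_all add: algebra_simps)

lemma wsum_R: "wsum f m (R x) = wsum f m x"
  unfolding R_def by (rule wsum_shift)

lemma wsum_Q: "wsum f m (Q x) = wsum f m x"
  using wsum_shift[of f m x "- jumpQ x"] by (simp add: Q_def)

text \<open>\<open>N\<close> counts tested points, and \<open>x\<close> itself is the first one in
  both directions: \<open>surv 0\<close> always holds, \<open>surv 1\<close> already excludes hole
  and gap.\<close>

definition surv :: "nat \<Rightarrow> real \<Rightarrow> bool" where
  "surv N x \<longleftrightarrow> (\<forall>n<N. \<not> hole ((R ^^ n) x) \<and> \<not> gap ((Q ^^ n) x))"

definition S :: "real set" where "S = {x. \<forall>N. surv N x}"

text \<open>One step of \<open>R\<close> or \<open>Q\<close> moves a point by at most
  \<open>(k + 1) b\<close>, so its window index moves by at most \<open>K0\<close>.\<close>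

definition K0 :: int where "K0 = \<lceil>(of_int k + 1) * b / a\<rceil>"

lemma floor_near:
  assumes "\<bar>x - y\<bar> \<le> (of_int k + 1) * b"
  shows "\<bar>\<lfloor>x / a\<rfloor> - \<lfloor>y / a\<rfloor>\<bar> \<le> K0"
proof -
  have "\<bar>x / a - y / a\<bar> \<le> (of_int k + 1) * b / a"
    using assms a_pos by (simp add: divide_right_mono flip: diff_divide_distrib abs_divide)
      (simp add: abs_divide divide_right_mono)
  then have "\<bar>x / a - y / a\<bar> \<le> of_int K0" unfolding K0_def by linarith
  then have 1: "x / a \<le> y / a + of_int K0" and 2: "y / a \<le> x / a + of_int K0" by linarith+
  have "\<lfloor>x / a\<rfloor> \<le> \<lfloor>y / a\<rfloor> + K0" using floor_mono[OF 1] by simp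
  moreover have "\<lfloor>y / a\<rfloor> \<le> \<lfloor>x / a\<rfloor> + K0" using floor_mono[OF 2] by simp
  ultimately show ?thesis by linarith
qed

lemma kb_nonneg: "0 \<le> of_int k * b" using b_le_kb b_pos by linarith

lemma floor_R: "\<bar>\<lfloor>R x / a\<rfloor> - \<lfloor>x / a\<rfloor>\<bar> \<le> K0"
  by (rule floor_near) (use kb_nonneg b_pos in \<open>auto simp: R_def jump_def algebra_simps\<close>)

lemma floor_Q: "\<bar>\<lfloor>Q x / a\<rfloor> - \<lfloor>x / a\<rfloor>\<bar> \<le> K0"
  by (rule floor_near) (use kb_nonneg b_pos in \<open>auto simp: Q_def jumpQ_def algebra_simps\<close>)

lemma floor_c: "\<bar>\<lfloor>(x - c) / a\<rfloor> - \<lfloor>x / a\<rfloor>\<bar> \<le> K0"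
  by (rule floor_near) (use kb_nonneg b_pos c_eq c0_less c_pos a_less_b in \<open>auto simp: algebra_simps\<close>)

lemma K0_pos: "1 \<le> K0"
proof -
  have "0 < (of_int k + 1) * b / a" using kb_nonneg b_pos a_pos by (simp add: algebra_simps)
  then show ?thesis unfolding K0_def by linarith
qed

text \<open>A step of \<open>R\<close> changes \<open>f\<close> by a difference of two consecutive
  window sums, hence by at most \<open>2 B\<close>; at the hole the value of \<open>f\<close> itself
  is such a difference up to sign.\<close>

lemma forward_bound:
  assumes "\<exists>i<n. hole ((R ^^ i) x)"
    and "\<And>m. \<bar>m - \<lfloor>x / a\<rfloor>\<bar> \<le> int n * K0 \<Longrightarrow> cmod (wsum f m x) \<le> B"
  shows "cmod (f x) \<le> 2 * real n * B"
  using assms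
proof (induction n arbitrary: x)
  case 0
  then show ?case by simp
next
  case (Suc n)
  have K: "int (Suc n) * K0 = int n * K0 + K0" "0 \<le> int n * K0" using K0_pos by (simp_all add: algebra_simps)
  have B: "cmod (wsum f \<lfloor>x / a\<rfloor> x) \<le> B" "cmod (wsum f (\<lfloor>x / a\<rfloor> + 1) x) \<le> B"
    by (rule Suc.prems(2); use K K0_pos in linarith)+
  then have B0: "0 \<le> B" using norm_ge_zero order_trans by blast
  have diff: "cmod (wsum f (\<lfloor>x / a\<rfloor> + 1) x - wsum f \<lfloor>x / a\<rfloor> x) \<le> 2 * B"
    using norm_triangle_ineq4[of "wsum f (\<lfloor>x / a\<rfloor> + 1) x" "wsum f \<lfloor>x / a\<rfloor> x"] B by linarith
  show ?case
  proof (cases "hole x")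
    case True
    have "cmod (f x) \<le> 2 * B" using diff wsum_step_hole[OF True, of f] by simp
    also have "\<dots> \<le> 2 * real (Suc n) * B" using B0 by (simp add: algebra_simps)
    finally show ?thesis .
  next
    case False
    obtain i where i: "i < Suc n" "hole ((R ^^ i) x)" using Suc.prems(1) by blast
    then obtain i' where i': "i = Suc i'" using False by (cases i) auto
    have "cmod (f (R x)) \<le> 2 * real n * B"
    proof (rule Suc.IH)
      show "\<exists>i<n. hole ((R ^^ i) (R x))" using i i' by (auto simp: funpow_Suc_right simp del: funpow.simps)
      show "cmod (wsum f m (R x)) \<le> B" if "\<bar>m - \<lfloor>R x / a\<rfloor>\<bar> \<le> int n * K0" for m
        unfolding wsum_R by (rule Suc.prems(2)) (use that floor_R[of x] K in linarith)
    qed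
    moreover have "cmod (f (R x) - f x) \<le> 2 * B" using diff wsum_step_R[OF False, of f] by simp
    ultimately have "cmod (f x) \<le> 2 * real n * B + 2 * B"
      using norm_triangle_ineq4[of "f (R x)" "f (R x) - f x"] by simp
    then show ?thesis by (simp add: algebra_simps)
  qed
qed

text \<open>The mirror image of \<open>forward_bound\<close>, with the gap ending the recursion. The
  extra 1 in the range of \<open>m\<close> pays for the second window at the gap, whose index
  exceeds by one that of \<open>x - c\<close>.\<close>

lemma backward_bound:
  assumes "\<exists>i<n. gap ((Q ^^ i) x)"
    and "\<And>m. \<bar>m - \<lfloor>x / a\<rfloor>\<bar> \<le> int n * K0 + 1 \<Longrightarrow> cmod (wsum f m x) \<le> B"
  shows "cmod (f x) \<le> 2 * real n * B"
  using assms
proof (induction n arbitrary: x)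
  case 0
  then show ?case by simp
next
  case (Suc n)
  have K: "int (Suc n) * K0 = int n * K0 + K0" "0 \<le> int n * K0" using K0_pos by (simp_all add: algebra_simps)
  show ?case
  proof (cases "gap x")
    case True
    have B: "cmod (wsum f \<lfloor>(x - c) / a\<rfloor> x) \<le> B" "cmod (wsum f (\<lfloor>(x - c) / a\<rfloor> + 1) x) \<le> B"
      by (rule Suc.prems(2); use K K0_pos floor_c[of x] in linarith)+
    then have B0: "0 \<le> B" using norm_ge_zero order_trans by blast
    have "cmod (f x) \<le> 2 * B"
      using norm_triangle_ineq4[of "wsum f (\<lfloor>(x - c) / a\<rfloor> + 1) x" "wsum f \<lfloor>(x - c) / a\<rfloor> x"] B
        wsum_step_gap[OF True, of f] by simp
    also have "\<dots> \<le> 2 * real (Suc n) * B" using B0 by (simp add: algebra_simps)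
    finally show ?thesis .
  next
    case False
    note Q = Q_not_hole[OF False]
    have B: "cmod (wsum f \<lfloor>Q x / a\<rfloor> x) \<le> B" "cmod (wsum f (\<lfloor>Q x / a\<rfloor> + 1) x) \<le> B"
      by (rule Suc.prems(2); use K K0_pos floor_Q[of x] in linarith)+
    have "cmod (wsum f (\<lfloor>Q x / a\<rfloor> + 1) (Q x) - wsum f \<lfloor>Q x / a\<rfloor> (Q x)) \<le> 2 * B"
      unfolding wsum_Q
      using norm_triangle_ineq4[of "wsum f (\<lfloor>Q x / a\<rfloor> + 1) x" "wsum f \<lfloor>Q x / a\<rfloor> x"] B by linarith
    then have "cmod (f x - f (Q x)) \<le> 2 * B" using wsum_step_R[OF Q(1), of f] Q(2) by simp
    moreover obtain i where i: "i < Suc n" "gap ((Q ^^ i) x)" using Suc.prems(1) by blast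
    moreover from i obtain i' where i': "i = Suc i'" using False by (cases i) auto
    have "cmod (f (Q x)) \<le> 2 * real n * B"
    proof (rule Suc.IH)
      show "\<exists>i<n. gap ((Q ^^ i) (Q x))" using i i' by (auto simp: funpow_Suc_right simp del: funpow.simps)
      show "cmod (wsum f m (Q x)) \<le> B" if "\<bar>m - \<lfloor>Q x / a\<rfloor>\<bar> \<le> int n * K0 + 1" for m
        unfolding wsum_Q by (rule Suc.prems(2)) (use that floor_Q[of x] K in linarith)
    qed
    ultimately have "cmod (f x) \<le> 2 * real n * B + 2 * B"
      using norm_triangle_ineq[of "f (Q x)" "f x - f (Q x)"] by simp
    then show ?thesis by (simp add: algebra_simps)
  qed
qed

lemma not_surv_bound:
  assumes "\<not> surv n x"
    and "\<And>m. \<bar>m - \<lfloor>x / a\<rfloor>\<bar> \<le> int n * K0 + 1 \<Longrightarrow> cmod (wsum f m x) \<le> B"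
  shows "cmod (f x) \<le> 2 * real n * B"
  using assms forward_bound[of n x f B] backward_bound[of n x f B] by (fastforce simp: surv_def)

definition pair :: "nat \<Rightarrow> real \<Rightarrow> int \<Rightarrow> bool" where
  "pair N t m \<longleftrightarrow> (\<exists>i\<in>window t m. \<exists>j\<in>window t m. i \<noteq> j \<and> surv N (t + of_int i * b) \<and> surv N (t + of_int j * b))"

lemma funpow_R_shift: "(R ^^ n) (x + of_int i * a) = (R ^^ n) x + of_int i * a"
  by (induction n) simp_all

lemma funpow_Q_shift: "(Q ^^ n) (x + of_int i * a) = (Q ^^ n) x + of_int i * a"
  by (induction n) simp_all

lemma surv_shift [simp]: "surv N (x + of_int i * a) \<longleftrightarrow> surv N x"
  by (simp add: surv_def funpow_R_shift funpow_Q_shift)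

lemma window_shift_a: "window (t + of_int i * a) (m + i) = window t m"
  by (auto simp: window_def algebra_simps)

lemma pair_shift_a: "pair N (t + of_int i * a) (m + i) \<longleftrightarrow> pair N t m"
proof -
  have "surv N (t + of_int i * a + of_int j * b) \<longleftrightarrow> surv N (t + of_int j * b)" for j
    using surv_shift[of N "t + of_int j * b" i] by (simp add: algebra_simps)
  then show ?thesis by (simp add: pair_def window_shift_a)
qed

text \<open>A point that does not survive is bounded directly. If \<open>x\<close> survives, no
  other point of its window does, so \<open>f x\<close> is the window sum minus boundedly many
  bounded terms.\<close>

lemma not_pair_bound:
  assumes np: "\<And>t. \<not> pair n t 0"
    and B: "\<And>m. \<bar>m - \<lfloor>x / a\<rfloor>\<bar> \<le> (int n + 1) * K0 + 1 \<Longrightarrow> cmod (wsum f m x) \<le> B"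
  shows "cmod (f x) \<le> (1 + 2 * real n * real (nat \<lceil>c / b\<rceil>)) * B + 2 * real n * B"
proof -
  have K: "(int n + 1) * K0 = int n * K0 + K0" "0 \<le> int n * K0" using K0_pos by (simp_all add: algebra_simps)
  define m where "m = \<lfloor>x / a\<rfloor>"
  have Bm: "cmod (wsum f m x) \<le> B" by (rule B) (use K K0_pos in \<open>simp add: m_def\<close>)
  then have B0: "0 \<le> B" using norm_ge_zero order_trans by blast
  show ?thesis
  proof (cases "surv n x")
    case False
    then have "cmod (f x) \<le> 2 * real n * B"
      by (rule not_surv_bound) (rule B, use K K0_pos in linarith)
    moreover have "0 \<le> (1 + 2 * real n * real (nat \<lceil>c / b\<rceil>)) * B" using B0 by simp
    ultimately show ?thesis by linarith
  next
    case True
    have "m * a \<le> x" "x < m * a + a" using u_bounds[of x] by (simp_all add: u_def m_def)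
    then have w0: "0 \<in> window x m" using a_le_c by (simp add: window_def)
    \<comment> \<open>The hypothesis speaks of window 0; translation by a multiple of
      \<open>a\<close> carries window \<open>m\<close> there.\<close>
    have "\<not> pair n x m" using np[of "x + of_int (- m) * a"] pair_shift_a[of n x "- m" m] by simp
    then have ns: "\<not> surv n (x + of_int j * b)" if "j \<in> window x m" "j \<noteq> 0" for j
      using True w0 that unfolding pair_def by (metis add.right_neutral mult_zero_left of_int_0)
    have fb: "cmod (f (x + of_int j * b)) \<le> 2 * real n * B" if j: "j \<in> window x m" "j \<noteq> 0" for j
    proof (rule not_surv_bound[OF ns[OF j]])
      fix i assume i: "\<bar>i - \<lfloor>(x + of_int j * b) / a\<rfloor>\<bar> \<le> int n * K0 + 1"
      have "\<bar>\<lfloor>(x + of_int j * b) / a\<rfloor> - \<lfloor>x / a\<rfloor>\<bar> \<le> K0"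
      proof (rule floor_near)
        have "\<bar>x + of_int j * b - x\<bar> \<le> c"
          using j(1) \<open>m * a \<le> x\<close> \<open>x < m * a + a\<close> a_le_c unfolding window_def mem_Collect_eq by linarith
        also have "c \<le> (of_int k + 1) * b" using c_eq c0_less a_less_b by (simp add: algebra_simps)
        finally show "\<bar>x + of_int j * b - x\<bar> \<le> (of_int k + 1) * b" .
      qed
      then show "cmod (wsum f i (x + of_int j * b)) \<le> B"
        unfolding wsum_shift by (intro B) (use i K in linarith)
    qed
    have "wsum f m x = (\<Sum>j\<in>window x m. f (x + of_int j * b))"
      by (simp add: wsum_def winsum_def fiber_def)
    also have "\<dots> = f x + (\<Sum>j\<in>window x m - {0}. f (x + of_int j * b))"
      using w0 by (simp add: sum.remove)
    finally have "f x = wsum f m x - (\<Sum>j\<in>window x m - {0}. f (x + of_int j * b))" by simp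
    then have "cmod (f x) \<le> cmod (wsum f m x) + cmod (\<Sum>j\<in>window x m - {0}. f (x + of_int j * b))"
      by (metis norm_triangle_ineq4)
    also have "\<dots> \<le> B + (\<Sum>j\<in>window x m - {0}. 2 * real n * B)"
      using fb by (intro add_mono Bm sum_norm_le) auto
    also have "\<dots> \<le> B + real (nat \<lceil>c / b\<rceil>) * (2 * real n * B)"
    proof -
      have "card (window x m - {0}) \<le> card (window x m)" by (intro card_mono) auto
      also have "\<dots> \<le> nat \<lceil>c / b\<rceil>" unfolding window_def by (rule finite_int_window(2)[OF b_pos])
      finally have "real (card (window x m - {0})) * (2 * real n * B) \<le> real (nat \<lceil>c / b\<rceil>) * (2 * real n * B)"
        using B0 by (intro mult_right_mono) auto
      then show ?thesis by simp
    qed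
    also have "\<dots> \<le> (1 + 2 * real n * real (nat \<lceil>c / b\<rceil>)) * B + 2 * real n * B"
      using B0 by (simp add: algebra_simps)
    finally show ?thesis .
  qed
qed

text \<open>Each entry is controlled by boundedly many nearby window sums, and each window sum is
  used by boundedly many entries; summing squares gives the lower bound uniformly in the
  coset.\<close>

theorem frame_if_no_pair:
  assumes np: "\<And>t. \<not> pair n t 0"
  shows "gabor_frame (indicator {0..<c}) a b"
proof -
  define D where "D = (1 + 2 * real n * real (nat \<lceil>c / b\<rceil>)) + 2 * real n"
  define L where "L = (int n + 1) * K0 + 1"
  have D: "0 < D" by (simp add: D_def add_pos_nonneg)
  have L: "0 < L" using K0_pos by (simp add: L_def add_nonneg_pos)
  define l where "l = real (nat \<lceil>(2 * of_int L + 1) * a / b\<rceil>)"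
  have l: "0 \<le> l" by (simp add: l_def)
  show ?thesis
  proof (rule gabor_frame_if[of "D\<^sup>2 * l + 1"])
    show "0 < D\<^sup>2 * l + 1" using l by (simp add: add_nonneg_pos)
    fix s :: real and x :: "int \<Rightarrow> complex"
    \<comment> \<open>A function on the line whose values along the coset of \<open>s\<close> are
      the given sequence.\<close>
    define f where "f y = x \<lfloor>(y - s) / b\<rfloor>" for y
    have fx: "f (s + of_int j * b) = x j" for j using b_pos by (simp add: f_def)
    have Wf: "wsum f m s = winsum s x m" for m by (simp add: wsum_def winsum_def fiber_def fx)
    define I where "I j = {m. \<bar>m - \<lfloor>(s + of_int j * b) / a\<rfloor>\<bar> \<le> L}" for j
    have I: "finite (I j)" for j
    proof -
      have "I j = {\<lfloor>(s + of_int j * b) / a\<rfloor> - L..\<lfloor>(s + of_int j * b) / a\<rfloor> + L}" by (auto simp: I_def)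
      then show ?thesis by simp
    qed
    have pt: "(cmod (x j))\<^sup>2 \<le> D\<^sup>2 * (\<Sum>m\<in>I j. (cmod (winsum s x m))\<^sup>2)" for j
    proof -
      \<comment> \<open>The Euclidean norm of the nearby window sums bounds each of them, which
        turns a supremum estimate into a summable one.\<close>
      define B where "B = sqrt (\<Sum>m\<in>I j. (cmod (winsum s x m))\<^sup>2)"
      have "cmod (f (s + of_int j * b)) \<le> (1 + 2 * real n * real (nat \<lceil>c / b\<rceil>)) * B + 2 * real n * B"
      proof (rule not_pair_bound[OF np])
        fix m assume m: "\<bar>m - \<lfloor>(s + of_int j * b) / a\<rfloor>\<bar> \<le> (int n + 1) * K0 + 1"
        have "(cmod (winsum s x m))\<^sup>2 \<le> (\<Sum>m\<in>I j. (cmod (winsum s x m))\<^sup>2)"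
          by (rule member_le_sum) (use m I in \<open>auto simp: I_def L_def\<close>)
        then have "cmod (winsum s x m) \<le> B" unfolding B_def by (rule real_le_rsqrt)
        then show "cmod (wsum f m (s + of_int j * b)) \<le> B" by (simp add: wsum_shift Wf)
      qed
      then have "cmod (x j) \<le> D * B" unfolding fx D_def by (simp add: algebra_simps)
      then have "(cmod (x j))\<^sup>2 \<le> (D * B)\<^sup>2" by (intro power_mono) auto
      then show ?thesis by (simp add: B_def power_mult_distrib sum_nonneg)
    qed
    define y where "y m = ennreal ((cmod (winsum s x m))\<^sup>2)" for m
    have "(\<integral>\<^sup>+j. ennreal ((cmod (x j))\<^sup>2) \<partial>count_space UNIV) \<le> (\<integral>\<^sup>+j. ennreal (D\<^sup>2) * (\<integral>\<^sup>+m. y m * indicator (I j) m \<partial>count_space UNIV) \<partial>count_space UNIV)"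
    proof (rule nn_integral_mono)
      fix j
      have "ennreal ((cmod (x j))\<^sup>2) \<le> ennreal (D\<^sup>2 * (\<Sum>m\<in>I j. (cmod (winsum s x m))\<^sup>2))"
        by (rule ennreal_leI[OF pt])
      also have "\<dots> = ennreal (D\<^sup>2) * (\<Sum>m\<in>I j. y m)"
        by (simp add: ennreal_mult sum_nonneg y_def)
      also have "(\<Sum>m\<in>I j. y m) = (\<integral>\<^sup>+m. y m * indicator (I j) m \<partial>count_space UNIV)"
        using I by (simp add: nn_integral_count_space_finite flip: nn_integral_count_space_indicator)
      finally show "ennreal ((cmod (x j))\<^sup>2) \<le> ennreal (D\<^sup>2) * (\<integral>\<^sup>+m. y m * indicator (I j) m \<partial>count_space UNIV)" .
    qed
    also have "\<dots> = ennreal (D\<^sup>2) * (\<integral>\<^sup>+j. \<integral>\<^sup>+m. y m * indicator (I j) m \<partial>count_space UNIV \<partial>count_space UNIV)"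
      by (rule nn_integral_cmult) simp
    also have "(\<integral>\<^sup>+j. \<integral>\<^sup>+m. y m * indicator (I j) m \<partial>count_space UNIV \<partial>count_space UNIV)
        = (\<integral>\<^sup>+m. \<integral>\<^sup>+j. y m * indicator (I j) m \<partial>count_space UNIV \<partial>count_space UNIV)"
      by (rule nn_integral_count_space_nn_integral) auto
    also have "\<dots> \<le> (\<integral>\<^sup>+m. ennreal l * y m \<partial>count_space UNIV)"
    proof (rule nn_integral_mono)
      fix m
      \<comment> \<open>Contains every \<open>j\<close> whose neighbourhood \<open>I j\<close>
        includes \<open>m\<close>: the corresponding points lie in an interval of length
        \<open>(2 L + 1) a\<close>.\<close>
      define J where "J = {j::int. of_int (m - L) * a \<le> s + of_int j * b \<and> s + of_int j * b < of_int (m - L) * a + (2 * of_int L + 1) * a}"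
      have J: "finite J" "card J \<le> nat \<lceil>(2 * of_int L + 1) * a / b\<rceil>"
        unfolding J_def by (rule finite_int_window[OF b_pos])+
      have sub: "m \<in> I j \<Longrightarrow> j \<in> J" for j
      proof -
        assume "m \<in> I j"
        then have "m - L \<le> \<lfloor>(s + of_int j * b) / a\<rfloor>" "\<lfloor>(s + of_int j * b) / a\<rfloor> < m + L + 1" by (auto simp: I_def)
        then have m: "of_int (m - L) \<le> (s + of_int j * b) / a" "(s + of_int j * b) / a < of_int (m + L + 1)"
          by (simp_all only: le_floor_iff floor_less_iff)
        from m(1) have "of_int (m - L) * a \<le> s + of_int j * b"
          using a_pos by (simp add: pos_le_divide_eq del: of_int_diff)
        moreover from m(2) have "s + of_int j * b < of_int (m + L + 1) * a"
          using a_pos by (simp add: pos_divide_less_eq del: of_int_add)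
        ultimately show ?thesis by (simp add: J_def algebra_simps)
      qed
      have "(\<integral>\<^sup>+j. y m * indicator (I j) m \<partial>count_space UNIV) \<le> (\<integral>\<^sup>+j. y m * indicator J j \<partial>count_space UNIV)"
        using sub by (intro nn_integral_mono) (auto simp: indicator_def)
      also have "\<dots> = (\<Sum>j\<in>J. y m)"
        using nn_integral_count_space_indicator[of J "\<lambda>_. y m"]
          nn_integral_count_space_finite[OF J(1), of "\<lambda>_. y m"] by (simp only: NO_MATCH_def)
      also have "\<dots> = ennreal (card J) * y m" by (simp only: sum_constant ennreal_of_nat_eq_real_of_nat)
      also have "\<dots> \<le> ennreal l * y m" using J by (intro mult_right_mono ennreal_leI) (auto simp: l_def)
      finally show "(\<integral>\<^sup>+j. y m * indicator (I j) m \<partial>count_space UNIV) \<le> ennreal l * y m" .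
    qed
    also have "\<dots> = ennreal l * (\<integral>\<^sup>+m. y m \<partial>count_space UNIV)" by (rule nn_integral_cmult) simp
    finally have "(\<integral>\<^sup>+j. ennreal ((cmod (x j))\<^sup>2) \<partial>count_space UNIV) \<le> ennreal (D\<^sup>2) * (ennreal l * (\<integral>\<^sup>+m. y m \<partial>count_space UNIV))"
      by (simp add: mult_left_mono)
    also have "\<dots> = ennreal (D\<^sup>2 * l) * (\<integral>\<^sup>+m. y m \<partial>count_space UNIV)"
      using l by (simp add: ennreal_mult mult.assoc)
    also have "\<dots> \<le> ennreal (D\<^sup>2 * l + 1) * (\<integral>\<^sup>+m. y m \<partial>count_space UNIV)"
      by (intro mult_right_mono ennreal_leI) auto
    finally show "(\<integral>\<^sup>+j. ennreal ((cmod (x j))\<^sup>2) \<partial>count_space UNIV)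
      \<le> ennreal (D\<^sup>2 * l + 1) * (\<integral>\<^sup>+m. ennreal ((cmod (winsum s x m))\<^sup>2) \<partial>count_space UNIV)"
      by (simp add: y_def)
  qed
qed

section \<open>Homogeneity, and two orbits against the frame property\<close>

lemma surv_mono: "surv N x \<Longrightarrow> L \<le> N \<Longrightarrow> surv L x"
  by (simp add: surv_def)

text \<open>The forward tests shift by one, which uses up a step. Backward, the new test at
  \<open>R x\<close> succeeds because \<open>R\<close> never maps a point outside the hole into the
  gap.\<close>

lemma surv_R:
  assumes "surv (Suc N) x"
  shows "surv N (R x)"
  unfolding surv_def
proof (intro allI impI conjI)
  fix n assume n: "n < N"
  have nh: "\<not> hole x" using assms unfolding surv_def by (metis funpow_0 zero_less_Suc)
  have "\<not> hole ((R ^^ Suc n) x)" using assms n unfolding surv_def by (metis Suc_mono)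
  then show "\<not> hole ((R ^^ n) (R x))" by (simp add: funpow_Suc_right del: funpow.simps)
  show "\<not> gap ((Q ^^ n) (R x))"
  proof (cases n)
    case 0
    then show ?thesis using R_not_gap[OF nh] by simp
  next
    case (Suc i)
    then have "(Q ^^ n) (R x) = (Q ^^ i) x"
      using R_not_gap[OF nh] by (simp add: funpow_Suc_right del: funpow.simps)
    then show ?thesis using assms n Suc by (simp add: surv_def)
  qed
qed

lemma surv_Q:
  assumes "surv (Suc N) x"
  shows "surv N (Q x)"
  unfolding surv_def
proof (intro allI impI conjI)
  fix n assume n: "n < N"
  have nh: "\<not> gap x" using assms unfolding surv_def by (metis funpow_0 zero_less_Suc)
  have "\<not> gap ((Q ^^ Suc n) x)" using assms n unfolding surv_def by (metis Suc_mono)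
  then show "\<not> gap ((Q ^^ n) (Q x))" by (simp add: funpow_Suc_right del: funpow.simps)
  show "\<not> hole ((R ^^ n) (Q x))"
  proof (cases n)
    case 0
    then show ?thesis using Q_not_hole[OF nh] by simp
  next
    case (Suc i)
    then have "(R ^^ n) (Q x) = (R ^^ i) x"
      using Q_not_hole[OF nh] by (simp add: funpow_Suc_right del: funpow.simps)
    then show ?thesis using assms n Suc by (simp add: surv_def)
  qed
qed

lemma leaving_subset: "leaving t m \<subseteq> window t m" and entering_subset: "entering t m \<subseteq> window t (m + 1)"
  using a_le_c by (auto simp: leaving_def entering_def window_def algebra_simps)

text \<open>A leaving survivor is replaced by its image under \<open>R\<close>, which enters; other
  survivors stay. This is injective because at most one point leaves and entering points are not in
  the old window.\<close>

lemma pair_up: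
  assumes "pair (Suc N) t m"
  shows "pair N t (m + 1)"
proof -
  obtain i j where ij: "i \<in> window t m" "j \<in> window t m" "i \<noteq> j"
    "surv (Suc N) (t + of_int i * b)" "surv (Suc N) (t + of_int j * b)"
    using assms unfolding pair_def by blast
  define g where "g l = (if l \<in> leaving t m then l + jump (t + of_int l * b) else l)" for l
  have nh: "\<not> hole x" if "surv (Suc N) x" for x using that unfolding surv_def by (metis funpow_0 zero_less_Suc)
  have g: "(l \<in> leaving t m \<and> g l \<in> entering t m \<or> l \<notin> leaving t m \<and> g l = l) \<and> g l \<in> window t (m + 1) \<and> surv N (t + of_int (g l) * b)"
    if l: "l \<in> window t m" "surv (Suc N) (t + of_int l * b)" for l
  proof (cases "l \<in> leaving t m")
    case True
    have "g l \<in> entering t m" using leaving_R[OF True nh[OF l(2)]] True by (simp add: g_def)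
    moreover from this have "g l \<in> window t (m + 1)" using entering_subset by blast
    moreover have "g l = l + jump (t + of_int l * b)" using True by (simp add: g_def)
    then have "t + of_int (g l) * b = R (t + of_int l * b)"
      unfolding R_def by (simp add: distrib_right)
    ultimately show ?thesis using surv_R[OF l(2)] True by simp
  next
    case False
    then show ?thesis using l window_leaving_entering(1)[of t m] surv_mono[OF l(2), of N] by (auto simp: g_def)
  qed
  have "g i \<noteq> g j"
  proof
    assume eq: "g i = g j"
    show False
    proof (cases "i \<in> leaving t m")
      case True
      then have "j \<notin> leaving t m" using ij leaving_unique by blast
      then have "g j = j" "g i \<in> entering t m" using True g ij by blast+
      then show False using eq ij window_leaving_entering(3)[of t m] by auto
    next
      case False
      then have gi: "g i = i" using g ij by blast
      show False
      proof (cases "j \<in> leaving t m")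
        case True
        then have "g j \<in> entering t m" using g ij by blast
        then show False using eq gi ij window_leaving_entering(3)[of t m] by auto
      next
        case False
        then show False using eq gi ij g by auto
      qed
    qed
  qed
  then show ?thesis using g ij unfolding pair_def by blast
qed

lemma pair_down:
  assumes "pair (Suc N) t (m + 1)"
  shows "pair N t m"
proof -
  obtain i j where ij: "i \<in> window t (m + 1)" "j \<in> window t (m + 1)" "i \<noteq> j"
    "surv (Suc N) (t + of_int i * b)" "surv (Suc N) (t + of_int j * b)"
    using assms unfolding pair_def by blast
  define g where "g l = (if l \<in> entering t m then l - jumpQ (t + of_int l * b) else l)" for l
  have nh: "\<not> gap x" if "surv (Suc N) x" for x using that unfolding surv_def by (metis funpow_0 zero_less_Suc)
  have g: "(l \<in> entering t m \<and> g l \<in> leaving t m \<or> l \<notin> entering t m \<and> g l = l) \<and> g l \<in> window t m \<and> surv N (t + of_int (g l) * b)"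
    if l: "l \<in> window t (m + 1)" "surv (Suc N) (t + of_int l * b)" for l
  proof (cases "l \<in> entering t m")
    case True
    have "g l \<in> leaving t m" using entering_Q[OF True nh[OF l(2)]] True by (simp add: g_def)
    moreover from this have "g l \<in> window t m" using leaving_subset by blast
    moreover have "g l = l - jumpQ (t + of_int l * b)" using True by (simp add: g_def)
    then have "t + of_int (g l) * b = Q (t + of_int l * b)"
      unfolding Q_def by (simp add: left_diff_distrib)
    ultimately show ?thesis using surv_Q[OF l(2)] True by simp
  next
    case False
    then show ?thesis using l window_leaving_entering(1)[of t m] surv_mono[OF l(2), of N] by (auto simp: g_def)
  qed
  have "g i \<noteq> g j"
  proof
    assume eq: "g i = g j"
    show False
    proof (cases "i \<in> entering t m")
      case True
      then have "j \<notin> entering t m" using ij entering_unique by blast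
      then have "g j = j" "g i \<in> leaving t m" using True g ij by blast+
      then show False using eq ij window_leaving_entering(2)[of t m] by auto
    next
      case False
      then have gi: "g i = i" using g ij by blast
      show False
      proof (cases "j \<in> entering t m")
        case True
        then have "g j \<in> leaving t m" using g ij by blast
        then show False using eq gi ij window_leaving_entering(2)[of t m] by auto
      next
        case False
        then show False using eq gi ij g by auto
      qed
    qed
  qed
  then show ?thesis using g ij unfolding pair_def by blast
qed

lemma pair_up_n: "pair (N + n) t m \<Longrightarrow> pair N t (m + int n)"
proof (induction n arbitrary: m)
  case (Suc n)
  then have "pair (N + n) t (m + 1)" using pair_up[of "N + n" t m] by simp
  then show ?case using Suc.IH[of "m + 1"] by (simp add: algebra_simps)
qed simp

lemma pair_down_n: "pair (N + n) t m \<Longrightarrow> pair N t (m - int n)"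
proof (induction n arbitrary: m)
  case (Suc n)
  then have "pair (N + n) t (m - 1)" using pair_down[of "N + n" t "m - 1"] by simp
  then show ?case using Suc.IH[of "m - 1"] by (simp add: algebra_simps)
qed simp

lemma pair_shift_b: "pair N (t + of_int i * b) m \<longleftrightarrow> pair N t m"
proof -
  have sh: "pair N s m \<Longrightarrow> pair N (s + of_int i * b) m" for s i
  proof -
    assume "pair N s m"
    then obtain l j where lj: "l \<in> window s m" "j \<in> window s m" "l \<noteq> j"
      "surv N (s + of_int l * b)" "surv N (s + of_int j * b)" unfolding pair_def by blast
    have eq: "s + of_int i * b + of_int (q - i) * b = s + of_int q * b" for q by (simp add: algebra_simps)
    have w: "l - i \<in> window (s + of_int i * b) m" "j - i \<in> window (s + of_int i * b) m"
      using lj by (simp_all add: window_shift)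
    show ?thesis
      unfolding pair_def by (rule bexI[OF _ w(1)], rule bexI[OF _ w(2)]) (use lj in \<open>simp only: eq, simp\<close>)
  qed
  show ?thesis using sh[of t i] sh[of "t + of_int i * b" "- i"] by auto
qed

lemma pair_mono: "pair N t m \<Longrightarrow> L \<le> N \<Longrightarrow> pair L t m"
  unfolding pair_def using surv_mono by blast

text \<open>Translation by \<open>b\<close> is free, since it keeps the coset. Translation by
  \<open>i a\<close> is a shift of the window index and is paid with \<open>|i|\<close> steps of
  survival.\<close>

lemma pair_translate:
  assumes "pair N t 0" "L + nat \<bar>i\<bar> \<le> N"
  shows "pair L (t + of_int i * a + of_int j * b) 0"
proof -
  have "pair (L + nat \<bar>i\<bar>) t 0" using assms pair_mono by blast
  then have "pair L t (- i)"
    using pair_up_n[of L "nat \<bar>i\<bar>" t 0] pair_down_n[of L "nat \<bar>i\<bar>" t 0] by (cases "0 \<le> i") auto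
  then have "pair L (t + of_int i * a) 0" using pair_shift_a[of L t i "- i"] by simp
  then show ?thesis by (simp add: pair_shift_b)
qed

section \<open>Stability under small shifts to the right, and density\<close>

lemma eventually_small: "0 < \<epsilon> \<Longrightarrow> \<forall>\<^sub>F h in at_right (0::real). 0 < h \<and> h < \<epsilon>"
  using eventually_at_right_real[of 0 \<epsilon>] by (auto elim: eventually_mono)

text \<open>Strict upper and weak lower bounds are those that small shifts to the right preserve in
  both directions. Hole, gap, windows and the branches of \<open>R\<close> and \<open>Q\<close> are
  all half-open in this way.\<close>

lemma eventually_less_stable: "\<forall>\<^sub>F h in at_right (0::real). x + h < y \<longleftrightarrow> x < y"
proof (cases "x < y")
  case True
  then show ?thesis using eventually_small[of "y - x"] by (auto elim: eventually_mono)
next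
  case False
  show ?thesis using eventually_small[of 1] False by (auto elim!: eventually_mono)
qed

lemma eventually_u: "\<forall>\<^sub>F h in at_right 0. u (x + h) = u x + h"
proof -
  have "0 < a - u x" using u_bounds[of x] by simp
  from eventually_small[OF this] show ?thesis
  proof eventually_elim
    case (elim h)
    then show ?case using u_bounds[of x] by (intro u_add) auto
  qed
qed

lemma eventually_u_less: "\<forall>\<^sub>F h in at_right 0. u (x + h) < y \<longleftrightarrow> u x < y"
  using eventually_u[of x] eventually_less_stable[of "u x" y] by eventually_elim simp

lemma eventually_hole: "\<forall>\<^sub>F h in at_right 0. hole (x + h) \<longleftrightarrow> hole x"
  using eventually_u_less[of x c0] eventually_u_less[of x "c0 - d"]
  by eventually_elim (auto simp: hole_def not_less[symmetric])

lemma eventually_gap: "\<forall>\<^sub>F h in at_right 0. gap (x + h) \<longleftrightarrow> gap x"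
  using eventually_u_less[of "x - of_int k * b" d]
  by eventually_elim (auto simp: gap_def algebra_simps)

lemma eventually_R: "\<forall>\<^sub>F h in at_right 0. R (x + h) = R x + h"
  using eventually_u_less[of x "c0 - d"]
  by eventually_elim (auto simp: R_def jump_def algebra_simps)

lemma eventually_Q: "\<forall>\<^sub>F h in at_right 0. Q (x + h) = Q x + h"
  using eventually_u_less[of "x - of_int k * b" c0]
proof eventually_elim
  case (elim h)
  have "x + h - of_int k * b = x - of_int k * b + h" by simp
  then have "jumpQ (x + h) = jumpQ x" using elim by (simp only: jumpQ_def)
  then show ?case by (simp add: Q_def)
qed

lemma eventually_funpow_R: "\<forall>\<^sub>F h in at_right 0. (R ^^ n) (x + h) = (R ^^ n) x + h"
proof (induction n)
  case (Suc n)
  then show ?case using eventually_R[of "(R ^^ n) x"] by eventually_elim simp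
qed simp

lemma eventually_funpow_Q: "\<forall>\<^sub>F h in at_right 0. (Q ^^ n) (x + h) = (Q ^^ n) x + h"
proof (induction n)
  case (Suc n)
  then show ?case using eventually_Q[of "(Q ^^ n) x"] by eventually_elim simp
qed simp

lemma eventually_surv: "\<forall>\<^sub>F h in at_right 0. surv N (x + h) \<longleftrightarrow> surv N x"
proof -
  have "\<forall>\<^sub>F h in at_right 0. \<forall>n\<in>{..<N}. (hole ((R ^^ n) (x + h)) \<longleftrightarrow> hole ((R ^^ n) x)) \<and> (gap ((Q ^^ n) (x + h)) \<longleftrightarrow> gap ((Q ^^ n) x))"
  proof (intro eventually_ball_finite ballI)
    fix n
    show "\<forall>\<^sub>F h in at_right 0. (hole ((R ^^ n) (x + h)) \<longleftrightarrow> hole ((R ^^ n) x)) \<and> (gap ((Q ^^ n) (x + h)) \<longleftrightarrow> gap ((Q ^^ n) x))"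
      using eventually_funpow_R[of n x] eventually_funpow_Q[of n x] eventually_hole[of "(R ^^ n) x"] eventually_gap[of "(Q ^^ n) x"]
      by eventually_elim simp
  qed simp
  then show ?thesis by eventually_elim (simp add: surv_def)
qed

lemma eventually_not_pair:
  assumes "\<not> pair N t 0"
  shows "\<forall>\<^sub>F h in at_right 0. \<not> pair N (t + h) 0"
proof -
  \<comment> \<open>The indices that can lie in window 0 of \<open>t + h\<close> for some
    \<open>0 < h < b\<close>; hence the lower end \<open>- b\<close>.\<close>
  define J where "J = {j::int. - b \<le> t + of_int j * b \<and> t + of_int j * b < - b + (b + c)}"
  have J: "finite J" unfolding J_def by (rule finite_int_window(1)[OF b_pos])
  have "\<forall>\<^sub>F h in at_right 0. \<forall>j\<in>J. (surv N (t + of_int j * b + h) \<longleftrightarrow> surv N (t + of_int j * b))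
      \<and> (t + of_int j * b + h < 0 \<longleftrightarrow> t + of_int j * b < 0)"
    using J by (intro eventually_ball_finite ballI eventually_conj eventually_surv eventually_less_stable) auto
  then show ?thesis using eventually_small[OF b_pos]
  proof eventually_elim
    case (elim h)
    have J: "j \<in> J \<and> j \<in> window t 0" if "j \<in> window (t + h) 0" for j
    proof -
      have "0 \<le> t + h + of_int j * b" "t + h + of_int j * b < c" using that by (auto simp: window_def)
      then have "j \<in> J" "0 \<le> t + of_int j * b + h" "t + of_int j * b < c" using elim(2) by (auto simp: J_def)
      then show ?thesis using elim(1) by (force simp: window_def)
    qed
    show ?case
    proof
      assume "pair N (t + h) 0"
      then obtain i j where ij: "i \<in> window (t + h) 0" "j \<in> window (t + h) 0" "i \<noteq> j"
        "surv N (t + h + of_int i * b)" "surv N (t + h + of_int j * b)" unfolding pair_def by blast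
      moreover have "t + h + of_int l * b = t + of_int l * b + h" for l by simp
      ultimately have "surv N (t + of_int i * b)" "surv N (t + of_int j * b)" using elim(1) J by metis+
      then show False using assms J ij unfolding pair_def by blast
    qed
  qed
qed

text \<open>The fractional parts are aimed at \<open>\<epsilon> / (2 b)\<close> with an error below
  \<open>\<epsilon> / (2 b)\<close>, which keeps the combination strictly positive.\<close>

lemma small_combination:
  assumes "0 < \<epsilon>"
  obtains m j :: int where "0 < of_int m * a + of_int j * b" "of_int m * a + of_int j * b < \<epsilon>"
proof -
  have "0 < \<epsilon> / (2 * b)" using assms b_pos by simp
  from sequence_of_fractional_parts_is_dense[OF irr this, of "\<epsilon> / (2 * b)"]
  obtain h n :: int where hn: "\<bar>of_int n * (a / b) - of_int h - \<epsilon> / (2 * b)\<bar> < \<epsilon> / (2 * b)" by blast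
  define y where "y = of_int n * (a / b) - of_int h"
  have "\<bar>y - \<epsilon> / (2 * b)\<bar> < \<epsilon> / (2 * b)" using hn by (simp add: y_def)
  then have "0 < y" "y < \<epsilon> / (2 * b) + \<epsilon> / (2 * b)" by linarith+
  then have "0 < y * b" "y * b < \<epsilon>" using b_pos by (simp_all add: field_simps)
  moreover have "y * b = of_int n * a + of_int (- h) * b" using b_pos by (simp add: y_def field_simps)
  ultimately show ?thesis using that[of n "- h"] by simp
qed

text \<open>The point is that \<open>I\<close> does not depend on \<open>r\<close>: the coefficient
  of \<open>a\<close> is what \<open>pair_translate\<close> charges for. Reducing \<open>r\<close>
  modulo \<open>b\<close> is free, after which a small positive combination \<open>\<eta>\<close> is
  repeated at most \<open>b / \<eta> + 1\<close> times.\<close>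

lemma combination_dense:
  assumes "0 < \<epsilon>"
  obtains I :: nat where "\<And>r. \<exists>m j :: int. nat \<bar>m\<bar> \<le> I \<and> r < of_int m * a + of_int j * b \<and> of_int m * a + of_int j * b < r + \<epsilon>"
proof -
  obtain m1 j1 :: int where mj: "0 < of_int m1 * a + of_int j1 * b" "of_int m1 * a + of_int j1 * b < \<epsilon>"
    using small_combination[OF assms] .
  define \<eta> where "\<eta> = of_int m1 * a + of_int j1 * b"
  have \<eta>: "0 < \<eta>" "\<eta> < \<epsilon>" using mj by (simp_all add: \<eta>_def)
  define I where "I = nat ((\<lfloor>b / \<eta>\<rfloor> + 1) * \<bar>m1\<bar>)"
  have "\<exists>m j :: int. nat \<bar>m\<bar> \<le> I \<and> r < of_int m * a + of_int j * b \<and> of_int m * a + of_int j * b < r + \<epsilon>" for r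
  proof -
    define r' where "r' = r - of_int \<lfloor>r / b\<rfloor> * b"
    have r': "0 \<le> r'" "r' < b"
      using floor_divide_lower[OF b_pos, of r] floor_divide_upper[OF b_pos, of r] by (simp_all add: r'_def algebra_simps)
    define l where "l = \<lfloor>r' / \<eta>\<rfloor> + 1"
    have l: "r' < of_int l * \<eta>" "of_int l * \<eta> \<le> r' + \<eta>"
      using floor_divide_lower[OF \<eta>(1), of r'] floor_divide_upper[OF \<eta>(1), of r'] by (simp_all add: l_def algebra_simps)
    have "r' / \<eta> \<le> b / \<eta>" using r' \<eta> by (intro divide_right_mono) auto
    then have "l \<le> \<lfloor>b / \<eta>\<rfloor> + 1" unfolding l_def by (simp add: floor_mono)
    moreover have l0: "0 \<le> l" using r' \<eta> by (simp add: l_def)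
    ultimately have "\<bar>l * m1\<bar> \<le> (\<lfloor>b / \<eta>\<rfloor> + 1) * \<bar>m1\<bar>" by (simp add: abs_mult mult_right_mono)
    then have "nat \<bar>l * m1\<bar> \<le> I" unfolding I_def by (rule nat_mono)
    moreover have "of_int (l * m1) * a + of_int (l * j1 + \<lfloor>r / b\<rfloor>) * b = of_int l * \<eta> + (r - r')"
      by (simp add: \<eta>_def r'_def algebra_simps)
    ultimately show ?thesis using l \<eta> by (intro exI[of _ "l * m1"] exI[of _ "l * j1 + \<lfloor>r / b\<rfloor>"]) linarith
  qed
  then show ?thesis using that by blast
qed

text \<open>The failure of \<open>pair\<close> is stable under small translations to the right, and a translation by \<open>a\<close> costs
  at most one step of survival; so by density of \<open>a \<int> + b \<int>\<close> one failure would exclude all pairs of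
  long-surviving points.\<close>

lemma pair_everywhere:
  assumes "\<And>N. \<exists>t. pair N t 0"
  shows "pair L t 0"
proof (rule ccontr)
  assume np: "\<not> pair L t 0"
  obtain \<epsilon> where \<epsilon>: "0 < \<epsilon>" "\<And>h. 0 < h \<Longrightarrow> h < \<epsilon> \<Longrightarrow> \<not> pair L (t + h) 0"
    using eventually_not_pair[OF np] unfolding eventually_at_right_field by auto
  obtain I :: nat where I: "\<And>r. \<exists>m j :: int. nat \<bar>m\<bar> \<le> I \<and> r < of_int m * a + of_int j * b \<and> of_int m * a + of_int j * b < r + \<epsilon>"
    using combination_dense[OF \<epsilon>(1)] by blast
  obtain t0 where t0: "pair (L + I) t0 0" using assms by blast
  obtain m j :: int where mj: "nat \<bar>m\<bar> \<le> I" "t - t0 < of_int m * a + of_int j * b" "of_int m * a + of_int j * b < t - t0 + \<epsilon>"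
    using I[of "t - t0"] by blast
  have "pair L (t0 + of_int m * a + of_int j * b) 0"
    by (rule pair_translate[OF t0]) (use mj in simp)
  moreover have "t0 + of_int m * a + of_int j * b = t + (t0 + of_int m * a + of_int j * b - t)" by simp
  ultimately show False using \<epsilon>(2)[of "t0 + of_int m * a + of_int j * b - t"] mj by auto
qed

text \<open>Compactness: a window contains finitely many pairs and survival only shrinks as
  \<open>N\<close> grows, so if every pair failed at some stage, all would have failed at a common
  \<open>N\<close>.\<close>

lemma S_pair:
  assumes "\<And>N. \<exists>t. pair N t 0"
  obtains i j where "i \<in> window t 0" "j \<in> window t 0" "i \<noteq> j" "t + of_int i * b \<in> S" "t + of_int j * b \<in> S"
proof (rule ccontr)
  assume no: "\<not> thesis"
  define F where "F = window t 0 \<times> window t 0"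
  have "\<forall>\<^sub>F N in sequentially. \<forall>q\<in>F. fst q \<noteq> snd q \<longrightarrow> \<not> (surv N (t + of_int (fst q) * b) \<and> surv N (t + of_int (snd q) * b))"
  proof (intro eventually_ball_finite ballI)
    show "finite F" by (simp add: F_def)
    fix q assume q: "q \<in> F"
    show "\<forall>\<^sub>F N in sequentially. fst q \<noteq> snd q \<longrightarrow> \<not> (surv N (t + of_int (fst q) * b) \<and> surv N (t + of_int (snd q) * b))"
    proof (cases "fst q = snd q")
      case False
      then have "t + of_int (fst q) * b \<notin> S \<or> t + of_int (snd q) * b \<notin> S"
        using no that[of "fst q" "snd q"] q by (auto simp: F_def)
      then obtain N where N: "\<not> (surv N (t + of_int (fst q) * b) \<and> surv N (t + of_int (snd q) * b))"
        by (auto simp: S_def)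
      show ?thesis
        using eventually_ge_at_top[of N] by eventually_elim (use N surv_mono in blast)
    qed simp
  qed
  then obtain N where N: "\<And>q. q \<in> F \<Longrightarrow> fst q \<noteq> snd q \<Longrightarrow> \<not> (surv N (t + of_int (fst q) * b) \<and> surv N (t + of_int (snd q) * b))"
    unfolding eventually_sequentially by blast
  obtain i j where ij: "i \<in> window t 0" "j \<in> window t 0" "i \<noteq> j" "surv N (t + of_int i * b)" "surv N (t + of_int j * b)"
    using pair_everywhere[OF assms, of N t] unfolding pair_def by blast
  then show False using N[of "(i, j)"] by (simp add: F_def)
qed

section \<open>Orbits of \<open>R\<close> on the multiples of \<open>b\<close>\<close>

definition R_orbit :: "(int \<Rightarrow> int) \<Rightarrow> bool" where
  "R_orbit J \<longleftrightarrow> (\<forall>n. \<not> hole (of_int (J n) * b) \<and> of_int (J (n + 1)) * b = R (of_int (J n) * b))"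

lemma R_orbit_step: "R_orbit J \<Longrightarrow> J n < J (n + 1)"
proof -
  assume "R_orbit J"
  then have "of_int (J (n + 1)) * b = (of_int (J n) + of_int (jump (of_int (J n) * b))) * b"
    by (simp add: R_orbit_def R_def distrib_right)
  then have "real_of_int (J (n + 1)) = of_int (J n) + of_int (jump (of_int (J n) * b))"
    using b_pos by simp
  moreover have "0 < jump (of_int (J n) * b)" using k_ge by (simp add: jump_def)
  ultimately show ?thesis by linarith
qed

lemma R_orbit_ge:
  assumes "R_orbit J" "n \<le> m"
  shows "J n + (m - n) \<le> J m"
  using assms(2)
proof (induction m rule: int_ge_induct)
  case (step i)
  then show ?case using R_orbit_step[OF assms(1), of i] by simp
qed simp

text \<open>The indices increase strictly, so some orbit point is the first at or above
  \<open>m a\<close>. It lies below \<open>m a + c\<close> because its predecessor lies below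
  \<open>m a\<close>, and its successor is already at or beyond \<open>m a + c\<close>.\<close>

lemma R_orbit_window:
  assumes J: "R_orbit J"
  shows "\<exists>n. window 0 m \<inter> range J = {J n}"
proof -
  define P where "P n \<longleftrightarrow> of_int (J n) * b < of_int m * a" for n
  have "\<exists>n. P n \<and> \<not> P (n + 1)"
  proof (rule ccontr)
    assume "\<nexists>n. P n \<and> \<not> P (n + 1)"
    then have step: "P n \<Longrightarrow> P (n + 1)" for n by blast
    define q where "q = of_int m * a / b"
    have P: "P n \<longleftrightarrow> of_int (J n) < q" for n using b_pos by (simp add: P_def q_def field_simps)
    define n0 where "n0 = min 0 (\<lfloor>q\<rfloor> - J 0 - 1)"
    have "J n0 + (0 - n0) \<le> J 0" by (rule R_orbit_ge[OF J]) (simp add: n0_def)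
    then have "P n0" unfolding P n0_def by linarith
    define n1 where "n1 = max 0 (\<lceil>q\<rceil> - J 0)"
    have "J 0 + (n1 - 0) \<le> J n1" by (rule R_orbit_ge[OF J]) (simp add: n1_def)
    then have "\<not> P n1" unfolding P n1_def by linarith
    have "n0 \<le> n1" by (simp add: n0_def n1_def)
    then have "P n1"
    proof (induction n1 rule: int_ge_induct)
      case base
      then show ?case using \<open>P n0\<close> .
    qed (use step in blast)
    then show False using \<open>\<not> P n1\<close> by blast
  qed
  then obtain n where n: "P n" "\<not> P (n + 1)" by blast
  have nh: "\<not> hole (of_int (J i) * b)" and st: "of_int (J (i + 1)) * b = R (of_int (J i) * b)" for i
    using J by (auto simp: R_orbit_def)
  have w: "J (n + 1) \<in> window 0 m"
    using n R_window_less[OF nh[of n], of m] st[of n] by (simp add: window_def P_def)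
  have after: "J i \<notin> window 0 m" if "n + 1 < i" for i
  proof -
    have "of_int m * a + c \<le> of_int (J (n + 1 + 1)) * b"
      unfolding st[of "n + 1"] using n by (intro R_window_ge nh) (simp add: P_def)
    also have "J (n + 1 + 1) \<le> J i" using R_orbit_ge[OF J, of "n + 1 + 1" i] that by simp
    then have "of_int (J (n + 1 + 1)) * b \<le> of_int (J i) * b" using b_pos by (intro mult_right_mono) auto
    finally show ?thesis by (simp add: window_def)
  qed
  have before: "J i \<notin> window 0 m" if "i < n + 1" for i
  proof -
    have "J i \<le> J n" using R_orbit_ge[OF J, of i n] that by simp
    then have "of_int (J i) * b \<le> of_int (J n) * b" using b_pos by (intro mult_right_mono) auto
    then show ?thesis using n(1) by (simp add: window_def P_def)
  qed
  have "window 0 m \<inter> range J = {J (n + 1)}"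
  proof (rule antisym; rule subsetI)
    fix y assume y: "y \<in> window 0 m \<inter> range J"
    then obtain i where "y = J i" by blast
    then show "y \<in> {J (n + 1)}" using y after[of i] before[of i] by (cases i "n + 1" rule: linorder_cases) auto
  qed (use w in auto)
  then show ?thesis by blast
qed

text \<open>Every window contains exactly one point of each orbit, so the difference of the two orbit indicators has
  vanishing window sums; truncating it leaves boundedly many nonzero ones.\<close>

theorem not_frame_if_orbits:
  assumes J1: "R_orbit J1" and J2: "R_orbit J2" and disj: "range J1 \<inter> range J2 = {}"
  shows "\<not> gabor_frame (indicator {0..<c}) a b"
proof
  assume "gabor_frame (indicator {0..<c}) a b"
  then obtain C where C: "0 < C" and fib: "\<And>x. finite {j. x j \<noteq> 0} \<Longrightarrow>
      (\<integral>\<^sup>+j. ennreal ((cmod (x j))\<^sup>2) \<partial>count_space UNIV)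
      \<le> ennreal C * (\<integral>\<^sup>+m. ennreal ((cmod (winsum 0 x m))\<^sup>2) \<partial>count_space UNIV)"
    using gabor_frame_fiber by metis
  define k1 where "k1 = nat \<lceil>c / b\<rceil>"
  define k2 where "k2 = nat \<lceil>c / a\<rceil>"
  define z where "z j = indicator (range J1) j - (indicator (range J2) j :: complex)" for j
  have z1: "cmod (z j) \<le> 1" for j using disj by (auto simp: z_def indicator_def)
  have zsum: "(\<Sum>j\<in>window 0 m. z j) = 0" for m
  proof -
    obtain n1 n2 where n: "window 0 m \<inter> range J1 = {J1 n1}" "window 0 m \<inter> range J2 = {J2 n2}"
      using R_orbit_window J1 J2 by metis
    have "(\<Sum>j\<in>window 0 m. indicator A j) = (of_nat (card (window 0 m \<inter> A)) :: complex)" for A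
      by (simp add: indicator_def sum.inter_restrict[symmetric] flip: sum.inter_filter)
    then show ?thesis unfolding z_def sum_subtractf by (simp add: n)
  qed
  have bound: "real N \<le> C * (real (2 * k2) * (real k1)\<^sup>2)" for N :: nat
  proof -
    \<comment> \<open>A truncation radius that keeps the \<open>N\<close> entries at
      \<open>J1 0, ..., J1 (N - 1)\<close>, each of modulus 1.\<close>
    define T where "T = Max (insert 0 ((\<lambda>n. \<bar>J1 n\<bar>) ` {0..<int N}))"
    have T: "\<bar>J1 n\<bar> \<le> T" if "n \<in> {0..<int N}" for n
      unfolding T_def using that by (intro Max_ge) auto
    define x where "x j = (if \<bar>j\<bar> \<le> T then z j else 0)" for j
    have fin: "finite {j. x j \<noteq> 0}"
      by (rule finite_subset[of _ "{-T..T}"]) (auto simp: x_def)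
    have inj: "inj_on J1 {0..<int N}"
    proof (rule inj_onI)
      fix i j assume "J1 i = J1 j"
      then show "i = j"
        using R_orbit_ge[OF J1, of i j] R_orbit_ge[OF J1, of j i] by (cases i j rule: linorder_cases) auto
    qed
    have x1: "cmod (x (J1 n)) = 1" if "n \<in> {0..<int N}" for n
    proof -
      have "J1 n \<notin> range J2" using disj by blast
      then show ?thesis using T[OF that] by (simp add: x_def z_def)
    qed
    have "ennreal (real N) = (\<Sum>j\<in>J1 ` {0..<int N}. ennreal ((cmod (x j))\<^sup>2))"
      using x1 by (simp add: sum.reindex[OF inj] ennreal_of_nat_eq_real_of_nat)
    also have "\<dots> \<le> (\<integral>\<^sup>+j. ennreal ((cmod (x j))\<^sup>2) \<partial>count_space UNIV)"
      by (rule sum_le_nn_integral_count_space) simp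
    also have "\<dots> \<le> ennreal C * (\<integral>\<^sup>+m. ennreal ((cmod (winsum 0 x m))\<^sup>2) \<partial>count_space UNIV)"
      by (rule fib[OF fin])
    also have "(\<integral>\<^sup>+m. ennreal ((cmod (winsum 0 x m))\<^sup>2) \<partial>count_space UNIV) \<le> ennreal (real (2 * k2) * (real k1)\<^sup>2)"
    proof -
      \<comment> \<open>Truncation disturbs only windows containing \<open>T b\<close> or
        \<open>- T b\<close>; their number is bounded independently of \<open>N\<close>.\<close>
      define B1 where "B1 = {m::int. of_int m * a \<le> of_int T * b \<and> of_int T * b < of_int m * a + c}"
      define B2 where "B2 = {m::int. of_int m * a \<le> - of_int T * b \<and> - of_int T * b < of_int m * a + c}"
      have B: "finite B1" "card B1 \<le> k2" "finite B2" "card B2 \<le> k2"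
        unfolding B1_def B2_def k2_def by (rule finite_int_window_left[OF a_pos])+
      have zero: "winsum 0 x m = 0" if m: "m \<notin> B1 \<union> B2" for m
      proof (cases "\<exists>j\<in>window 0 m. \<bar>j\<bar> \<le> T")
        case False
        then show ?thesis by (simp add: winsum_def x_def)
      next
        case True
        then obtain j where j: "j \<in> window 0 m" "\<bar>j\<bar> \<le> T" by blast
        have "\<bar>i\<bar> \<le> T" if i: "i \<in> window 0 m" for i
        proof (rule ccontr)
          assume "\<not> \<bar>i\<bar> \<le> T"
          then consider "T < i" | "i < - T" by linarith
          then show False
          proof cases
            case 1
            then have "real_of_int j * b \<le> of_int T * b" "real_of_int T * b < of_int i * b"
              using j b_pos by auto
            then show False using m i j unfolding B1_def window_def by auto
          next
            case 2
            then have "- T \<le> j" using j by linarith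
            then have "real_of_int (- T) * b \<le> of_int j * b" using b_pos by (intro mult_right_mono) auto
            moreover have "of_int i * b < real_of_int (- T) * b" using 2 b_pos by (intro mult_strict_right_mono) auto
            ultimately show False using m i j unfolding B2_def window_def by auto
          qed
        qed
        then have "winsum 0 x m = (\<Sum>j\<in>window 0 m. z j)" by (simp add: winsum_def x_def)
        then show ?thesis using zsum by simp
      qed
      have le: "cmod (winsum 0 x m) \<le> real k1" for m
      proof -
        have "cmod (winsum 0 x m) \<le> (\<Sum>j\<in>window 0 m. 1)"
          unfolding winsum_def using z1 by (intro sum_norm_le) (simp add: x_def)
        also have "\<dots> \<le> real k1"
          using finite_int_window(2)[OF b_pos, of "of_int m * a" 0 c] by (simp add: window_def k1_def)
        finally show ?thesis .
      qed
      have "(\<integral>\<^sup>+m. ennreal ((cmod (winsum 0 x m))\<^sup>2) \<partial>count_space UNIV)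
          \<le> (\<integral>\<^sup>+m. ennreal ((real k1)\<^sup>2) * indicator (B1 \<union> B2) m \<partial>count_space UNIV)"
      proof (rule nn_integral_mono)
        fix m
        show "ennreal ((cmod (winsum 0 x m))\<^sup>2) \<le> ennreal ((real k1)\<^sup>2) * indicator (B1 \<union> B2) m"
          using zero[of m] le[of m] by (cases "m \<in> B1 \<union> B2") (auto intro!: ennreal_leI power_mono)
      qed
      also have "\<dots> = ennreal ((real k1)\<^sup>2) * of_nat (card (B1 \<union> B2))"
        using B by (simp add: nn_integral_cmult)
      also have "\<dots> \<le> ennreal ((real k1)\<^sup>2) * of_nat (2 * k2)"
      proof -
        have "card (B1 \<union> B2) \<le> 2 * k2" using B card_Un_le[of B1 B2] by linarith
        then show ?thesis by (intro mult_left_mono of_nat_mono zero_le)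
      qed
      also have "\<dots> = ennreal (real (2 * k2) * (real k1)\<^sup>2)"
        by (simp only: ennreal_mult[OF of_nat_0_le_iff zero_le_power2] ennreal_of_nat_eq_real_of_nat mult.commute)
      finally show ?thesis .
    qed
    finally have "ennreal (real N) \<le> ennreal C * ennreal (real (2 * k2) * (real k1)\<^sup>2)"
      by (simp add: mult_left_mono)
    then have "ennreal (real N) \<le> ennreal (C * (real (2 * k2) * (real k1)\<^sup>2))"
      using C by (simp only: ennreal_mult'[OF less_imp_le])
    then show ?thesis using C by (simp add: ennreal_le_iff del: of_nat_mult)
  qed
  obtain N :: nat where "C * (real (2 * k2) * (real k1)\<^sup>2) < real N" using reals_Archimedean2 by blast
  then show False using bound[of N] by linarith
qed

end

section \<open>Two orbits from the arithmetic conditions\<close>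

lemma int_telescope:
  fixes f :: "int \<Rightarrow> 'a::ab_group_add"
  assumes "0 \<le> N"
  shows "(\<Sum>n\<in>{1..N}. f (n - 1) - f n) = f 0 - f N"
  using assms
proof (induction N rule: int_ge_induct)
  case (step i)
  have "{1..i + 1} = insert (i + 1) {1..i}" using step by auto
  then show ?case using step by simp
qed simp

context hole_dynamics
begin

lemma lin_indep:
  fixes i j :: int
  assumes "of_int i * a + of_int j * b = 0"
  shows "i = 0" "j = 0"
proof -
  show "i = 0"
  proof (rule ccontr)
    assume "i \<noteq> 0"
    then have "a / b = of_int (- j) / of_int i"
      using assms b_pos by (simp add: field_simps add_eq_0_iff2)
    then have "a / b \<in> \<rat>" by (metis Rats_divide Rats_of_int)
    then show False using irr by blast
  qed
  then show "j = 0" using assms b_pos by simp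
qed

lemma lin_indep_eq:
  fixes i j i' j' :: int
  assumes "of_int i * a + of_int j * b = of_int i' * a + of_int j' * b"
  shows "i = i'" "j = j'"
  using lin_indep[of "i - i'" "j - j'"] assms by (simp_all add: algebra_simps)

text \<open>The orbit is continued backward by \<open>Q\<close>, which inverts \<open>R\<close> off
  the gap. Both maps move by multiples of \<open>b\<close>, so the orbit stays on the multiples of
  \<open>b\<close>.\<close>

lemma invariant_orbit:
  assumes G: "\<And>x. x \<in> G \<Longrightarrow> \<not> hole x \<and> \<not> gap x \<and> R x \<in> G \<and> Q x \<in> G" and x: "of_int j * b \<in> G"
  obtains J where "R_orbit J" "\<And>n. of_int (J n) * b \<in> G"
proof -
  define o' where "o' n = (if 0 \<le> n then (R ^^ nat n) (of_int j * b) else (Q ^^ nat (- n)) (of_int j * b))" for n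
  have RG: "(R ^^ n) (of_int j * b) \<in> G" for n by (induction n) (use x G in auto)
  have QG: "(Q ^^ n) (of_int j * b) \<in> G" for n by (induction n) (use x G in auto)
  have G': "o' n \<in> G" for n using RG QG by (simp add: o'_def)
  have st: "o' (n + 1) = R (o' n)" for n
  proof (cases "0 \<le> n")
    case True
    then have "nat (n + 1) = Suc (nat n)" by simp
    then show ?thesis using True by (simp add: o'_def)
  next
    case False
    define i where "i = nat (- (n + 1))"
    have "nat (- n) = Suc i" using False by (simp add: i_def)
    then have "R (o' n) = R (Q ((Q ^^ i) (of_int j * b)))" using False by (simp add: o'_def)
    also have "\<dots> = (Q ^^ i) (of_int j * b)" using Q_not_hole(2) G QG by blast
    also have "\<dots> = o' (n + 1)"
      using False by (cases "n = -1") (simp_all add: o'_def i_def)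
    finally show ?thesis by simp
  qed
  have RZ: "\<exists>l::int. (R ^^ n) (of_int j * b) = of_int l * b" for n
  proof (induction n)
    case (Suc n)
    then obtain l :: int where l: "(R ^^ n) (of_int j * b) = of_int l * b" by blast
    then have "(R ^^ Suc n) (of_int j * b) = of_int (l + jump (of_int l * b)) * b"
      by (simp add: R_def distrib_right)
    then show ?case by blast
  qed auto
  have QZ: "\<exists>l::int. (Q ^^ n) (of_int j * b) = of_int l * b" for n
  proof (induction n)
    case (Suc n)
    then obtain l :: int where l: "(Q ^^ n) (of_int j * b) = of_int l * b" by blast
    then have "(Q ^^ Suc n) (of_int j * b) = of_int (l - jumpQ (of_int l * b)) * b"
      by (simp add: Q_def left_diff_distrib)
    then show ?case by blast
  qed auto
  have "\<exists>l::int. o' n = of_int l * b" for n using RZ QZ by (simp add: o'_def)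
  then obtain J where J: "\<And>n. o' n = of_int (J n) * b" by metis
  have "R_orbit J" unfolding R_orbit_def J[symmetric] using st G' G by simp
  moreover have "of_int (J n) * b \<in> G" for n using G' by (simp add: J[symmetric])
  ultimately show ?thesis using that by blast
qed

end

text \<open>Collapsing the gaps turns \<open>R\<close> modulo \<open>a\<close> into the rotation by \<open>\<theta>\<close> modulo \<open>L\<close>; conversely
  \<open>Psi\<close> re-inserts a gap of length \<open>d\<close> at each of the points \<open>n \<theta> + L \<int>\<close>, \<open>1 \<le> n \<le> N\<close>.\<close>

locale gap_insertion = hole_dynamics +
  fixes N m d1 :: int and L \<theta> c0' :: real
  assumes L_def: "L = a - of_int N * (b - a)" and \<theta>_def: "\<theta> = c1 - of_int m * (b - a)"
    and c0'_def: "c0' = c0 - (of_int d1 + 1) * (b - a)"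
    and c0'_pos: "0 < c0'" and c0'_less: "c0' < L" and N_pos: "1 \<le> N"
    and N_\<theta>: "of_int N * \<theta> = c0' + of_int m * L"
    and count: "int (card {n. 1 \<le> n \<and> n \<le> N \<and> (\<exists>i::int. 0 \<le> of_int n * \<theta> - of_int i * L \<and> of_int n * \<theta> - of_int i * L < c0')}) = d1"
    and det: "2 \<le> (k - m) * (1 + N) + N * (m - p)"
begin

lemma L_pos: "0 < L"
  using c0'_pos c0'_less by simp

lemma \<theta>_comb: "\<theta> = of_int (m - p) * a + of_int (k - m) * b"
  using kb_eq by (simp add: \<theta>_def algebra_simps)

lemma L_comb: "L = of_int (1 + N) * a + of_int (- N) * b"
  by (simp add: L_def algebra_simps)

text \<open>The coefficient matrix of \<open>\<theta>\<close> and \<open>L\<close> in terms of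
  \<open>a\<close> and \<open>b\<close> has, up to sign, the determinant bounded below in
  \<open>det\<close>; that number is the index of the lattice spanned by \<open>\<theta>\<close> and
  \<open>L\<close>.\<close>

lemma \<theta>_L_comb: "of_int x * \<theta> + of_int y * L
    = of_int (x * (m - p) + y * (1 + N)) * a + of_int (x * (k - m) - y * N) * b"
  unfolding \<theta>_comb L_comb by (simp add: algebra_simps)

text \<open>Eliminating \<open>y\<close> by Cramer's rule leaves \<open>x\<close> times the
  determinant equal to 0.\<close>

lemma \<theta>_L_indep:
  assumes "of_int x * \<theta> = of_int y * L"
  shows "x = 0"
proof -
  have "of_int x * \<theta> + of_int (- y) * L = 0" using assms by simp
  then have *: "of_int (x * (m - p) + - y * (1 + N)) * a + of_int (x * (k - m) - - y * N) * b = 0"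
    unfolding \<theta>_L_comb .
  have e: "x * (m - p) + - y * (1 + N) = 0" "x * (k - m) - - y * N = 0"
    using lin_indep[OF *] by blast+
  have "x * ((k - m) * (1 + N) + N * (m - p))
      = (1 + N) * (x * (k - m) - - y * N) + N * (x * (m - p) + - y * (1 + N))"
    by (simp add: algebra_simps)
  also have "\<dots> = 0" unfolding e by simp
  finally show ?thesis using det by simp
qed

text \<open>For \<open>y \<ge> 0\<close> the difference of floors counts the points
  \<open>n \<theta> + i L\<close> in \<open>(0, y]\<close>, and each of them pushes the image by
  \<open>d\<close>; for negative \<open>y\<close> the count carries a sign. Including the right end
  makes each inserted gap end at the image of its point.\<close>

definition Psi :: "real \<Rightarrow> real" where
  "Psi y = y + d * of_int (\<Sum>n\<in>{1..N}. \<lfloor>(y - of_int n * \<theta>) / L\<rfloor> - \<lfloor>- (of_int n * \<theta>) / L\<rfloor>)"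

lemma Psi_0: "Psi 0 = 0"
  by (simp add: Psi_def)

lemma Psi_mono: "y \<le> y' \<Longrightarrow> Psi y' - Psi y \<ge> y' - y"
proof -
  assume y: "y \<le> y'"
  have "\<lfloor>(y - z) / L\<rfloor> \<le> \<lfloor>(y' - z) / L\<rfloor>" for z
    using y L_pos by (intro floor_mono divide_right_mono) auto
  then have "(\<Sum>n\<in>{1..N}. \<lfloor>(y - of_int n * \<theta>) / L\<rfloor> - \<lfloor>- (of_int n * \<theta>) / L\<rfloor>)
      \<le> (\<Sum>n\<in>{1..N}. \<lfloor>(y' - of_int n * \<theta>) / L\<rfloor> - \<lfloor>- (of_int n * \<theta>) / L\<rfloor>)"
    by (intro sum_mono) simp
  then have "real_of_int (\<Sum>n\<in>{1..N}. \<lfloor>(y - of_int n * \<theta>) / L\<rfloor> - \<lfloor>- (of_int n * \<theta>) / L\<rfloor>)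
      \<le> of_int (\<Sum>n\<in>{1..N}. \<lfloor>(y' - of_int n * \<theta>) / L\<rfloor> - \<lfloor>- (of_int n * \<theta>) / L\<rfloor>)"
    by (simp only: of_int_le_iff)
  from mult_left_mono[OF this, of d] show ?thesis using d_pos by (simp add: Psi_def)
qed

lemma Psi_inj: "Psi y = Psi y' \<Longrightarrow> y = y'"
  using Psi_mono[of y y'] Psi_mono[of y' y] by (cases y y' rule: linorder_cases) auto

lemma Psi_shift: "Psi (y + of_int i * L) = Psi y + of_int i * a"
proof -
  have "\<lfloor>(y + of_int i * L - z) / L\<rfloor> = \<lfloor>(y - z) / L\<rfloor> + i" for z
  proof -
    have "(y + of_int i * L - z) / L = (y - z) / L + of_int i" using L_pos by (simp add: field_simps)
    then show ?thesis by simp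
  qed
  then have "(\<Sum>n\<in>{1..N}. \<lfloor>(y + of_int i * L - of_int n * \<theta>) / L\<rfloor> - \<lfloor>- (of_int n * \<theta>) / L\<rfloor>)
      = (\<Sum>n\<in>{1..N}. (\<lfloor>(y - of_int n * \<theta>) / L\<rfloor> - \<lfloor>- (of_int n * \<theta>) / L\<rfloor>) + i)"
    by (intro sum.cong) simp_all
  also have "\<dots> = (\<Sum>n\<in>{1..N}. \<lfloor>(y - of_int n * \<theta>) / L\<rfloor> - \<lfloor>- (of_int n * \<theta>) / L\<rfloor>) + N * i"
    using N_pos by (simp only: sum.distrib) simp
  finally have "Psi (y + of_int i * L) = Psi y + of_int i * L + d * (of_int N * of_int i)"
    by (simp add: Psi_def distrib_left)
  then show ?thesis by (simp add: L_def algebra_simps)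
qed

text \<open>Replacing \<open>y\<close> by \<open>y + \<theta>\<close> shifts the index
  \<open>n\<close> by one, so the sum telescopes to its two end terms. The remaining difference of
  floors is 1 if \<open>y\<close> modulo \<open>L\<close> is below \<open>c0'\<close> and 0
  otherwise, which is the choice between the two branches of \<open>R\<close>.\<close>

lemma Psi_rotate: "Psi (y + \<theta>) = Psi y + c1 + d * of_int (\<lfloor>y / L\<rfloor> - \<lfloor>(y - c0') / L\<rfloor>)"
proof -
  define f where "f n = \<lfloor>(y - of_int n * \<theta>) / L\<rfloor>" for n :: int
  define g where "g n = \<lfloor>- (of_int n * \<theta>) / L\<rfloor>" for n :: int
  have "\<lfloor>(y + \<theta> - of_int n * \<theta>) / L\<rfloor> = f (n - 1)" for n :: int
    unfolding f_def by (simp add: algebra_simps)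
  then have "(\<Sum>n\<in>{1..N}. \<lfloor>(y + \<theta> - of_int n * \<theta>) / L\<rfloor> - g n) = (\<Sum>n\<in>{1..N}. f n - g n) + (\<Sum>n\<in>{1..N}. f (n - 1) - f n)"
    unfolding sum.distrib[symmetric] by (intro sum.cong) simp_all
  also have "(\<Sum>n\<in>{1..N}. f (n - 1) - f n) = f 0 - f N" using N_pos by (intro int_telescope) simp
  finally have "Psi (y + \<theta>) = Psi y + \<theta> + d * of_int (f 0 - f N)"
    by (simp add: Psi_def f_def g_def distrib_left)
  moreover have "f N = \<lfloor>(y - c0') / L\<rfloor> - m"
  proof -
    have "(y - of_int N * \<theta>) / L = (y - c0') / L - of_int m"
      unfolding N_\<theta> using L_pos by (simp add: field_simps)
    then show ?thesis by (simp add: f_def)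
  qed
  moreover have "f 0 = \<lfloor>y / L\<rfloor>" by (simp add: f_def)
  ultimately show ?thesis by (simp add: \<theta>_def algebra_simps)
qed

definition res :: "int \<Rightarrow> real" where "res n = of_int n * \<theta> - of_int \<lfloor>of_int n * \<theta> / L\<rfloor> * L"

lemma res_bounds: "0 \<le> res n" "res n < L"
  using floor_divide_lower[OF L_pos, of "of_int n * \<theta>"] floor_divide_upper[OF L_pos, of "of_int n * \<theta>"]
  by (simp_all add: res_def algebra_simps)

lemma res_pos: "n \<noteq> 0 \<Longrightarrow> 0 < res n"
proof -
  assume "n \<noteq> 0"
  then have "of_int n * \<theta> \<noteq> of_int \<lfloor>of_int n * \<theta> / L\<rfloor> * L" using \<theta>_L_indep by blast
  then show ?thesis using res_bounds[of n] by (simp add: res_def)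
qed

lemma res_unique: "0 \<le> of_int n * \<theta> - of_int i * L \<Longrightarrow> of_int n * \<theta> - of_int i * L < L \<Longrightarrow> of_int n * \<theta> - of_int i * L = res n"
proof -
  assume "0 \<le> of_int n * \<theta> - of_int i * L" "of_int n * \<theta> - of_int i * L < L"
  then have "\<lfloor>of_int n * \<theta> / L\<rfloor> = i" using L_pos by (simp add: floor_eq_iff field_simps)
  then show ?thesis by (simp add: res_def)
qed

lemma Psi_period:
  assumes y: "0 \<le> y" "y < L"
  shows "Psi y = y + d * real (card {n. 1 \<le> n \<and> n \<le> N \<and> res n \<le> y})"
proof -
  have "\<lfloor>(y - of_int n * \<theta>) / L\<rfloor> - \<lfloor>- (of_int n * \<theta>) / L\<rfloor> = (if res n \<le> y then 1 else 0)" if n: "n \<in> {1..N}" for n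
  proof -
    define i where "i = \<lfloor>of_int n * \<theta> / L\<rfloor>"
    have nt: "of_int n * \<theta> = res n + of_int i * L" by (simp add: res_def i_def)
    have r: "0 < res n" "res n < L" using res_pos[of n] res_bounds n by auto
    have "(y - of_int n * \<theta>) / L = (y - res n) / L - of_int i" "- (of_int n * \<theta>) / L = - res n / L - of_int i"
      unfolding nt using L_pos by (simp_all add: field_simps)
    moreover have "\<lfloor>- res n / L\<rfloor> = -1" using r L_pos by (simp add: floor_eq_iff field_simps)
    moreover have "\<lfloor>(y - res n) / L\<rfloor> = (if res n \<le> y then 0 else -1)"
      using r y L_pos by (simp add: floor_eq_iff field_simps)
    ultimately show ?thesis by simp
  qed
  then have "(\<Sum>n\<in>{1..N}. \<lfloor>(y - of_int n * \<theta>) / L\<rfloor> - \<lfloor>- (of_int n * \<theta>) / L\<rfloor>) = (\<Sum>n\<in>{1..N}. if res n \<le> y then 1 else 0)"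
    by (intro sum.cong) simp_all
  also have "\<dots> = int (card ({1..N} \<inter> {n. res n \<le> y}))" by (simp add: sum.If_cases)
  also have "{1..N} \<inter> {n. res n \<le> y} = {n. 1 \<le> n \<and> n \<le> N \<and> res n \<le> y}" by auto
  finally show ?thesis by (simp add: Psi_def)
qed

lemma count_res: "int (card {n. 1 \<le> n \<and> n \<le> N \<and> res n < c0'}) = d1"
proof -
  have "(\<exists>i::int. 0 \<le> of_int n * \<theta> - of_int i * L \<and> of_int n * \<theta> - of_int i * L < c0') \<longleftrightarrow> res n < c0'" for n
  proof
    assume "\<exists>i::int. 0 \<le> of_int n * \<theta> - of_int i * L \<and> of_int n * \<theta> - of_int i * L < c0'"
    then show "res n < c0'" using res_unique[of n] c0'_less by force
  next
    assume "res n < c0'"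
    then show "\<exists>i::int. 0 \<le> of_int n * \<theta> - of_int i * L \<and> of_int n * \<theta> - of_int i * L < c0'"
      using res_bounds[of n] unfolding res_def by blast
  qed
  then show ?thesis using count by simp
qed

lemma finite_range_N: "finite {n::int. 1 \<le> n \<and> n \<le> N \<and> P n}"
  by (rule finite_subset[of _ "{1..N}"]) auto

lemma res_N: "res N = c0'"
  using res_unique[of N m] N_\<theta> c0'_pos c0'_less by simp

text \<open>Up to and including \<open>c0'\<close> there are the \<open>d1\<close> gaps of
  \<open>count\<close> and the one at \<open>N \<theta>\<close>, congruent to \<open>c0'\<close>
  itself. This last one is inserted exactly over the hole.\<close>

lemma Psi_c0': "Psi c0' = c0"
proof -
  have "{n. 1 \<le> n \<and> n \<le> N \<and> res n \<le> c0'} = insert N {n. 1 \<le> n \<and> n \<le> N \<and> res n < c0'}"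
  proof (intro set_eqI iffI)
    fix n assume n: "n \<in> {n. 1 \<le> n \<and> n \<le> N \<and> res n \<le> c0'}"
    show "n \<in> insert N {n. 1 \<le> n \<and> n \<le> N \<and> res n < c0'}"
    proof (cases "res n = c0'")
      case True
      then have "of_int (n - N) * \<theta> = of_int (\<lfloor>of_int n * \<theta> / L\<rfloor> - m) * L"
        using N_\<theta> unfolding res_def by (simp add: left_diff_distrib)
      then have "n - N = 0" by (rule \<theta>_L_indep)
      then show ?thesis by simp
    qed (use n in auto)
  qed (use N_pos res_N in auto)
  then have "int (card {n. 1 \<le> n \<and> n \<le> N \<and> res n \<le> c0'}) = d1 + 1"
    using count_res res_N finite_range_N by simp
  then have "real (card {n. 1 \<le> n \<and> n \<le> N \<and> res n \<le> c0'}) = of_int d1 + 1" by linarith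
  then show ?thesis using Psi_period[of c0'] c0'_pos c0'_less by (simp add: c0'_def algebra_simps)
qed

lemma Psi_less: "0 \<le> y \<Longrightarrow> y < c0' \<Longrightarrow> Psi y < c0 - d"
proof -
  assume y: "0 \<le> y" "y < c0'"
  have "card {n. 1 \<le> n \<and> n \<le> N \<and> res n \<le> y} \<le> card {n. 1 \<le> n \<and> n \<le> N \<and> res n < c0'}"
    using y by (intro card_mono finite_range_N) auto
  then have "real (card {n. 1 \<le> n \<and> n \<le> N \<and> res n \<le> y}) \<le> of_int d1" using count_res by linarith
  then have "d * real (card {n. 1 \<le> n \<and> n \<le> N \<and> res n \<le> y}) \<le> d * of_int d1"
    using d_pos by (intro mult_left_mono) auto
  then have "Psi y < c0' + d * of_int d1" using Psi_period[of y] y c0'_less by simp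
  then show ?thesis by (simp add: c0'_def algebra_simps)
qed

text \<open>\<open>Psi\<close> jumps over the hole at \<open>c0'\<close>: by \<open>Psi_less\<close>
  it stays below \<open>c0 - d\<close> before, by \<open>Psi_c0'\<close> at or above
  \<open>c0\<close> from there on. On each side \<open>Psi_rotate\<close> is the matching branch of
  \<open>R\<close>.\<close>

lemma R_Psi: "\<not> hole (Psi y) \<and> (\<exists>i::int. R (Psi y) = Psi (y + \<theta> + of_int i * L))"
proof -
  define i where "i = \<lfloor>y / L\<rfloor>"
  define y0 where "y0 = y - of_int i * L"
  have y0: "0 \<le> y0" "y0 < L"
    using floor_divide_lower[OF L_pos, of y] floor_divide_upper[OF L_pos, of y] by (simp_all add: y0_def i_def algebra_simps)
  have y: "y = y0 + of_int i * L" by (simp add: y0_def)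
  have "Psi L = a" using Psi_shift[of 0 1] Psi_0 by simp
  then have P: "0 \<le> Psi y0" "Psi y0 < a"
    using Psi_mono[of 0 y0] Psi_mono[of y0 L] Psi_0 y0 by auto
  have uP: "u (Psi y) = Psi y0"
    by (rule u_eq[OF P, of _ i]) (simp add: y Psi_shift)
  have rot: "Psi (y + \<theta>) = Psi y + c1 + d * of_int (- \<lfloor>(y0 - c0') / L\<rfloor>)"
  proof -
    have "Psi (y + \<theta>) = Psi (y0 + \<theta> + of_int i * L)" by (simp add: y algebra_simps)
    also have "\<dots> = Psi (y0 + \<theta>) + of_int i * a" by (rule Psi_shift)
    also have "Psi (y0 + \<theta>) = Psi y0 + c1 + d * of_int (- \<lfloor>(y0 - c0') / L\<rfloor>)"
    proof -
      have "\<lfloor>y0 / L\<rfloor> = 0" using y0 L_pos by (simp add: floor_eq_iff field_simps)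
      then show ?thesis by (simp add: Psi_rotate)
    qed
    finally show ?thesis using y Psi_shift[of y0 i] by simp
  qed
  show ?thesis
  proof (cases "y0 < c0'")
    case True
    then have lt: "Psi y0 < c0 - d" using y0 Psi_less by simp
    have "\<lfloor>(y0 - c0') / L\<rfloor> = -1" using True y0 L_pos c0'_less by (simp add: floor_eq_iff field_simps)
    then have "R (Psi y) = Psi (y + \<theta>) + of_int (p + 1) * a"
      using lt uP rot kb_eq by (simp add: R_def jump_def algebra_simps)
    also have "\<dots> = Psi (y + \<theta> + of_int (p + 1) * L)" by (rule Psi_shift[symmetric])
    finally have "R (Psi y) = Psi (y + \<theta> + of_int (p + 1) * L)" .
    moreover have "\<not> hole (Psi y)" using lt uP by (simp add: hole_def)
    ultimately show ?thesis by blast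
  next
    case False
    then have ge: "c0 \<le> Psi y0" using Psi_mono[of c0' y0] Psi_c0' by simp
    have "\<lfloor>(y0 - c0') / L\<rfloor> = 0" using False y0 L_pos c0'_pos by (simp add: floor_eq_iff field_simps)
    then have "R (Psi y) = Psi (y + \<theta>) + of_int p * a"
      using ge d_pos uP rot kb_eq by (simp add: R_def jump_def algebra_simps)
    also have "\<dots> = Psi (y + \<theta> + of_int p * L)" by (rule Psi_shift[symmetric])
    finally have "R (Psi y) = Psi (y + \<theta> + of_int p * L)" .
    moreover have "\<not> hole (Psi y)" using ge uP by (simp add: hole_def)
    ultimately show ?thesis by blast
  qed
qed

text \<open>By \<open>R_Psi\<close> at \<open>y - \<theta>\<close>, every value of
  \<open>Psi\<close> is itself an \<open>R\<close>-image of a value of \<open>Psi\<close>, so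
  \<open>R_not_gap\<close> applies.\<close>

lemma Q_Psi: "\<not> gap (Psi y) \<and> (\<exists>i::int. Q (Psi y) = Psi (y - \<theta> + of_int i * L))"
proof -
  obtain i :: int where i: "R (Psi (y - \<theta>)) = Psi (y - \<theta> + \<theta> + of_int i * L)" using R_Psi by blast
  have eq: "Psi (y - \<theta> + of_int (- i) * L) = Psi (y - \<theta>) + of_int (- i) * a" by (rule Psi_shift)
  then have "R (Psi (y - \<theta> + of_int (- i) * L)) = Psi y"
    unfolding eq R_shift i using Psi_shift[of y i] by simp
  then show ?thesis using R_not_gap[of "Psi (y - \<theta> + of_int (- i) * L)"] R_Psi by metis
qed

lemma Psi_comb: "\<exists>i j::int. Psi (of_int r * a + of_int s * b) = of_int i * a + of_int j * b"
proof -
  define q where "q = (\<Sum>n\<in>{1..N}. \<lfloor>(of_int r * a + of_int s * b - of_int n * \<theta>) / L\<rfloor> - \<lfloor>- (of_int n * \<theta>) / L\<rfloor>)"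
  have "Psi (of_int r * a + of_int s * b) = of_int (r - q) * a + of_int (s + q) * b"
    unfolding Psi_def q_def[symmetric] by (simp add: algebra_simps)
  then show ?thesis by blast
qed

text \<open>The lattice \<open>\<theta> \<int> + L \<int>\<close> has index at least 2 in \<open>a \<int> + b \<int>\<close>.\<close>

lemma proper_sublattice:
  obtains r s :: int where "\<And>x y :: int. of_int r * a + of_int s * b \<noteq> of_int x * \<theta> + of_int y * L"
proof (rule ccontr)
  assume no: "\<not> thesis"
  have ex: "\<exists>x y :: int. of_int r * a + of_int s * b = of_int x * \<theta> + of_int y * L" for r s :: int
  proof (rule ccontr)
    assume "\<nexists>x y :: int. of_int r * a + of_int s * b = of_int x * \<theta> + of_int y * L"
    then show False using no that[of r s] by blast
  qed
  obtain x1 y1 :: int where "of_int 1 * a + of_int 0 * b = of_int x1 * \<theta> + of_int y1 * L" using ex by blast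
  then have e1: "1 = x1 * (m - p) + y1 * (1 + N)" "0 = x1 * (k - m) - y1 * N"
    unfolding \<theta>_L_comb using lin_indep_eq by blast+
  obtain x2 y2 :: int where "of_int 0 * a + of_int 1 * b = of_int x2 * \<theta> + of_int y2 * L" using ex by blast
  then have e2: "0 = x2 * (m - p) + y2 * (1 + N)" "1 = x2 * (k - m) - y2 * N"
    unfolding \<theta>_L_comb using lin_indep_eq by blast+
  \<comment> \<open>Determinants multiply: an integral inverse matrix would force the determinant to
    divide 1.\<close>
  have "((k - m) * (1 + N) + N * (m - p)) * (x2 * y1 - x1 * y2)
      = (x1 * (m - p) + y1 * (1 + N)) * (x2 * (k - m) - y2 * N) - (x1 * (k - m) - y1 * N) * (x2 * (m - p) + y2 * (1 + N))"
    by (simp add: algebra_simps)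
  also have "\<dots> = 1" using e1 e2 by simp
  finally have "((k - m) * (1 + N) + N * (m - p)) dvd 1" by (metis dvd_triv_left)
  then show False using det by simp
qed

lemma not_gabor_frame: "\<not> gabor_frame (indicator {0..<c}) a b"
proof -
  \<comment> \<open>The image of a coset of the lattice spanned by \<open>\<theta>\<close> and
    \<open>L\<close>. The multiples of \<open>L\<close> make it invariant under translation by
    \<open>a\<close>, so it meets the multiples of \<open>b\<close> as soon as it meets their span
    with \<open>a\<close>.\<close>
  define G where "G z = {Psi (z + of_int x * \<theta> + of_int y * L) |x y :: int. True}" for z
  have G: "\<not> hole x \<and> \<not> gap x \<and> R x \<in> G z \<and> Q x \<in> G z" if "x \<in> G z" for x z
  proof -
    obtain i j :: int where x: "x = Psi (z + of_int i * \<theta> + of_int j * L)" using \<open>x \<in> G z\<close> by (auto simp: G_def)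
    obtain l :: int where "R x = Psi (z + of_int i * \<theta> + of_int j * L + \<theta> + of_int l * L)" using R_Psi x by blast
    also have "\<dots> = Psi (z + of_int (i + 1) * \<theta> + of_int (j + l) * L)" by (simp add: algebra_simps)
    finally have "R x \<in> G z" unfolding G_def by blast
    obtain l :: int where "Q x = Psi (z + of_int i * \<theta> + of_int j * L - \<theta> + of_int l * L)" using Q_Psi x by blast
    also have "\<dots> = Psi (z + of_int (i - 1) * \<theta> + of_int (j + l) * L)" by (simp add: algebra_simps)
    finally have "Q x \<in> G z" unfolding G_def by blast
    with \<open>R x \<in> G z\<close> show ?thesis using R_Psi Q_Psi x by blast
  qed
  obtain r s :: int where rs: "\<And>x y :: int. of_int r * a + of_int s * b \<noteq> of_int x * \<theta> + of_int y * L"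
    using proper_sublattice by blast
  define z where "z = of_int r * a + of_int s * b"
  obtain i j :: int where ij: "Psi z = of_int i * a + of_int j * b" unfolding z_def using Psi_comb by blast
  have "Psi (z + of_int (- i) * L) = of_int j * b" unfolding Psi_shift ij by simp
  then have "Psi (z + of_int 0 * \<theta> + of_int (- i) * L) = of_int j * b" by simp
  then have z_in: "of_int j * b \<in> G z" unfolding G_def by (metis (mono_tags, lifting) mem_Collect_eq)
  have "Psi (0 + of_int 0 * \<theta> + of_int 0 * L) = of_int 0 * b" by (simp add: Psi_0)
  then have "of_int 0 * b \<in> G 0" unfolding G_def by (metis (mono_tags, lifting) mem_Collect_eq)
  then obtain J1 where J1: "R_orbit J1" "\<And>n. of_int (J1 n) * b \<in> G 0"
    using invariant_orbit[OF G] by metis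
  obtain J2 where J2: "R_orbit J2" "\<And>n. of_int (J2 n) * b \<in> G z"
    using invariant_orbit[OF G z_in] by metis
  have disj: "G 0 \<inter> G z = {}"
  proof (rule ccontr)
    assume "G 0 \<inter> G z \<noteq> {}"
    then obtain x y x' y' :: int where "Psi (0 + of_int x * \<theta> + of_int y * L) = Psi (z + of_int x' * \<theta> + of_int y' * L)"
      unfolding G_def by blast
    then have "0 + of_int x * \<theta> + of_int y * L = z + of_int x' * \<theta> + of_int y' * L" by (rule Psi_inj)
    then have "z = of_int (x - x') * \<theta> + of_int (y - y') * L" by (simp add: algebra_simps)
    then show False using rs unfolding z_def by blast
  qed
  have "J1 n \<noteq> J2 n'" for n n'
    using J1(2)[of n] J2(2)[of n'] disj by auto
  then have "range J1 \<inter> range J2 = {}" by auto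
  then show ?thesis using not_frame_if_orbits J1 J2 by blast
qed

end

section \<open>Sufficiency of the arithmetic conditions\<close>

context hole_dynamics
begin

lemma not_frame_if_conditions:
  fixes d1 d2 :: nat
  assumes X: "c - (real d1 + 1) * (of_int k + 1) * (b - a) - (real d2 + 1) * of_int k * (b - a) = a * of_int j" and j: "j \<noteq> 1"
    and b1: "of_int k * b + (real d1 + 1) * (b - a) < c"
    and b2: "c < of_int k * b + b - (real d2 + 1) * (b - a)"
    and m: "m = ((real d1 + real d2 + 1) * c1 - c0 + (real d1 + 1) * (b - a)) / a"
    and card: "card {n::int. 1 \<le> n \<and> n \<le> int d1 + int d2 + 1 \<and>
              of_int n * (c1 - m * (b - a)) \<in>
                plus_rZ {0..<c0 - (real d1 + 1) * (b - a)} (a - (real d1 + real d2 + 1) * (b - a))} = d1"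
  shows "\<not> gabor_frame (indicator {0..<c}) a b"
proof -
  define N where "N = int d1 + int d2 + 1"
  define c0' where "c0' = c0 - (real d1 + 1) * (b - a)"
  define L where "L = a - of_int N * (b - a)"
  have N: "real_of_int N = real d1 + real d2 + 1" by (simp add: N_def)
  \<comment> \<open>The integer value of \<open>m\<close>, found by solving \<open>X = a j\<close>
    with the help of \<open>kb_eq\<close>.\<close>
  define mi where "mi = k + k * N - N * p - j"
  have ma: "m * a = of_int N * c1 - c0'"
    using a_pos by (simp add: m N c0'_def)
  have c1: "c1 = of_int k * b - of_int p * a" using kb_eq by simp
  have aj: "a * of_int j = of_int k * a + c0' - of_int k * of_int N * (b - a)"
    using X c_eq by (simp add: N c0'_def algebra_simps)
  have "m * a = of_int mi * a"
    unfolding ma mi_def using aj by (simp add: c1 algebra_simps)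
  then have mi: "m = of_int mi" using a_pos by simp
  have c0'_pos: "0 < c0'" using b1 c_eq by (simp add: c0'_def)
  have c0'_less: "c0' < L" using b2 c_eq by (simp add: c0'_def L_def N algebra_simps)
  define \<theta> where "\<theta> = c1 - of_int mi * (b - a)"
  have N_\<theta>: "of_int N * \<theta> = c0' + of_int mi * L"
    using ma unfolding mi by (simp add: \<theta>_def L_def algebra_simps)
  have Npos: "1 \<le> N" by (simp add: N_def)
  have mi0: "0 \<le> mi"
  proof -
    have "c0' < a" using c0'_less Npos d_pos unfolding L_def by (smt (verit) mult_nonneg_nonneg of_int_0_le_iff)
    moreover have "0 \<le> of_int N * c1" using Npos c1_pos by simp
    ultimately have "(- 1) * a < of_int mi * a" using ma mi by simp
    then have "- 1 < real_of_int mi" using a_pos by (simp only: mult_less_cancel_right_pos)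
    then show ?thesis by linarith
  qed
  have "0 < \<theta>"
  proof -
    have "0 < of_int N * \<theta>" unfolding N_\<theta> using c0'_pos c0'_less mi0 by (simp add: add_pos_nonneg)
    then show ?thesis using Npos by (simp add: zero_less_mult_iff)
  qed
  \<comment> \<open>So \<open>j\<close> is the determinant that the locale bounds below in
    \<open>det\<close>.\<close>
  have j_eq: "j = (k - mi) * (1 + N) + N * (mi - p)" by (simp add: mi_def algebra_simps)
  have p0: "0 \<le> p"
  proof (rule ccontr)
    assume "\<not> 0 \<le> p"
    then have "of_int p * a \<le> (- 1) * a" using a_pos by (intro mult_right_mono) auto
    then show False using kb_eq kb_nonneg b_le_kb b_pos c1_less a_less_b by linarith
  qed
  \<comment> \<open>The counterpart of \<open>\<phi> c\<close> in the converse direction. Its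
    positivity excludes \<open>j \<le> 0\<close>, and \<open>j \<noteq> 1\<close> then leaves
    \<open>j \<ge> 2\<close>.\<close>
  have "of_int j * b = of_int p * L + \<theta> + c0'"
  proof -
    have "c0' = of_int N * c1 - of_int mi * a" using ma mi by simp
    then show ?thesis by (simp add: j_eq L_def \<theta>_def c1 algebra_simps)
  qed
  moreover have "0 \<le> of_int p * L" using p0 c0'_pos c0'_less by simp
  ultimately have "0 < of_int j * b" using \<open>0 < \<theta>\<close> c0'_pos by linarith
  then have "0 < j" using b_pos by (simp add: zero_less_mult_iff)
  then have j2: "2 \<le> j" using j by simp
  have mem: "of_int n * (c1 - m * (b - a)) \<in> plus_rZ {0..<c0 - (real d1 + 1) * (b - a)} (a - (real d1 + real d2 + 1) * (b - a))
      \<longleftrightarrow> (\<exists>i::int. 0 \<le> of_int n * \<theta> - of_int i * L \<and> of_int n * \<theta> - of_int i * L < c0')" for n :: int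
  proof -
    have "of_int n * \<theta> \<in> plus_rZ {0..<c0'} L \<longleftrightarrow> (\<exists>i::int. 0 \<le> of_int n * \<theta> - of_int i * L \<and> of_int n * \<theta> - of_int i * L < c0')"
    proof
      assume "of_int n * \<theta> \<in> plus_rZ {0..<c0'} L"
      then obtain x and i :: int where "of_int n * \<theta> = x + L * of_int i" "0 \<le> x" "x < c0'"
        by (auto simp: plus_rZ_def)
      then show "\<exists>i::int. 0 \<le> of_int n * \<theta> - of_int i * L \<and> of_int n * \<theta> - of_int i * L < c0'"
        by (intro exI[of _ i]) (simp add: mult.commute)
    next
      assume "\<exists>i::int. 0 \<le> of_int n * \<theta> - of_int i * L \<and> of_int n * \<theta> - of_int i * L < c0'"
      then obtain i :: int where "of_int n * \<theta> - of_int i * L \<in> {0..<c0'}" by auto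
      moreover have "of_int n * \<theta> = (of_int n * \<theta> - of_int i * L) + L * of_int i" by simp
      ultimately show "of_int n * \<theta> \<in> plus_rZ {0..<c0'} L" unfolding plus_rZ_def by blast
    qed
    then show ?thesis by (simp add: \<theta>_def mi c0'_def L_def N)
  qed
  interpret gap_insertion b a c k p c0 c1 N mi "int d1" L \<theta> c0'
  proof
    show "int (card {n. 1 \<le> n \<and> n \<le> N \<and> (\<exists>i::int. 0 \<le> of_int n * \<theta> - of_int i * L \<and> of_int n * \<theta> - of_int i * L < c0')}) = int d1"
      using card unfolding mem N_def[symmetric] by simp
    show "2 \<le> (k - mi) * (1 + N) + N * (mi - p)" using j2 j_eq by simp
    show "L = a - of_int N * (b - a)" "\<theta> = c1 - of_int mi * (b - a)" "c0' = c0 - (of_int (int d1) + 1) * (b - a)"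
      by (simp_all add: L_def \<theta>_def c0'_def)
  qed (fact c0'_pos c0'_less Npos N_\<theta>)+
  show ?thesis by (rule not_gabor_frame)
qed

end

section \<open>The arithmetic conditions from surviving pairs\<close>

definition mass :: "real set \<Rightarrow> real \<Rightarrow> real \<Rightarrow> real" where
  "mass A x y = measure lborel (A \<inter> {x..<y})"

lemma mass_nonneg [simp]: "0 \<le> mass A x y"
  by (simp add: mass_def)

lemma finite_Ico: "emeasure lborel (A \<inter> {x..<y::real}) \<noteq> top"
proof -
  have "emeasure lborel (A \<inter> {x..<y}) < \<infinity>"
    by (rule emeasure_bounded_finite) (rule bounded_subset[of "{x..y}"], auto)
  then show ?thesis by simp
qed

lemma mass_split:
  assumes [measurable]: "A \<in> sets borel" and "x \<le> y" "y \<le> z"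
  shows "mass A x z = mass A x y + mass A y z"
proof -
  have "A \<inter> {x..<z} = (A \<inter> {x..<y}) \<union> (A \<inter> {y..<z})" using assms by auto
  then show ?thesis unfolding mass_def
    by (simp only:) (rule measure_Union, auto simp: finite_Ico)
qed

lemma mass_mono:
  assumes "A \<in> sets borel" "B \<in> sets borel" "A \<inter> {x..<y} \<subseteq> B"
  shows "mass A x y \<le> mass B x y"
  unfolding mass_def
proof (rule measure_mono_fmeasurable)
  show "B \<inter> {x..<y} \<in> fmeasurable lborel"
    using finite_Ico[of B x y] assms(2) by (intro fmeasurableI) (simp_all add: less_top)
qed (use assms in auto)

lemma mass_full: "x \<le> y \<Longrightarrow> {x..<y} \<subseteq> A \<Longrightarrow> mass A x y = y - x"
  by (simp add: mass_def Int_absorb1)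

lemma mass_empty: "A \<inter> {x..<y} = {} \<Longrightarrow> mass A x y = 0"
  by (simp add: mass_def)

lemma mass_degenerate [simp]: "mass A x x = 0"
  by (simp add: mass_def)

lemma mass_le:
  assumes "A \<in> sets borel" "x \<le> y"
  shows "mass A x y \<le> y - x"
  using mass_mono[of A UNIV x y] mass_full[of x y UNIV] assms by simp

text \<open>The correspondence is asked only on \<open>[x, y)\<close>, because \<open>R\<close> is a
  translation only on each of its branches.\<close>

lemma mass_shift:
  assumes [measurable]: "A \<in> sets borel" "B \<in> sets borel"
    and AB: "\<And>t. x \<le> t \<Longrightarrow> t < y \<Longrightarrow> t + h \<in> B \<longleftrightarrow> t \<in> A"
  shows "mass B (x + h) (y + h) = mass A x y"
proof -
  have "emeasure lborel (B \<inter> {x + h..<y + h}) = (\<integral>\<^sup>+t. indicator (B \<inter> {x + h..<y + h}) t \<partial>lborel)"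
    by simp
  also have "\<dots> = (\<integral>\<^sup>+t. indicator (B \<inter> {x + h..<y + h}) (h + 1 * t) \<partial>lborel)"
    by (subst nn_integral_real_affine[where c=1 and t=h]) auto
  also have "\<dots> = (\<integral>\<^sup>+t. indicator (A \<inter> {x..<y}) t \<partial>lborel)"
    using AB by (intro nn_integral_cong) (auto simp: indicator_def add.commute)
  also have "\<dots> = emeasure lborel (A \<inter> {x..<y})" by simp
  finally show ?thesis by (simp add: mass_def measure_def)
qed

lemma mass_UN:
  assumes "finite I" "\<And>i. i \<in> I \<Longrightarrow> A i \<in> sets borel" "disjoint_family_on A I"
  shows "mass (\<Union>i\<in>I. A i) x y = (\<Sum>i\<in>I. mass (A i) x y)"
  using assms
proof (induction I rule: finite_induct)
  case (insert i I)
  have "A i \<inter> (\<Union>i\<in>I. A i) = {}" using insert by (auto simp: disjoint_family_on_def)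
  moreover have "A i \<in> sets borel" "(\<Union>i\<in>I. A i) \<in> sets borel" using insert by auto
  ultimately have "mass (A i \<union> (\<Union>i\<in>I. A i)) x y = mass (A i) x y + mass (\<Union>i\<in>I. A i) x y"
    unfolding mass_def Int_Un_distrib2 by (intro measure_Union) (auto simp: finite_Ico)
  moreover have "disjoint_family_on A I" using insert by (auto simp: disjoint_family_on_def)
  ultimately show ?case using insert by simp
qed (simp add: mass_empty)

lemma mass_Un:
  assumes [measurable]: "A \<in> sets borel" "B \<in> sets borel" and "A \<inter> B = {}"
  shows "mass (A \<union> B) x y = mass A x y + mass B x y"
  unfolding mass_def Int_Un_distrib2 by (intro measure_Union) (use assms in \<open>auto simp: finite_Ico\<close>)

lemma mass_eq_0_iff:
  assumes [measurable]: "A \<in> sets borel"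
  shows "mass A x y = 0 \<longleftrightarrow> A \<inter> {x..<y} \<in> null_sets lborel"
  unfolding mass_def null_sets_def mem_Collect_eq emeasure_eq_ennreal_measure[OF finite_Ico]
  by (simp add: ennreal_eq_0_iff measure_le_0_iff)

lemma mass_UN_null:
  fixes A :: "'i \<Rightarrow> real set"
  assumes "countable I" "\<And>i. i \<in> I \<Longrightarrow> A i \<in> sets borel" "\<And>i. i \<in> I \<Longrightarrow> mass (A i) x y = 0"
  shows "mass (\<Union>i\<in>I. A i) x y = 0"
proof -
  have null: "(\<Union>i\<in>I. A i \<inter> {x..<y}) \<in> null_sets lborel"
    using assms mass_eq_0_iff by (intro null_sets_UN') auto
  have sets: "(\<Union>i\<in>I. A i) \<in> sets borel" using assms by (intro sets.countable_UN') auto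
  have eq: "(\<Union>i\<in>I. A i) \<inter> {x..<y} = (\<Union>i\<in>I. A i \<inter> {x..<y})" by auto
  show ?thesis unfolding mass_eq_0_iff[OF sets] eq by (rule null)
qed

lemma mass_period:
  assumes A [measurable]: "A \<in> sets borel" and per: "\<And>t. t + a \<in> A \<longleftrightarrow> t \<in> A" and z: "0 \<le> z" "z \<le> a"
  shows "mass A z (z + a) = mass A 0 a"
proof -
  have "mass A z (z + a) = mass A z a + mass A a (z + a)" using z by (intro mass_split A) auto
  also have "mass A a (z + a) = mass A 0 z" using mass_shift[OF A A, of 0 z a] per by simp
  also have "mass A z a + mass A 0 z = mass A 0 a" using mass_split[OF A, of 0 z a] z by simp
  finally show ?thesis .
qed

section \<open>The collapsing map and the rotation it induces\<close>

context hole_dynamics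
begin

lemma u_measurable [measurable]: "u \<in> borel_measurable borel"
  unfolding u_def[abs_def] by measurable

lemma hole_measurable [measurable]: "Measurable.pred borel hole"
  unfolding hole_def[abs_def] by measurable

lemma gap_measurable [measurable]: "Measurable.pred borel gap"
  unfolding gap_def[abs_def] by measurable

lemma R_measurable [measurable]: "R \<in> borel_measurable borel"
  unfolding R_def[abs_def] jump_def by measurable

lemma Q_measurable [measurable]: "Q \<in> borel_measurable borel"
  unfolding Q_def[abs_def] jumpQ_def by measurable

lemma funpow_measurable: "f \<in> borel_measurable borel \<Longrightarrow> (f ^^ n) \<in> borel_measurable borel" for f :: "real \<Rightarrow> real"
  by (induction n) (auto simp: o_def measurable_compose)

lemma S_measurable [measurable]: "S \<in> sets borel"
proof -
  note [measurable] = funpow_measurable[OF R_measurable] funpow_measurable[OF Q_measurable]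
  have "{x \<in> space borel. \<forall>N. surv N x} \<in> sets borel"
    unfolding surv_def by measurable
  then show ?thesis by (simp add: S_def)
qed

lemma S_shift [simp]: "x + of_int i * a \<in> S \<longleftrightarrow> x \<in> S"
  by (simp add: S_def)

lemma S_iff: "x \<in> S \<longleftrightarrow> (\<forall>n. \<not> hole ((R ^^ n) x) \<and> \<not> gap ((Q ^^ n) x))"
  unfolding S_def surv_def by blast

lemma S_not_hole: "x \<in> S \<Longrightarrow> \<not> hole x" and S_not_gap: "x \<in> S \<Longrightarrow> \<not> gap x"
  unfolding S_iff by (metis funpow_0)+

lemma S_R: "\<not> hole x \<Longrightarrow> R x \<in> S \<longleftrightarrow> x \<in> S"
proof
  assume "x \<in> S"
  then show "R x \<in> S" using surv_R by (auto simp: S_def)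
next
  assume "\<not> hole x" "R x \<in> S"
  then have "Q (R x) \<in> S" using surv_Q by (auto simp: S_def)
  then show "x \<in> S" using R_not_gap \<open>\<not> hole x\<close> by simp
qed

text \<open>\<open>\<phi>\<close> collapses the complement of \<open>S\<close>; it is the inverse construction to \<open>Psi\<close>.\<close>

definition \<phi> :: "real \<Rightarrow> real" where
  "\<phi> x = (if 0 \<le> x then mass S 0 x else - mass S x 0)"

lemma \<phi>_diff: "x \<le> y \<Longrightarrow> \<phi> y - \<phi> x = mass S x y"
proof -
  assume xy: "x \<le> y"
  consider "0 \<le> x" | "x < 0" "0 \<le> y" | "y < 0" by linarith
  then show ?thesis
  proof cases
    case 1
    then show ?thesis using xy mass_split[OF S_measurable, of 0 x y] by (simp add: \<phi>_def)
  next
    case 2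
    then show ?thesis using mass_split[OF S_measurable, of x 0 y] by (simp add: \<phi>_def)
  next
    case 3
    then show ?thesis using xy mass_split[OF S_measurable, of x y 0] by (simp add: \<phi>_def)
  qed
qed

lemma \<phi>_0 [simp]: "\<phi> 0 = 0"
  by (simp add: \<phi>_def)

lemma \<phi>_mono: "x \<le> y \<Longrightarrow> \<phi> x \<le> \<phi> y"
  using \<phi>_diff[of x y] mass_nonneg[of S x y] by linarith

lemma \<phi>_lipschitz: "x \<le> y \<Longrightarrow> \<phi> y - \<phi> x \<le> y - x"
  using \<phi>_diff[of x y] mass_le[OF S_measurable, of x y] by simp

lemma continuous_\<phi>: "continuous_on A \<phi>"
proof (rule continuous_on_subset[of UNIV])
  have "\<bar>\<phi> x - \<phi> y\<bar> \<le> \<bar>x - y\<bar>" for x y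
    using \<phi>_lipschitz[of x y] \<phi>_lipschitz[of y x] \<phi>_mono[of x y] \<phi>_mono[of y x] by (cases "x \<le> y") auto
  then show "continuous_on UNIV \<phi>"
    unfolding continuous_on_iff dist_real_def by (meson le_less_trans)
qed simp

lemma \<phi>_measurable [measurable]: "\<phi> \<in> borel_measurable borel"
  by (rule borel_measurable_continuous_onI[OF continuous_\<phi>])

definition L :: real where "L = \<phi> a"

definition \<theta> :: real where "\<theta> = \<phi> c1"

definition c0' :: real where "c0' = \<phi> c0"

lemma \<phi>_shift_a: "\<phi> (x + a) = \<phi> x + L"
proof -
  have sh: "mass S (x + a) (y + a) = mass S x y" for x y
    by (rule mass_shift) (use S_shift[of _ 1] in auto)
  show ?thesis
    using \<phi>_diff[of 0 x] \<phi>_diff[of x 0] \<phi>_diff[of a "x + a"] \<phi>_diff[of "x + a" a] sh[of 0 x] sh[of x 0]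
    by (cases "0 \<le> x") (simp_all add: L_def)
qed

lemma \<phi>_shift: "\<phi> (x + of_int i * a) = \<phi> x + of_int i * L"
proof -
  have nat: "\<phi> (x + real n * a) = \<phi> x + real n * L" for x n
  proof (induction n)
    case (Suc n)
    then show ?case using \<phi>_shift_a[of "x + real n * a"] by (simp add: algebra_simps)
  qed simp
  show ?thesis
  proof (cases "0 \<le> i")
    case True
    then show ?thesis using nat[of x "nat i"] by simp
  next
    case False
    then show ?thesis using nat[of "x + of_int i * a" "nat (- i)"] by (simp add: algebra_simps)
  qed
qed

lemma \<phi>_hole: "\<phi> (c0 - d) = c0'"
proof -
  have "S \<inter> {c0 - d..<c0} = {}"
  proof (rule ccontr)
    assume "S \<inter> {c0 - d..<c0} \<noteq> {}"
    then obtain x where x: "x \<in> S" "c0 - d \<le> x" "x < c0" by auto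
    then have "u x = x" using c0_gt c0_less by (intro u_eq[of _ _ 0]) auto
    then have "hole x" using x by (simp add: hole_def)
    then show False using S_not_hole x by blast
  qed
  then have "mass S (c0 - d) c0 = 0" by (rule mass_empty)
  then show ?thesis using \<phi>_diff[of "c0 - d" c0] d_pos by (simp add: c0'_def)
qed

lemma gap_interval: "c1 \<le> x \<Longrightarrow> x < c1 + d \<Longrightarrow> gap x"
proof -
  assume x: "c1 \<le> x" "x < c1 + d"
  have "u (x - of_int k * b) = x - c1"
    using x kb_eq a_less_b c1_less c1_pos by (intro u_eq[of _ _ "- p"]) auto
  then show ?thesis using x by (simp add: gap_def)
qed

lemma \<phi>_gap: "c1 \<le> x \<Longrightarrow> x \<le> c1 + d \<Longrightarrow> \<phi> x = \<theta>"
proof -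
  assume x: "c1 \<le> x" "x \<le> c1 + d"
  have "S \<inter> {c1..<x} = {}" using gap_interval S_not_gap x by fastforce
  then have "mass S c1 x = 0" by (rule mass_empty)
  then show ?thesis using \<phi>_diff[of c1 x] x by (simp add: \<theta>_def)
qed

text \<open>On this branch \<open>R\<close> is translation by \<open>c1 + d\<close> up to a multiple
  of \<open>a\<close>, because \<open>(k + 1) b = (c1 + d) + (p + 1) a\<close>; \<open>S\<close> is
  invariant under \<open>R\<close> off the hole and under \<open>a\<close>.\<close>

lemma S_shift_low: "0 \<le> t \<Longrightarrow> t < c0 - d \<Longrightarrow> t + (c1 + d) \<in> S \<longleftrightarrow> t \<in> S"
proof -
  assume t: "0 \<le> t" "t < c0 - d"
  have ut: "u t = t" using t c0_less d_pos by (intro u_eq[of _ _ 0]) auto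
  then have nh: "\<not> hole t" using t by (simp add: hole_def)
  have "R t = t + (c1 + d) + of_int (p + 1) * a"
    using ut t kb_eq by (simp add: R_def jump_def algebra_simps)
  then show ?thesis using S_R[OF nh] S_shift by metis
qed

lemma S_shift_high: "c0 \<le> t \<Longrightarrow> t < a \<Longrightarrow> t + c1 \<in> S \<longleftrightarrow> t \<in> S"
proof -
  assume t: "c0 \<le> t" "t < a"
  have ut: "u t = t" using t c0_gt d_pos by (intro u_eq[of _ _ 0]) auto
  then have nh: "\<not> hole t" using t by (simp add: hole_def)
  have "R t = t + c1 + of_int p * a"
    using ut t kb_eq d_pos by (simp add: R_def jump_def algebra_simps)
  then show ?thesis using S_R[OF nh] S_shift by metis
qed

lemma \<phi>_low: "0 \<le> x \<Longrightarrow> x \<le> c0 - d \<Longrightarrow> \<phi> (x + (c1 + d)) = \<phi> x + \<theta>"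
proof -
  assume x: "0 \<le> x" "x \<le> c0 - d"
  have "mass S (0 + (c1 + d)) (x + (c1 + d)) = mass S 0 x"
    by (rule mass_shift) (use x S_shift_low in auto)
  then show ?thesis
    using \<phi>_diff[of "c1 + d" "x + (c1 + d)"] \<phi>_diff[of 0 x] x \<phi>_gap[of "c1 + d"] d_pos by simp
qed

lemma \<phi>_high: "c0 \<le> x \<Longrightarrow> x \<le> a \<Longrightarrow> \<phi> (x + c1) = \<phi> x + \<theta>"
proof -
  assume x: "c0 \<le> x" "x \<le> a"
  have "mass S (c0 + c1) (x + c1) = mass S c0 x"
    by (rule mass_shift) (use x S_shift_high in auto)
  \<comment> \<open>The starting value comes from the lower branch at \<open>c0 - d\<close>, as
    \<open>\<phi>\<close> is constant across the hole.\<close>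
  moreover have "\<phi> (c0 + c1) = c0' + \<theta>"
    using \<phi>_low[of "c0 - d"] \<phi>_hole c0_gt by simp
  ultimately show ?thesis
    using \<phi>_diff[of "c0 + c1" "x + c1"] \<phi>_diff[of c0 x] x by (simp add: c0'_def)
qed

text \<open>At this stage \<open>L\<close> may still be 0, and the relation is then equality;
  positivity of \<open>L\<close> comes only from surviving pairs.\<close>

definition cong_L :: "real \<Rightarrow> real \<Rightarrow> bool" where
  "cong_L x y \<longleftrightarrow> (\<exists>i::int. x = y + of_int i * L)"

lemma cong_L_refl [simp]: "cong_L x x"
  unfolding cong_L_def by (rule exI[of _ 0]) simp

lemma cong_L_sym: "cong_L x y \<Longrightarrow> cong_L y x"
  unfolding cong_L_def
proof (elim exE)
  fix i :: int assume "x = y + of_int i * L"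
  then show "\<exists>i::int. y = x + of_int i * L" by (intro exI[of _ "- i"]) simp
qed

lemma cong_L_trans: "cong_L x y \<Longrightarrow> cong_L y z \<Longrightarrow> cong_L x z"
  unfolding cong_L_def
proof (elim exE)
  fix i j :: int assume "x = y + of_int i * L" "y = z + of_int j * L"
  then show "\<exists>i::int. x = z + of_int i * L" by (intro exI[of _ "i + j"]) (simp add: algebra_simps)
qed

lemma cong_L_add [simp]: "cong_L (x + z) (y + z) \<longleftrightarrow> cong_L x y"
  unfolding cong_L_def by (auto simp: algebra_simps)

lemma cong_L_shift: "cong_L (x + of_int i * L) x"
  unfolding cong_L_def by blast

lemma cong_L_\<phi>_R: "\<not> hole x \<Longrightarrow> cong_L (\<phi> (R x)) (\<phi> x + \<theta>)"
proof -
  assume nh: "\<not> hole x"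
  obtain i where x: "x = of_int i * a + u x" by (rule u_cases)
  have \<phi>x: "\<phi> x = \<phi> (u x) + of_int i * L" using x \<phi>_shift[of "u x" i] by (simp add: add.commute)
  show ?thesis
  proof (cases "u x < c0 - d")
    case True
    have "R x = of_int i * a + u x + of_int k * b + b" using True x by (simp add: R_def jump_def algebra_simps)
    then have "R x = u x + (c1 + d) + of_int (i + p + 1) * a"
      using kb_eq by (simp add: algebra_simps)
    then have "\<phi> (R x) = \<phi> (u x + (c1 + d)) + of_int (i + p + 1) * L" by (simp only: \<phi>_shift)
    also have "\<dots> = (\<phi> x + \<theta>) + of_int (p + 1) * L"
      using \<phi>_low[of "u x"] u_bounds[of x] True \<phi>x by (simp add: algebra_simps)
    finally show ?thesis unfolding cong_L_def by blast
  next
    case False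
    have "R x = of_int i * a + u x + of_int k * b" using False x by (simp add: R_def jump_def algebra_simps)
    then have "R x = u x + c1 + of_int (i + p) * a"
      using kb_eq by (simp add: algebra_simps)
    then have "\<phi> (R x) = \<phi> (u x + c1) + of_int (i + p) * L" by (simp only: \<phi>_shift)
    also have "\<dots> = (\<phi> x + \<theta>) + of_int p * L"
      using \<phi>_high[of "u x"] u_bounds[of x] False nh \<phi>x by (simp add: algebra_simps hole_def)
    finally show ?thesis unfolding cong_L_def by blast
  qed
qed

lemma cong_L_\<phi>_Q: "\<not> gap x \<Longrightarrow> cong_L (\<phi> (Q x)) (\<phi> x - \<theta>)"
proof -
  assume "\<not> gap x"
  then have "cong_L (\<phi> x) (\<phi> (Q x) + \<theta>)" using cong_L_\<phi>_R[of "Q x"] Q_not_hole[of x] by simp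
  then have "cong_L (\<phi> x - \<theta> + \<theta>) (\<phi> (Q x) + \<theta>)" by simp
  then show ?thesis unfolding cong_L_add by (rule cong_L_sym)
qed

lemma cong_L_hole: "hole x \<Longrightarrow> cong_L (\<phi> x) c0'"
proof -
  assume h: "hole x"
  obtain i where x: "x = of_int i * a + u x" by (rule u_cases)
  have "\<phi> x = \<phi> (u x) + of_int i * L" using x \<phi>_shift[of "u x" i] by (simp add: add.commute)
  moreover have "\<phi> (u x) = c0'"
    using h \<phi>_mono[of "c0 - d" "u x"] \<phi>_mono[of "u x" c0] \<phi>_hole by (simp add: hole_def c0'_def)
  ultimately show ?thesis by (simp add: cong_L_shift)
qed

lemma cong_L_gap: "gap x \<Longrightarrow> cong_L (\<phi> x) \<theta>"
proof -
  assume g: "gap x"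
  obtain i where x: "x - of_int k * b = of_int i * a + u (x - of_int k * b)" by (rule u_cases)
  define v where "v = u (x - of_int k * b)"
  have v: "0 \<le> v" "v < d" using g u_bounds by (simp_all add: v_def gap_def)
  have "x = (c1 + v) + of_int (i + p) * a" using x kb_eq unfolding v_def[symmetric] by (simp add: algebra_simps)
  then have "\<phi> x = \<phi> (c1 + v) + of_int (i + p) * L" by (simp only: \<phi>_shift)
  also have "\<phi> (c1 + v) = \<theta>" using v by (intro \<phi>_gap) auto
  finally show ?thesis unfolding cong_L_def by blast
qed

section \<open>Lengths collapsed to a point, and their conservation\<close>

definition G :: "real \<Rightarrow> real set" where "G y = {x. cong_L (\<phi> x) y}"

definition V :: "real \<Rightarrow> real" where "V y = mass (G y) 0 a"

lemma G_measurable [measurable]: "G y \<in> sets borel"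
proof -
  have "{x \<in> space borel. \<exists>i::int. \<phi> x = y + of_int i * L} \<in> sets borel" by measurable
  then show ?thesis by (simp add: G_def cong_L_def)
qed

lemma G_shift: "t + a \<in> G y \<longleftrightarrow> t \<in> G y"
proof -
  have "cong_L (\<phi> t + L) (\<phi> t)" using cong_L_shift[of "\<phi> t" 1] by simp
  then show ?thesis unfolding G_def mem_Collect_eq \<phi>_shift_a using cong_L_sym cong_L_trans by blast
qed

lemma G_disjoint: "\<not> cong_L x y \<Longrightarrow> G x \<inter> G y = {}"
  unfolding G_def using cong_L_sym cong_L_trans by blast

text \<open>\<open>V y\<close> is the length, within one period \<open>a\<close>, of what \<open>\<phi>\<close> collapses to \<open>y\<close> modulo \<open>L\<close>. The dynamics
  preserves it, except that the hole (collapsed to \<open>c0'\<close>) is lost and the gap (collapsed to \<open>\<theta>\<close>) is gained.\<close>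

lemma V_recurrence:
  "V (y + \<theta>) + (if cong_L c0' y then d else 0) = V y + (if cong_L 0 y then d else 0)"
proof -
  have c0d: "0 \<le> c0 - d" "c0 - d \<le> c0" "c0 \<le> a" using c0_gt c0_less d_pos by auto
  have "V y = mass (G y) 0 (c0 - d) + mass (G y) (c0 - d) c0 + mass (G y) c0 a"
    unfolding V_def using mass_split[OF G_measurable, of 0 "c0 - d" a y] mass_split[OF G_measurable, of "c0 - d" c0 a y] c0d by simp
  also have "mass (G y) (c0 - d) c0 = (if cong_L c0' y then d else 0)"
  proof -
    have "\<phi> x = c0'" if "c0 - d \<le> x" "x < c0" for x
      using that \<phi>_mono[of "c0 - d" x] \<phi>_mono[of x c0] \<phi>_hole by (simp add: c0'_def)
    then have "if cong_L c0' y then {c0 - d..<c0} \<subseteq> G y else G y \<inter> {c0 - d..<c0} = {}"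
      by (auto simp: G_def)
    then show ?thesis using mass_full[of "c0 - d" c0 "G y"] mass_empty[of "G y" "c0 - d" c0] d_pos by (auto split: if_splits)
  qed
  finally have 1: "V y = mass (G y) 0 (c0 - d) + (if cong_L c0' y then d else 0) + mass (G y) c0 a" .
  \<comment> \<open>The image period is cut at \<open>c1\<close>, so that the gap comes first and
    each branch of \<open>R\<close> is a single translation.\<close>
  have "V (y + \<theta>) = mass (G (y + \<theta>)) c1 (c1 + a)"
    unfolding V_def using mass_period[OF G_measurable G_shift, of c1] c1_pos c1_less d_pos by simp
  also have "\<dots> = mass (G (y + \<theta>)) c1 (c1 + d) + mass (G (y + \<theta>)) (c1 + d) (c0 + c1) + mass (G (y + \<theta>)) (c0 + c1) (c1 + a)"
    using mass_split[OF G_measurable, of c1 "c1 + d" "c1 + a" "y + \<theta>"] mass_split[OF G_measurable, of "c1 + d" "c0 + c1" "c1 + a" "y + \<theta>"]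
      c0d d_pos c0_gt by simp
  also have "mass (G (y + \<theta>)) c1 (c1 + d) = (if cong_L 0 y then d else 0)"
  proof -
    have "cong_L \<theta> (y + \<theta>) \<longleftrightarrow> cong_L 0 y" using cong_L_add[of 0 \<theta> y] by simp
    then have "if cong_L 0 y then {c1..<c1 + d} \<subseteq> G (y + \<theta>) else G (y + \<theta>) \<inter> {c1..<c1 + d} = {}"
      using \<phi>_gap by (auto simp: G_def)
    then show ?thesis using mass_full[of c1 "c1 + d" "G (y + \<theta>)"] mass_empty[of "G (y + \<theta>)" c1 "c1 + d"] d_pos by (auto split: if_splits)
  qed
  also have "mass (G (y + \<theta>)) (c1 + d) (c0 + c1) = mass (G y) 0 (c0 - d)"
  proof -
    have "mass (G (y + \<theta>)) (0 + (c1 + d)) ((c0 - d) + (c1 + d)) = mass (G y) 0 (c0 - d)"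
    proof (rule mass_shift)
      fix t assume "0 \<le> t" "t < c0 - d"
      then show "t + (c1 + d) \<in> G (y + \<theta>) \<longleftrightarrow> t \<in> G y" by (simp add: G_def \<phi>_low)
    qed auto
    then show ?thesis by (simp add: algebra_simps)
  qed
  also have "mass (G (y + \<theta>)) (c0 + c1) (c1 + a) = mass (G y) c0 a"
  proof -
    have "mass (G (y + \<theta>)) (c0 + c1) (a + c1) = mass (G y) c0 a"
    proof (rule mass_shift)
      fix t assume "c0 \<le> t" "t < a"
      then show "t + c1 \<in> G (y + \<theta>) \<longleftrightarrow> t \<in> G y" by (simp add: G_def \<phi>_high)
    qed auto
    then show ?thesis by (simp add: add.commute)
  qed
  finally show ?thesis using 1 by simp
qed

lemma V_nonneg: "0 \<le> V y" by (simp add: V_def)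

text \<open>Fibres over incongruent values are disjoint, and together they lie in one period of
  length \<open>a\<close>.\<close>

lemma V_sum_le:
  assumes "finite I" "\<And>i j. i \<in> I \<Longrightarrow> j \<in> I \<Longrightarrow> i \<noteq> j \<Longrightarrow> \<not> cong_L (f i) (f j)"
  shows "(\<Sum>i\<in>I. V (f i)) \<le> a"
proof -
  have "(\<Sum>i\<in>I. V (f i)) = mass (\<Union>i\<in>I. G (f i)) 0 a"
    unfolding V_def using assms G_disjoint by (intro mass_UN[symmetric]) (auto simp: disjoint_family_on_def)
  also have "\<dots> \<le> a - 0" using a_pos assms(1) by (intro mass_le) auto
  finally show ?thesis by simp
qed

lemma V_\<theta>_ge: "d \<le> V \<theta>"
proof -
  have "d = mass {c1..<c1 + d} 0 a"
    using mass_full[of c1 "c1 + d" "{c1..<c1 + d}"] mass_split[of "{c1..<c1 + d}" 0 c1 a] mass_split[of "{c1..<c1 + d}" c1 "c1 + d" a]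
      mass_empty[of "{c1..<c1 + d}" 0 c1] mass_empty[of "{c1..<c1 + d}" "c1 + d" a] d_pos c1_pos c1_less by simp
  also have "\<dots> \<le> V \<theta>"
  proof -
    have "{c1..<c1 + d} \<subseteq> G \<theta>" using \<phi>_gap by (auto simp: G_def)
    then show ?thesis unfolding V_def by (intro mass_mono G_measurable) auto
  qed
  finally show ?thesis .
qed

text \<open>A level set of \<open>\<phi>\<close> in \<open>[0, a]\<close> is compact, and
  \<open>\<phi>\<close> agrees at its infimum and supremum, so \<open>S\<close> has no mass between
  them. Only countably many levels are congruent to \<open>y\<close>.\<close>

lemma S_level_null: "mass (S \<inter> G y) 0 a = 0"
proof -
  define A where "A i = S \<inter> \<phi> -` {y + of_int i * L}" for i :: int
  have [measurable]: "A i \<in> sets borel" for i unfolding A_def by measurable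
  have "mass (A i) 0 a = 0" for i
  proof -
    define K where "K = {0..a} \<inter> \<phi> -` {y + of_int i * L}"
    have "closed K" unfolding K_def
      by (intro continuous_closed_preimage continuous_\<phi>) auto
    show ?thesis
    proof (cases "K = {}")
      case True
      then show ?thesis by (intro mass_empty) (auto simp: A_def K_def disjoint_iff)
    next
      case False
      have bd: "bdd_below K" "bdd_above K" by (auto simp: K_def)
      have "Inf K \<in> K" "Sup K \<in> K"
        using closed_contains_Inf[OF False bd(1) \<open>closed K\<close>] closed_contains_Sup[OF False bd(2) \<open>closed K\<close>] by auto
      then have "Inf K \<le> Sup K" using cInf_lower[OF _ bd(1)] by blast
      with \<open>Inf K \<in> K\<close> \<open>Sup K \<in> K\<close> have le: "Inf K \<le> Sup K" "\<phi> (Inf K) = \<phi> (Sup K)" "0 \<le> Inf K" "Sup K \<le> a"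
        unfolding K_def by auto
      then have 0: "mass S (Inf K) (Sup K) = 0" using \<phi>_diff[OF le(1)] by simp
      have "mass (A i) 0 a = mass (A i) 0 (Inf K) + (mass (A i) (Inf K) (Sup K) + mass (A i) (Sup K) a)"
        using le mass_split[of "A i" 0 "Inf K" a] mass_split[of "A i" "Inf K" "Sup K" a] by simp
      also have "mass (A i) 0 (Inf K) = 0"
      proof (rule mass_empty, rule ccontr)
        assume "A i \<inter> {0..<Inf K} \<noteq> {}"
        then obtain x where x: "x \<in> A i" "0 \<le> x" "x < Inf K" by auto
        then have "x \<in> K" using le by (auto simp: A_def K_def)
        then show False using cInf_lower[OF _ bd(1)] x by force
      qed
      also have "mass (A i) (Inf K) (Sup K) = 0"
      proof -
        have "mass (A i) (Inf K) (Sup K) \<le> mass S (Inf K) (Sup K)"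
          by (rule mass_mono) (auto simp: A_def)
        then show ?thesis using 0 mass_nonneg[of "A i" "Inf K" "Sup K"] by linarith
      qed
      also have "mass (A i) (Sup K) a = 0"
      proof -
        have "A i \<inter> {Sup K..<a} \<subseteq> {Sup K}"
        proof
          fix x assume x: "x \<in> A i \<inter> {Sup K..<a}"
          then have "x \<in> K" using le by (auto simp: A_def K_def)
          then show "x \<in> {Sup K}" using cSup_upper[OF _ bd(2)] x by force
        qed
        then have "A i \<inter> {Sup K..<a} \<in> null_sets lborel"
          by (rule null_sets_subset[rotated 2]) auto
        then show ?thesis using mass_eq_0_iff by simp
      qed
      finally show ?thesis by simp
    qed
  qed
  then have "mass (\<Union>i. A i) 0 a = 0" by (intro mass_UN_null) auto
  moreover have "(\<Union>i. A i) = S \<inter> G y" by (auto simp: A_def G_def cong_L_def)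
  ultimately show ?thesis by simp
qed

end

context hole_dynamics
begin

text \<open>By monotonicity \<open>\<phi>\<close> is constant on \<open>[x, x']\<close>, so the
  fibre contains a segment of length \<open>\<eta>\<close>; since \<open>\<eta> \<le> a\<close>, it
  is not folded onto itself modulo \<open>a\<close>.\<close>

lemma V_ge_segment:
  assumes x: "x \<le> x'" "cong_L (\<phi> x) y" "\<phi> x = \<phi> x'" and \<eta>: "0 \<le> \<eta>" "\<eta> \<le> a" "\<eta> \<le> x' - x"
  shows "\<eta> \<le> V y"
proof -
  obtain i where i: "x = of_int i * a + u x" by (rule u_cases)
  have "t \<in> G y" if t: "u x \<le> t" "t < u x + \<eta>" for t
  proof -
    have "x \<le> t + of_int i * a" "t + of_int i * a \<le> x'" using t i \<eta> by linarith+
    then have "\<phi> (t + of_int i * a) = \<phi> x" using \<phi>_mono[of x "t + of_int i * a"] \<phi>_mono[of "t + of_int i * a" x'] x by simp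
    then have "cong_L (\<phi> t) (\<phi> x)" using cong_L_shift[of "\<phi> t" i] cong_L_sym by (metis \<phi>_shift)
    then show ?thesis using x(2) cong_L_trans unfolding G_def by blast
  qed
  then have "{u x..<u x + \<eta>} \<subseteq> G y" by auto
  then have "\<eta> = mass (G y) (u x) (u x + \<eta>)" using \<eta> mass_full[of "u x" "u x + \<eta>" "G y"] by simp
  also have "\<dots> \<le> mass (G y) (u x) (u x + a)"
    using mass_split[of "G y" "u x" "u x + \<eta>" "u x + a"] \<eta> by simp
  also have "\<dots> = V y"
    unfolding V_def using mass_period[OF G_measurable G_shift, of "u x"] u_bounds[of x] by simp
  finally show ?thesis .
qed

lemma cong_L_funpow_R:
  "(\<And>i. i < n \<Longrightarrow> \<not> hole ((R ^^ i) x)) \<Longrightarrow> cong_L (\<phi> ((R ^^ n) x)) (\<phi> x + real n * \<theta>)"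
proof (induction n)
  case (Suc n)
  then have "cong_L (\<phi> ((R ^^ n) x) + \<theta>) (\<phi> x + real n * \<theta> + \<theta>)" by simp
  moreover have "cong_L (\<phi> (R ((R ^^ n) x))) (\<phi> ((R ^^ n) x) + \<theta>)" using Suc.prems cong_L_\<phi>_R by simp
  ultimately have "cong_L (\<phi> (R ((R ^^ n) x))) (\<phi> x + real n * \<theta> + \<theta>)" using cong_L_trans by blast
  then show ?case by (simp add: algebra_simps)
qed simp

lemma cong_L_funpow_Q:
  "(\<And>i. i < n \<Longrightarrow> \<not> gap ((Q ^^ i) x)) \<Longrightarrow> cong_L (\<phi> ((Q ^^ n) x)) (\<phi> x - real n * \<theta>)"
proof (induction n)
  case (Suc n)
  then have "cong_L (\<phi> ((Q ^^ n) x) + - \<theta>) (\<phi> x - real n * \<theta> + - \<theta>)" by (simp only: cong_L_add) simp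
  moreover have "cong_L (\<phi> (Q ((Q ^^ n) x))) (\<phi> ((Q ^^ n) x) + - \<theta>)" using Suc.prems cong_L_\<phi>_Q by simp
  ultimately have "cong_L (\<phi> (Q ((Q ^^ n) x))) (\<phi> x - real n * \<theta> + - \<theta>)" using cong_L_trans by blast
  then show ?case by (simp add: algebra_simps)
qed simp

lemma funpow_R_b: "\<exists>j::int. int n \<le> j \<and> j \<le> int n * (k + 1) \<and> (R ^^ n) x = x + of_int j * b"
proof (induction n)
  case (Suc n)
  then obtain j :: int where j: "int n \<le> j" "j \<le> int n * (k + 1)" "(R ^^ n) x = x + of_int j * b" by blast
  define l where "l = jump ((R ^^ n) x)"
  have l: "1 \<le> l" "l \<le> k + 1" using k_ge by (simp_all add: l_def jump_def)
  have "(R ^^ Suc n) x = x + of_int (j + l) * b" using j(3) by (simp add: R_def l_def algebra_simps)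
  moreover have "int (Suc n) \<le> j + l" "j + l \<le> int (Suc n) * (k + 1)" using j l by (simp_all add: algebra_simps)
  ultimately show ?case by blast
qed auto

lemma u_multiple_b: "j \<noteq> 0 \<Longrightarrow> 0 < u (of_int j * b)"
proof -
  assume j: "j \<noteq> 0"
  have "u (of_int j * b) \<noteq> 0"
  proof
    assume "u (of_int j * b) = 0"
    then have "of_int (- \<lfloor>of_int j * b / a\<rfloor>) * a + of_int j * b = 0" by (simp add: u_def)
    then show False using lin_indep j by blast
  qed
  then show ?thesis using u_bounds[of "of_int j * b"] by simp
qed

text \<open>Irrationality keeps \<open>j b\<close> off the multiples of \<open>a\<close> for
  \<open>j \<noteq> 0\<close>, and finitely many \<open>j\<close> leave a positive minimal
  distance.\<close>

lemma multiples_apart: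
  obtains \<eta> where "0 < \<eta>" "\<eta> \<le> a" "\<And>j q :: int. 1 \<le> j \<Longrightarrow> j \<le> J \<Longrightarrow> \<eta> \<le> \<bar>of_int j * b - of_int q * a\<bar>"
proof -
  define \<eta> where "\<eta> = Min (insert a ((\<lambda>j. min (u (of_int j * b)) (a - u (of_int j * b))) ` {1..J}))"
  have "0 < min (u (of_int j * b)) (a - u (of_int j * b))" if "1 \<le> j" for j
    using u_multiple_b[of j] u_bounds[of "of_int j * b"] that by simp
  then have "0 < \<eta>" unfolding \<eta>_def using a_pos by (subst Min_gr_iff) auto
  moreover have "\<eta> \<le> a" unfolding \<eta>_def by simp
  moreover have "\<eta> \<le> \<bar>of_int j * b - of_int q * a\<bar>" if j: "1 \<le> j" "j \<le> J" for j q
  proof -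
    have "\<eta> \<le> min (u (of_int j * b)) (a - u (of_int j * b))"
      unfolding \<eta>_def using j by (intro Min_le) auto
    moreover obtain i where i: "of_int j * b = of_int i * a + u (of_int j * b)" by (rule u_cases)
    have "min (u (of_int j * b)) (a - u (of_int j * b)) \<le> \<bar>of_int j * b - of_int q * a\<bar>"
    proof (cases "q \<le> i")
      case True
      then have "of_int q * a \<le> of_int i * a" using a_pos by (intro mult_right_mono) auto
      then show ?thesis using i by linarith
    next
      case False
      then have "of_int (i + 1) * a \<le> of_int q * a" using a_pos by (intro mult_right_mono) auto
      then have "of_int i * a + a \<le> of_int q * a" by (simp add: algebra_simps)
      then show ?thesis using i by linarith
    qed
    ultimately show ?thesis by linarith
  qed
  ultimately show ?thesis using that by blast
qed

end

section \<open>From surviving pairs to an irrational rotation\<close>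

locale surviving_pairs = hole_dynamics +
  assumes pairs: "\<And>t. \<exists>i\<in>window t 0. \<exists>j\<in>window t 0. i \<noteq> j \<and> t + of_int i * b \<in> S \<and> t + of_int j * b \<in> S"
begin

text \<open>Each coset has at least two points of \<open>S\<close> in \<open>[0, c)\<close>;
  integrating their number over a period of length \<open>b\<close> gives the measure of
  \<open>S\<close> there.\<close>

lemma \<phi>_c_ge: "2 * b \<le> \<phi> c"
proof -
  define A where "A = S \<inter> {0..<c}"
  have [measurable]: "A \<in> sets borel" by (simp add: A_def)
  have "ennreal (2 * b) = (\<integral>\<^sup>+s. 2 \<partial>M)"
    using emeasure_M_space b_pos by (simp add: ennreal_mult)
  also have "\<dots> \<le> (\<integral>\<^sup>+s. \<integral>\<^sup>+j. indicator A (s + of_int j * b) \<partial>count_space UNIV \<partial>M)"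
  proof (rule nn_integral_mono)
    fix s
    obtain i j where ij: "i \<in> window s 0" "j \<in> window s 0" "i \<noteq> j" "s + of_int i * b \<in> S" "s + of_int j * b \<in> S"
      using pairs[of s] by blast
    then have "s + of_int i * b \<in> A" "s + of_int j * b \<in> A" by (auto simp: A_def window_def)
    then have "(2::ennreal) = (\<Sum>l\<in>{i, j}. indicator A (s + of_int l * b))" using ij(3) by simp
    also have "\<dots> \<le> (\<integral>\<^sup>+j. indicator A (s + of_int j * b) \<partial>count_space UNIV)"
      by (rule sum_le_nn_integral_count_space) simp
    finally show "2 \<le> (\<integral>\<^sup>+j. indicator A (s + of_int j * b) \<partial>count_space UNIV)" .
  qed
  also have "\<dots> = (\<integral>\<^sup>+t. indicator A t \<partial>lborel)"
    by (rule nn_integral_periodize[symmetric]) measurable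
  also have "\<dots> = emeasure lborel A" by simp
  also have "\<dots> = ennreal (\<phi> c)"
    unfolding A_def using emeasure_eq_ennreal_measure[OF finite_Ico] c_pos by (simp add: \<phi>_def mass_def)
  finally show ?thesis using mass_nonneg[of S 0 c] c_pos by (simp add: \<phi>_def ennreal_le_iff)
qed

lemma L_pos: "0 < L"
proof (rule ccontr)
  assume "\<not> 0 < L"
  define n where "n = \<lceil>c / a\<rceil>"
  have "c / a \<le> of_int n" by (simp add: n_def)
  then have n: "c \<le> of_int n * a" using a_pos by (simp only: pos_divide_le_eq)
  then have "0 < of_int n * a" using c_pos by linarith
  then have n0: "0 \<le> n" using a_pos by (simp add: zero_less_mult_iff)
  have "\<phi> c \<le> \<phi> (0 + of_int n * a)" using n by (intro \<phi>_mono) simp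
  also have "\<dots> = of_int n * L" unfolding \<phi>_shift by simp
  also have "\<dots> \<le> 0" using n0 \<open>\<not> 0 < L\<close> by (simp add: mult_nonneg_nonpos)
  finally show False using \<phi>_c_ge b_pos by linarith
qed

text \<open>If \<open>r \<theta>\<close> were a multiple of \<open>L\<close>, then \<open>\<phi>\<close> would identify \<open>(R ^^ r) x\<close> with a translate of \<open>x\<close> by a multiple
  of \<open>a\<close>, although the two differ by an amount bounded away from 0.\<close>

lemma V_large_on_S:
  assumes r: "0 < r" "cong_L (real r * \<theta>) 0"
  obtains \<eta> where "0 < \<eta>" "\<And>x. x \<in> S \<Longrightarrow> \<eta> \<le> V (\<phi> x)"
proof -
  obtain \<eta> where \<eta>: "0 < \<eta>" "\<eta> \<le> a" "\<And>j q :: int. 1 \<le> j \<Longrightarrow> j \<le> int r * (k + 1) \<Longrightarrow> \<eta> \<le> \<bar>of_int j * b - of_int q * a\<bar>"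
    using multiples_apart[of "int r * (k + 1)"] by blast
  have "\<eta> \<le> V (\<phi> x)" if x: "x \<in> S" for x
  proof -
    have "cong_L (\<phi> ((R ^^ r) x)) (\<phi> x + real r * \<theta>)"
      using x by (intro cong_L_funpow_R) (simp add: S_iff)
    moreover have "cong_L (\<phi> x + real r * \<theta>) (\<phi> x)"
      using r(2) cong_L_add[of "real r * \<theta>" "\<phi> x" 0] by (simp add: add.commute)
    ultimately have cg: "cong_L (\<phi> ((R ^^ r) x)) (\<phi> x)" using cong_L_trans by blast
    then obtain q :: int where q: "\<phi> ((R ^^ r) x) = \<phi> x + of_int q * L" unfolding cong_L_def by blast
    obtain j :: int where j: "int r \<le> j" "j \<le> int r * (k + 1)" "(R ^^ r) x = x + of_int j * b"
      using funpow_R_b by blast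
    define y where "y = x + of_int q * a"
    have y: "\<phi> y = \<phi> ((R ^^ r) x)" "cong_L (\<phi> y) (\<phi> x)" unfolding y_def \<phi>_shift q by (simp_all add: cong_L_shift)
    have ge: "\<eta> \<le> \<bar>(R ^^ r) x - y\<bar>" using \<eta>(3)[of j q] j r(1) by (simp add: y_def)
    show ?thesis
    proof (cases "y \<le> (R ^^ r) x")
      case True
      show ?thesis by (rule V_ge_segment[of y "(R ^^ r) x"]) (use True y ge \<eta> in auto)
    next
      case False
      show ?thesis by (rule V_ge_segment[of "(R ^^ r) x" y]) (use False y ge \<eta> cg in auto)
    qed
  qed
  then show ?thesis using that \<eta>(1) by blast
qed

text \<open>Otherwise every fibre met by \<open>S\<close> has length at least \<open>\<eta>\<close>,
  so \<open>S\<close> lies in finitely many fibres. Each of them meets \<open>S\<close> in a null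
  set, so \<open>S\<close> would be null in a period, against \<open>L > 0\<close>.\<close>

lemma \<theta>_irrational:
  assumes "0 < r"
  shows "\<not> cong_L (real r * \<theta>) 0"
proof
  assume "cong_L (real r * \<theta>) 0"
  then obtain \<eta> where \<eta>: "0 < \<eta>" "\<And>x. x \<in> S \<Longrightarrow> \<eta> \<le> V (\<phi> x)" using V_large_on_S[OF assms] by blast
  define P where "P Y \<longleftrightarrow> finite Y \<and> Y \<subseteq> \<phi> ` S \<and> (\<forall>y\<in>Y. \<forall>z\<in>Y. y \<noteq> z \<longrightarrow> \<not> cong_L y z)" for Y
  have bound: "card Y \<le> nat \<lfloor>a / \<eta>\<rfloor>" if "P Y" for Y
  proof -
    have "(\<Sum>y\<in>Y. \<eta>) \<le> (\<Sum>y\<in>Y. V y)" using that \<eta>(2) by (intro sum_mono) (auto simp: P_def)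
    also have "\<dots> \<le> a" using that by (intro V_sum_le[where f="\<lambda>y. y"]) (auto simp: P_def)
    finally have "real (card Y) \<le> a / \<eta>" using \<eta>(1) by (simp add: field_simps)
    then show ?thesis by (simp add: le_nat_floor)
  qed
  have "P {}" by (simp add: P_def)
  \<comment> \<open>A largest family of incongruent values; by maximality its fibres cover
    \<open>S\<close>.\<close>
  then obtain Y where Y: "P Y" "\<And>Z. P Z \<Longrightarrow> card Z \<le> card Y"
    using ex_has_greatest_nat[of P "{}" card "nat \<lfloor>a / \<eta>\<rfloor> + 1"] bound by (metis less_Suc_eq_le Suc_eq_plus1)
  have "S \<subseteq> (\<Union>y\<in>Y. S \<inter> G y)"
  proof
    fix x assume x: "x \<in> S"
    show "x \<in> (\<Union>y\<in>Y. S \<inter> G y)"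
    proof (rule ccontr)
      assume "x \<notin> (\<Union>y\<in>Y. S \<inter> G y)"
      then have nc: "\<not> cong_L (\<phi> x) y" if "y \<in> Y" for y using that x by (auto simp: G_def)
      then have "\<phi> x \<notin> Y" using cong_L_refl by blast
      moreover have "P (insert (\<phi> x) Y)" using Y(1) x nc cong_L_sym unfolding P_def by blast
      ultimately show False using Y(2)[of "insert (\<phi> x) Y"] Y(1) by (simp add: P_def)
    qed
  qed
  then have "mass S 0 a \<le> mass (\<Union>y\<in>Y. S \<inter> G y) 0 a"
    using Y(1) by (intro mass_mono) (auto simp: P_def)
  also have "\<dots> = 0" using Y(1) S_level_null by (intro mass_UN_null) (auto simp: P_def countable_finite)
  finally have "mass S 0 a \<le> 0" .
  then show False using L_pos a_pos by (simp add: L_def \<phi>_def)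
qed

lemma \<theta>_multiple_inj: "cong_L (of_int n * \<theta>) (of_int m * \<theta>) \<Longrightarrow> n = m"
proof (induction n m rule: linorder_wlog)
  case (le n m)
  show ?case
  proof (rule ccontr)
    assume "n \<noteq> m"
    then have nm: "0 < nat (m - n)" using le by simp
    have "cong_L (of_int m * \<theta> + - (of_int n * \<theta>)) (of_int n * \<theta> + - (of_int n * \<theta>))"
      unfolding cong_L_add using cong_L_sym le(2) by blast
    then have "cong_L (real (nat (m - n)) * \<theta>) 0" using le by (simp add: algebra_simps)
    then show False using \<theta>_irrational[OF nm] by blast
  qed
next
  case (sym n m)
  then show ?case using cong_L_sym by metis
qed

section \<open>The finite chain of collapsed intervals\<close>

definition Vn :: "int \<Rightarrow> real" where "Vn n = V (of_int n * \<theta>)"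

text \<open>As multiples of \<open>\<theta>\<close> are pairwise incongruent, the gap contributes
  only to the step from 0 to 1.\<close>

lemma Vn_recurrence: "Vn (n + 1) + (if cong_L c0' (of_int n * \<theta>) then d else 0) = Vn n + (if n = 0 then d else 0)"
proof -
  have "cong_L 0 (of_int n * \<theta>) \<longleftrightarrow> n = 0"
    using \<theta>_multiple_inj[of 0 n] by auto
  then show ?thesis using V_recurrence[of "of_int n * \<theta>"] by (simp add: Vn_def algebra_simps)
qed

lemma Vn_sum_le: "finite I \<Longrightarrow> (\<Sum>n\<in>I. Vn n) \<le> a"
  unfolding Vn_def using \<theta>_multiple_inj by (intro V_sum_le) blast+

lemma Vn_not_bounded_below:
  assumes "infinite I" "\<And>n. n \<in> I \<Longrightarrow> v \<le> Vn n"
  shows "v \<le> 0"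
proof (rule ccontr)
  assume "\<not> v \<le> 0"
  then have v: "0 < v" by simp
  obtain K :: nat where K: "a < real K * v" using reals_Archimedean3[OF v] by blast
  obtain F where F: "F \<subseteq> I" "finite F" "card F = K" using infinite_arbitrarily_large[OF assms(1)] by blast
  have "real K * v = (\<Sum>n\<in>F. v)" using F by simp
  also have "\<dots> \<le> (\<Sum>n\<in>F. Vn n)" using F assms by (intro sum_mono) auto
  also have "\<dots> \<le> a" using F by (intro Vn_sum_le) simp
  finally show False using K by simp
qed

lemma infinite_atLeast_int: "infinite {n::int..}" and infinite_atMost_int: "infinite {..n::int}"
  by (simp_all add: infinite_Ici infinite_Iic)

text \<open>If the hole never took back the length \<open>d\<close> gained at index 1, infinitely
  many disjoint fibres of length at least \<open>d\<close> would fit into one period.\<close>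

lemma ex_N: "\<exists>N\<ge>1. cong_L c0' (of_int N * \<theta>)"
proof (rule ccontr)
  assume no: "\<not> (\<exists>N\<ge>1. cong_L c0' (of_int N * \<theta>))"
  have "d \<le> Vn n" if "1 \<le> n" for n
    using that
  proof (induction n rule: int_ge_induct)
    case base
    then show ?case using V_\<theta>_ge by (simp add: Vn_def)
  next
    case (step n)
    then show ?case using Vn_recurrence[of n] no by auto
  qed
  then have "d \<le> 0" by (intro Vn_not_bounded_below[OF infinite_atLeast_int[of 1]]) auto
  then show False using d_pos by simp
qed

definition N :: int where "N = (SOME N. 1 \<le> N \<and> cong_L c0' (of_int N * \<theta>))"

lemma N_ge: "1 \<le> N" and N_cong: "cong_L c0' (of_int N * \<theta>)"
  using someI_ex[OF ex_N[unfolded Bex_def]] by (auto simp: N_def)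

lemma cong_c0'_iff: "cong_L c0' (of_int n * \<theta>) \<longleftrightarrow> n = N"
proof
  assume "cong_L c0' (of_int n * \<theta>)"
  then have "cong_L (of_int n * \<theta>) (of_int N * \<theta>)" using N_cong cong_L_sym cong_L_trans by blast
  then show "n = N" by (rule \<theta>_multiple_inj)
qed (use N_cong in simp)

lemma Vn_rec: "Vn (n + 1) = Vn n + (if n = 0 then d else 0) - (if n = N then d else 0)"
  using Vn_recurrence[of n] unfolding cong_c0'_iff by simp

text \<open>No gain or loss occurs at negative indices, so the lengths agree for all
  \<open>n \<le> 0\<close>; infinitely many disjoint fibres of equal length must be null.\<close>

lemma Vn_nonpos:
  assumes "n \<le> 0"
  shows "Vn n = 0"
proof -
  have const: "Vn i = Vn 0" if "i \<le> 0" for i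
    using that
  proof (induction i rule: int_le_induct)
    case (step i)
    have "Vn (i - 1 + 1) = Vn (i - 1)" using Vn_rec[of "i - 1"] step(1) N_ge by simp
    then show ?case using step by simp
  qed simp
  have "Vn 0 \<le> 0"
  proof (rule Vn_not_bounded_below[OF infinite_atMost_int[of 0]])
    fix i :: int assume "i \<in> {..0}"
    then have "Vn i = Vn 0" by (intro const) simp
    then show "Vn 0 \<le> Vn i" by simp
  qed
  moreover have "0 \<le> Vn 0" unfolding Vn_def by (rule V_nonneg)
  moreover have "Vn n = Vn 0" using assms by (rule const)
  ultimately show ?thesis by linarith
qed

lemma Vn_mid: "1 \<le> n \<Longrightarrow> n \<le> N \<Longrightarrow> Vn n = d"
proof (induction n rule: int_ge_induct)
  case base
  then show ?case using Vn_rec[of 0] Vn_nonpos[of 0] N_ge by simp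
next
  case (step n)
  then show ?case using Vn_rec[of n] by simp
qed

lemma Vn_large: "N + 1 \<le> n \<Longrightarrow> Vn n = 0"
proof (induction n rule: int_ge_induct)
  case base
  then show ?case using Vn_rec[of N] Vn_mid[of N] N_ge by simp
next
  case (step n)
  then show ?case using Vn_rec[of n] N_ge by simp
qed

text \<open>Such a point reaches the hole forward or the gap backward. Until the first time it does,
  \<open>\<phi>\<close> follows the rotation, so its value is congruent to
  \<open>(N - n) \<theta>\<close> or to \<open>(1 + n) \<theta>\<close>.\<close>

lemma complement_S: "x \<notin> S \<Longrightarrow> \<exists>n::int. x \<in> G (of_int n * \<theta>)"
proof -
  assume "x \<notin> S"
  then consider n where "hole ((R ^^ n) x)" | n where "gap ((Q ^^ n) x)" unfolding S_iff by blast
  then show ?thesis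
  proof cases
    case 1
    define n where "n = (LEAST n. hole ((R ^^ n) x))"
    have h: "hole ((R ^^ n) x)" unfolding n_def using 1 by (rule LeastI)
    have "\<not> hole ((R ^^ i) x)" if "i < n" for i using that not_less_Least unfolding n_def by blast
    then have "cong_L (\<phi> ((R ^^ n) x)) (\<phi> x + real n * \<theta>)" by (rule cong_L_funpow_R)
    moreover have "cong_L (\<phi> ((R ^^ n) x)) (of_int N * \<theta>)" using cong_L_hole[OF h] N_cong cong_L_trans by blast
    ultimately have "cong_L (\<phi> x + real n * \<theta>) (of_int N * \<theta>)"
      by (rule cong_L_trans[OF cong_L_sym])
    also have "of_int N * \<theta> = of_int (N - int n) * \<theta> + real n * \<theta>" by (simp add: algebra_simps)
    finally show ?thesis unfolding cong_L_add G_def by blast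
  next
    case 2
    define n where "n = (LEAST n. gap ((Q ^^ n) x))"
    have h: "gap ((Q ^^ n) x)" unfolding n_def using 2 by (rule LeastI)
    have "\<not> gap ((Q ^^ i) x)" if "i < n" for i using that not_less_Least unfolding n_def by blast
    then have "cong_L (\<phi> ((Q ^^ n) x)) (\<phi> x - real n * \<theta>)" by (rule cong_L_funpow_Q)
    moreover have "cong_L (\<phi> ((Q ^^ n) x)) \<theta>" using cong_L_gap[OF h] .
    ultimately have "cong_L (\<phi> x - real n * \<theta>) \<theta>"
      by (rule cong_L_trans[OF cong_L_sym])
    then have "cong_L (\<phi> x - real n * \<theta> + real n * \<theta>) (\<theta> + real n * \<theta>)" by (simp only: cong_L_add)
    moreover have "\<theta> + real n * \<theta> = of_int (1 + int n) * \<theta>" by (simp add: algebra_simps)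
    ultimately have "cong_L (\<phi> x) (of_int (1 + int n) * \<theta>)" by simp
    then show ?thesis unfolding G_def by blast
  qed
qed

lemma mass_0_mono: "A \<in> sets borel \<Longrightarrow> 0 \<le> x \<Longrightarrow> x \<le> a \<Longrightarrow> mass A 0 x \<le> mass A 0 a"
  using mass_split[of A 0 x a] by simp

text \<open>Up to null sets the complement of \<open>S\<close> is the union \<open>U\<close> of the
  fibres over \<open>\<theta>, ..., N \<theta>\<close>: \<open>complement_S\<close> gives one
  inclusion, as the other fibres are null, and \<open>S_level_null\<close> the reverse one.\<close>

lemma \<phi>_eq_gaps:
  assumes x: "0 \<le> x" "x \<le> a"
  shows "\<phi> x = x - (\<Sum>n\<in>{1..N}. mass (G (of_int n * \<theta>)) 0 x)"
proof -
  define U where "U = (\<Union>n\<in>{1..N}. G (of_int n * \<theta>))"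
  define Z where "Z = (\<Union>n\<in>-{1..N}. G (of_int n * \<theta>))"
  have [measurable]: "U \<in> sets borel" "Z \<in> sets borel" unfolding U_def Z_def by auto
  have disj: "n \<noteq> m \<Longrightarrow> G (of_int n * \<theta>) \<inter> G (of_int m * \<theta>) = {}" for n m
    using G_disjoint \<theta>_multiple_inj by blast
  have U: "mass U 0 x = (\<Sum>n\<in>{1..N}. mass (G (of_int n * \<theta>)) 0 x)"
    unfolding U_def using disj by (intro mass_UN) (auto simp: disjoint_family_on_def)
  have "mass Z 0 x = 0"
    unfolding Z_def
  proof (intro mass_UN_null)
    fix n assume "n \<in> - {1..N}"
    then have "Vn n = 0" using Vn_nonpos[of n] Vn_large[of n] by (cases "n \<le> 0") auto
    then show "mass (G (of_int n * \<theta>)) 0 x = 0"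
      using mass_0_mono[OF G_measurable x, of "of_int n * \<theta>"] mass_nonneg[of "G (of_int n * \<theta>)" 0 x] by (simp add: Vn_def V_def)
  qed auto
  moreover have "U \<inter> Z = {}"
  proof -
    have "y \<notin> Z" if "y \<in> U" for y
    proof
      assume "y \<in> Z"
      then obtain m where "m \<in> - {1..N}" "y \<in> G (of_int m * \<theta>)" unfolding Z_def by blast
      moreover obtain n where "n \<in> {1..N}" "y \<in> G (of_int n * \<theta>)" using \<open>y \<in> U\<close> unfolding U_def by blast
      ultimately show False using disj[of n m] by auto
    qed
    then show ?thesis by blast
  qed
  then have "mass (U \<union> Z) 0 x = mass U 0 x + mass Z 0 x" by (intro mass_Un) simp_all
  ultimately have UZ: "mass (U \<union> Z) 0 x = mass U 0 x" by linarith
  have "- S \<subseteq> U \<union> Z" using complement_S unfolding U_def Z_def by blast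
  then have 1: "mass (- S) 0 x \<le> mass U 0 x" unfolding UZ[symmetric] by (intro mass_mono) auto
  have SU: "mass (S \<inter> U) 0 x = 0"
  proof -
    have "mass (\<Union>n\<in>{1..N}. S \<inter> G (of_int n * \<theta>)) 0 a = 0"
      using S_level_null by (intro mass_UN_null) auto
    moreover have "S \<inter> U = (\<Union>n\<in>{1..N}. S \<inter> G (of_int n * \<theta>))" by (auto simp: U_def)
    ultimately have "mass (S \<inter> U) 0 a = 0" by metis
    moreover have "mass (S \<inter> U) 0 x \<le> mass (S \<inter> U) 0 a" using x by (intro mass_0_mono) auto
    ultimately show ?thesis using mass_nonneg[of "S \<inter> U" 0 x] by linarith
  qed
  have "mass U 0 x \<le> mass (- S \<union> (S \<inter> U)) 0 x" by (intro mass_mono) auto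
  also have "\<dots> = mass (- S) 0 x" using SU by (subst mass_Un) auto
  finally have "mass (- S) 0 x = mass U 0 x" using 1 by simp
  moreover have "mass (S \<union> - S) 0 x = mass S 0 x + mass (- S) 0 x" by (rule mass_Un) auto
  moreover have "mass (S \<union> - S) 0 x = x" using mass_full[of 0 x UNIV] x by simp
  ultimately show ?thesis using U x by (simp add: \<phi>_def)
qed

lemma L_eq: "L = a - of_int N * d"
proof -
  have "L = a - (\<Sum>n\<in>{1..N}. Vn n)" unfolding L_def using \<phi>_eq_gaps[of a] a_pos by (simp add: Vn_def V_def)
  also have "(\<Sum>n\<in>{1..N}. Vn n) = (\<Sum>n\<in>{1..N}. d)" using Vn_mid by (intro sum.cong) auto
  also have "\<dots> = of_int N * d" using N_ge by simp
  finally show ?thesis .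
qed

section \<open>Positions of the collapsed intervals\<close>

definition res :: "int \<Rightarrow> real" where "res n = of_int n * \<theta> - of_int \<lfloor>of_int n * \<theta> / L\<rfloor> * L"

lemma res_bounds: "0 \<le> res n" "res n < L"
  using floor_divide_lower[OF L_pos, of "of_int n * \<theta>"] floor_divide_upper[OF L_pos, of "of_int n * \<theta>"]
  by (simp_all add: res_def algebra_simps)

lemma res_cong: "cong_L (res n) (of_int n * \<theta>)"
  unfolding cong_L_def res_def by (intro exI[of _ "- \<lfloor>of_int n * \<theta> / L\<rfloor>"]) simp

lemma cong_L_eq:
  assumes "cong_L x y" "0 \<le> x" "x < L" "0 \<le> y" "y < L"
  shows "x = y"
proof -
  obtain i :: int where i: "x = y + of_int i * L" using assms(1) unfolding cong_L_def by blast
  then have "\<bar>of_int i * L\<bar> < L" using assms by linarith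
  then have "\<bar>real_of_int i\<bar> < 1" using L_pos by (simp add: abs_mult)
  then have "i = 0" by linarith
  then show ?thesis using i by simp
qed

lemma res_pos: "n \<noteq> 0 \<Longrightarrow> 0 < res n"
proof -
  assume n: "n \<noteq> 0"
  have "res n \<noteq> 0"
  proof
    assume "res n = 0"
    then have "cong_L (of_int n * \<theta>) (of_int 0 * \<theta>)" using res_cong[of n] cong_L_sym by simp
    then show False using \<theta>_multiple_inj n by blast
  qed
  then show ?thesis using res_bounds[of n] by simp
qed

lemma res_inj: "res n = res m \<Longrightarrow> n = m"
  using res_cong[of n] res_cong[of m] cong_L_sym cong_L_trans \<theta>_multiple_inj by metis

lemma \<phi>_bounds: "0 \<le> t \<Longrightarrow> t \<le> a \<Longrightarrow> 0 \<le> \<phi> t \<and> \<phi> t \<le> L"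
  using \<phi>_mono[of 0 t] \<phi>_mono[of t a] by (simp add: L_def)

text \<open>The delicate case is \<open>\<phi> t = L\<close>, as at \<open>t = a\<close>: this value
  is congruent to 0, hence to no \<open>n \<theta>\<close> with \<open>n \<noteq> 0\<close>.\<close>

lemma G_res: "0 \<le> t \<Longrightarrow> t \<le> a \<Longrightarrow> n \<noteq> 0 \<Longrightarrow> t \<in> G (of_int n * \<theta>) \<longleftrightarrow> \<phi> t = res n"
proof
  assume t: "0 \<le> t" "t \<le> a" "n \<noteq> 0" "t \<in> G (of_int n * \<theta>)"
  then have c: "cong_L (\<phi> t) (res n)" using res_cong cong_L_sym cong_L_trans unfolding G_def by blast
  have "\<phi> t \<noteq> L"
  proof
    assume "\<phi> t = L"
    moreover have "cong_L 0 (0 + of_int 1 * L)" using cong_L_shift cong_L_sym by blast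
    ultimately have "cong_L 0 (res n)" using c cong_L_trans by simp
    then have "0 = res n" by (rule cong_L_eq) (use res_bounds L_pos in auto)
    then show False using res_pos t by force
  qed
  then show "\<phi> t = res n" using c \<phi>_bounds[OF t(1,2)] res_bounds by (intro cong_L_eq) auto
next
  assume "\<phi> t = res n"
  then show "t \<in> G (of_int n * \<theta>)" using res_cong by (simp add: G_def)
qed

lemma mass_gap_split:
  assumes n: "1 \<le> n" "n \<le> N" and x: "0 \<le> x" "x \<le> a"
  shows "mass (G (of_int n * \<theta>)) 0 x + mass (G (of_int n * \<theta>)) x a = d"
  using Vn_mid[OF n] mass_split[OF G_measurable, of 0 x a] x by (simp add: Vn_def V_def)

lemma mass_gap_before:
  assumes n: "1 \<le> n" "n \<le> N" and x: "0 \<le> x" "x \<le> a" and r: "res n < \<phi> x"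
  shows "mass (G (of_int n * \<theta>)) 0 x = d"
proof -
  have "G (of_int n * \<theta>) \<inter> {x..<a} = {}"
  proof (rule ccontr)
    assume "G (of_int n * \<theta>) \<inter> {x..<a} \<noteq> {}"
    then obtain t where t: "t \<in> G (of_int n * \<theta>)" "x \<le> t" "t < a" by auto
    then have "\<phi> t = res n" using G_res[of t n] x n by simp
    then show False using \<phi>_mono[OF t(2)] r by simp
  qed
  then show ?thesis using mass_gap_split[OF n x] mass_empty[of "G (of_int n * \<theta>)" x a] by simp
qed

lemma mass_gap_after:
  assumes n: "1 \<le> n" "n \<le> N" and x: "0 \<le> x" "x \<le> a" and r: "\<phi> x < res n"
  shows "mass (G (of_int n * \<theta>)) 0 x = 0"
proof -
  have "G (of_int n * \<theta>) \<inter> {0..<x} = {}"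
  proof (rule ccontr)
    assume "G (of_int n * \<theta>) \<inter> {0..<x} \<noteq> {}"
    then obtain t where t: "t \<in> G (of_int n * \<theta>)" "0 \<le> t" "t < x" by auto
    then have "\<phi> t = res n" using G_res[of t n] x n by simp
    then show False using \<phi>_mono[of t x] t r by simp
  qed
  then show ?thesis by (rule mass_empty)
qed

lemma sum_if_card: "(\<Sum>n\<in>{1..N}. if P n then d else 0) = d * real (card {n. 1 \<le> n \<and> n \<le> N \<and> P n})"
proof -
  have "(\<Sum>n\<in>{1..N}. if P n then d else 0) = real (card ({1..N} \<inter> {n. P n})) * d" by (simp add: sum.If_cases)
  also have "{1..N} \<inter> {n. P n} = {n. 1 \<le> n \<and> n \<le> N \<and> P n}" by auto
  finally show ?thesis by simp
qed

lemma c0_range: "0 \<le> c0" "c0 \<le> a" using c0_gt c0_less d_pos by auto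

lemma c1_range: "0 \<le> c1" "c1 \<le> a" "c1 + d \<le> a" using c1_pos c1_less d_pos by auto

text \<open>The fibre with residue exactly \<open>c0'\<close> is counted: it contains the hole,
  which already has the full length \<open>d\<close> of the fibre and ends at
  \<open>c0\<close>.\<close>

lemma c0'_eq: "c0' = c0 - d * real (card {n. 1 \<le> n \<and> n \<le> N \<and> res n \<le> c0'})"
proof -
  have "mass (G (of_int n * \<theta>)) 0 c0 = (if res n \<le> c0' then d else 0)" if n: "n \<in> {1..N}" for n
  proof (cases "res n" c0' rule: linorder_cases)
    case less
    then show ?thesis using mass_gap_before[of n c0] n c0_range by (simp add: c0'_def)
  next
    case greater
    then show ?thesis using mass_gap_after[of n c0] n c0_range by (simp add: c0'_def)
  next
    case equal
    have "{c0 - d..<c0} \<subseteq> G (of_int n * \<theta>)"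
    proof
      fix t assume t: "t \<in> {c0 - d..<c0}"
      then have "\<phi> t = c0'" using \<phi>_mono[of "c0 - d" t] \<phi>_mono[of t c0] \<phi>_hole by (simp add: c0'_def)
      then show "t \<in> G (of_int n * \<theta>)" using equal G_res[of t n] t n c0_range c0_gt by simp
    qed
    then have "mass (G (of_int n * \<theta>)) (c0 - d) c0 = d" using mass_full[of "c0 - d" c0] d_pos by simp
    moreover have "mass (G (of_int n * \<theta>)) 0 c0 = mass (G (of_int n * \<theta>)) 0 (c0 - d) + mass (G (of_int n * \<theta>)) (c0 - d) c0"
      using c0_gt d_pos by (intro mass_split) auto
    moreover have "mass (G (of_int n * \<theta>)) 0 c0 + mass (G (of_int n * \<theta>)) c0 a = d"
      using n by (intro mass_gap_split c0_range) auto
    ultimately have "mass (G (of_int n * \<theta>)) 0 c0 = d"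
      using mass_nonneg[of "G (of_int n * \<theta>)" 0 "c0 - d"] mass_nonneg[of "G (of_int n * \<theta>)" c0 a] by linarith
    then show ?thesis using equal by simp
  qed
  then have "(\<Sum>n\<in>{1..N}. mass (G (of_int n * \<theta>)) 0 c0) = (\<Sum>n\<in>{1..N}. if res n \<le> c0' then d else 0)"
    by (rule sum.cong[OF refl])
  then show ?thesis using \<phi>_eq_gaps[OF c0_range] unfolding c0'_def[symmetric] sum_if_card by linarith
qed

lemma res_1: "res 1 = \<theta>" and \<theta>_bounds: "0 < \<theta>" "\<theta> < L"
proof -
  have "0 \<le> \<theta>" "\<theta> \<le> L" using \<phi>_bounds[of c1] c1_range by (simp_all add: \<theta>_def)
  moreover have "\<theta> \<noteq> L"
  proof
    assume "\<theta> = L"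
    then have "cong_L (real 1 * \<theta>) 0" unfolding cong_L_def by (intro exI[of _ 1]) simp
    then show False using \<theta>_irrational[of 1] by simp
  qed
  ultimately have b: "0 \<le> \<theta>" "\<theta> < L" by simp_all
  show "res 1 = \<theta>" using res_cong[of 1] by (intro cong_L_eq) (use b res_bounds in auto)
  then show "0 < \<theta>" "\<theta> < L" using res_pos[of 1] b by auto
qed

text \<open>In contrast to \<open>c0'_eq\<close> the inequality is strict: the fibre over
  \<open>\<theta>\<close> has its full length in the gap, which only starts at
  \<open>c1\<close>.\<close>

lemma \<theta>_eq: "\<theta> = c1 - d * real (card {n. 1 \<le> n \<and> n \<le> N \<and> res n < \<theta>})"
proof -
  have "mass (G (of_int n * \<theta>)) 0 c1 = (if res n < \<theta> then d else 0)" if n: "n \<in> {1..N}" for n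
  proof (cases "res n" \<theta> rule: linorder_cases)
    case less
    then show ?thesis using mass_gap_before[of n c1] n c1_range by (simp add: \<theta>_def)
  next
    case greater
    then show ?thesis using mass_gap_after[of n c1] n c1_range by (simp add: \<theta>_def)
  next
    case equal
    have "{c1..<c1 + d} \<subseteq> G (of_int n * \<theta>)"
    proof
      fix t assume t: "t \<in> {c1..<c1 + d}"
      then show "t \<in> G (of_int n * \<theta>)" using equal G_res[of t n] n c1_range \<phi>_gap[of t] by simp
    qed
    then have "mass (G (of_int n * \<theta>)) c1 (c1 + d) = d" using mass_full[of c1 "c1 + d"] d_pos by simp
    moreover have "mass (G (of_int n * \<theta>)) c1 a = mass (G (of_int n * \<theta>)) c1 (c1 + d) + mass (G (of_int n * \<theta>)) (c1 + d) a"
      using c1_range d_pos by (intro mass_split) auto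
    moreover have "mass (G (of_int n * \<theta>)) 0 c1 + mass (G (of_int n * \<theta>)) c1 a = d"
      using n by (intro mass_gap_split c1_range) auto
    ultimately have "mass (G (of_int n * \<theta>)) 0 c1 = 0"
      using mass_nonneg[of "G (of_int n * \<theta>)" 0 c1] mass_nonneg[of "G (of_int n * \<theta>)" "c1 + d" a] by linarith
    then show ?thesis using equal by simp
  qed
  then have "(\<Sum>n\<in>{1..N}. mass (G (of_int n * \<theta>)) 0 c1) = (\<Sum>n\<in>{1..N}. if res n < \<theta> then d else 0)"
    by (rule sum.cong[OF refl])
  then show ?thesis using \<phi>_eq_gaps[OF c1_range(1,2)] unfolding \<theta>_def[symmetric] sum_if_card by linarith
qed

text \<open>The number of turns made by \<open>\<theta>, ..., N \<theta>\<close> modulo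
  \<open>L\<close>; in \<open>conditions\<close> it is identified with the quotient \<open>m\<close>
  of the statement.\<close>

definition m :: int where "m = \<lfloor>of_int N * \<theta> / L\<rfloor>"

text \<open>\<open>res n < \<theta>\<close> holds exactly when \<open>n \<theta>\<close> has just passed a multiple of \<open>L\<close>.\<close>

lemma card_wraps: "int (card {n. 1 \<le> n \<and> n \<le> N \<and> res n < \<theta>}) = m"
proof -
  define f where "f n = - \<lfloor>of_int n * \<theta> / L\<rfloor>" for n :: int
  have "f (n - 1) - f n = (if res n < \<theta> then 1 else 0)" for n
  proof -
    define i where "i = \<lfloor>of_int n * \<theta> / L\<rfloor>"
    have "res n = of_int n * \<theta> - of_int i * L" by (simp add: res_def i_def)
    then have eq: "of_int (n - 1) * \<theta> / L = (res n - \<theta>) / L + of_int i" using L_pos by (simp add: field_simps)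
    have "\<lfloor>(res n - \<theta>) / L\<rfloor> = (if res n < \<theta> then -1 else 0)"
      using res_bounds[of n] \<theta>_bounds L_pos by (simp add: floor_eq_iff field_simps)
    then show ?thesis unfolding f_def eq i_def[symmetric] by simp
  qed
  then have "(\<Sum>n\<in>{1..N}. if res n < \<theta> then 1 else 0) = (\<Sum>n\<in>{1..N}. f (n - 1) - f n)" by simp
  also have "\<dots> = f 0 - f N" using N_ge by (intro int_telescope) simp
  also have "\<dots> = m" by (simp add: f_def m_def)
  finally have "int (card ({1..N} \<inter> {n. res n < \<theta>})) = m" by (simp add: sum.If_cases)
  moreover have "{1..N} \<inter> {n. res n < \<theta>} = {n. 1 \<le> n \<and> n \<le> N \<and> res n < \<theta>}" by auto
  ultimately show ?thesis by simp
qed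

lemma \<theta>_c1: "\<theta> = c1 - of_int m * d"
proof -
  have "real (card {n. 1 \<le> n \<and> n \<le> N \<and> res n < \<theta>}) = of_int m" using card_wraps by linarith
  then show ?thesis using \<theta>_eq by simp
qed

lemma res_N: "res N = c0'" and c0'_bounds: "0 < c0'" "c0' < L"
proof -
  have b: "0 \<le> c0'" "c0' \<le> L" using \<phi>_bounds[of c0] c0_range by (simp_all add: c0'_def)
  have c: "cong_L c0' (res N)" using N_cong res_cong cong_L_sym cong_L_trans by blast
  have "c0' \<noteq> L"
  proof
    assume "c0' = L"
    moreover have "cong_L 0 (0 + of_int 1 * L)" using cong_L_shift cong_L_sym by blast
    ultimately have "cong_L 0 (res N)" using c cong_L_trans by simp
    then have "0 = res N" by (rule cong_L_eq) (use res_bounds L_pos in auto)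
    then show False using res_pos[of N] N_ge by simp
  qed
  then show r: "res N = c0'" using c b res_bounds cong_L_eq[of c0' "res N"] by simp
  then show "0 < c0'" "c0' < L" using res_pos[of N] N_ge res_bounds[of N] by auto
qed

lemma N_\<theta>: "of_int N * \<theta> = c0' + of_int m * L"
  using res_N by (simp add: res_def m_def)

lemma card_res_c0': "card {n. 1 \<le> n \<and> n \<le> N \<and> res n \<le> c0'} = card {n. 1 \<le> n \<and> n \<le> N \<and> res n < c0'} + 1"
proof -
  have fin: "finite {n::int. 1 \<le> n \<and> n \<le> N \<and> P n}" for P by (rule finite_subset[of _ "{1..N}"]) auto
  have "{n. 1 \<le> n \<and> n \<le> N \<and> res n \<le> c0'} = insert N {n. 1 \<le> n \<and> n \<le> N \<and> res n < c0'}"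
    using res_N N_ge res_inj by (auto simp: le_less)
  then show ?thesis using fin res_N by simp
qed

lemma \<phi>_c: "\<phi> c = of_int p * L + \<theta> + c0'"
proof -
  have "\<phi> c = \<phi> ((c0 + c1) + of_int p * a)" using c_eq kb_eq by (simp add: algebra_simps)
  also have "\<dots> = \<phi> (c0 + c1) + of_int p * L" by (rule \<phi>_shift)
  also have "\<phi> (c0 + c1) = c0' + \<theta>" using \<phi>_high[of c0] c0_range by (simp add: c0'_def)
  finally show ?thesis by simp
qed

theorem conditions:
  obtains d1 d2 :: nat and j :: int where
    "c - (real d1 + 1) * (of_int k + 1) * (b - a) - (real d2 + 1) * of_int k * (b - a) = a * of_int j" "2 \<le> j"
    "of_int k * b + (real d1 + 1) * (b - a) < c" "c < of_int k * b + b - (real d2 + 1) * (b - a)"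
    "card {n::int. 1 \<le> n \<and> n \<le> int d1 + int d2 + 1 \<and>
              of_int n * (c1 - ((real d1 + real d2 + 1) * c1 - c0 + (real d1 + 1) * (b - a)) / a * (b - a)) \<in>
                plus_rZ {0..<c0 - (real d1 + 1) * (b - a)} (a - (real d1 + real d2 + 1) * (b - a))} = d1"
proof -
  \<comment> \<open>The collapsed intervals before the hole. Those after it will be
    \<open>d2\<close> in number, and the hole itself is the remaining one.\<close>
  define d1 where "d1 = card {n. 1 \<le> n \<and> n \<le> N \<and> res n < c0'}"
  have "int d1 + 1 \<le> N"
  proof -
    have "card {n. 1 \<le> n \<and> n \<le> N \<and> res n \<le> c0'} \<le> card {1..N}" by (intro card_mono) auto
    then show ?thesis using card_res_c0' N_ge by (simp add: d1_def)
  qed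
  then obtain d2 :: nat where N: "N = int d1 + int d2 + 1" by (metis add.commute add.left_commute zle_iff_zadd)
  have rN: "real_of_int N = real d1 + real d2 + 1" by (simp add: N)
  have c0: "c0' = c0 - (real d1 + 1) * (b - a)"
    using c0'_eq card_res_c0' by (simp add: d1_def algebra_simps)
  have L: "L = a - (real d1 + real d2 + 1) * (b - a)" using L_eq rN by simp
  have c1: "c1 = of_int k * b - of_int p * a" using kb_eq by simp
  have mm: "of_int m * a = of_int N * c1 - c0'"
    using N_\<theta> \<theta>_c1 L_eq by (simp add: algebra_simps)
  define j where "j = k + k * N - N * p - m"
  have X: "c - (real d1 + 1) * (of_int k + 1) * (b - a) - (real d2 + 1) * of_int k * (b - a) = a * of_int j"
  proof -
    have "c - (real d1 + 1) * (of_int k + 1) * (b - a) - (real d2 + 1) * of_int k * (b - a)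
        = of_int k * a + c0' - of_int k * of_int N * (b - a)"
      using c_eq c0 by (simp add: rN algebra_simps)
    also have "c0' = of_int N * c1 - of_int m * a" using mm by simp
    finally show ?thesis by (simp add: c1 j_def algebra_simps)
  qed
  \<comment> \<open>Comparison with \<open>\<phi>_c_ge\<close> turns this identity into
    \<open>j \<ge> 2\<close>.\<close>
  have "of_int j * b = \<phi> c"
  proof -
    have "c0' = of_int N * c1 - of_int m * a" using mm by simp
    then show ?thesis unfolding \<phi>_c \<theta>_c1 L_eq by (simp add: c1 j_def algebra_simps)
  qed
  then have "2 * b \<le> of_int j * b" using \<phi>_c_ge by simp
  then have j2: "2 \<le> j" using b_pos by simp
  have m: "((real d1 + real d2 + 1) * c1 - c0 + (real d1 + 1) * (b - a)) / a = of_int m"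
    using mm c0 rN a_pos by (simp add: field_simps)
  have mem: "of_int n * \<theta> \<in> plus_rZ {0..<c0'} L \<longleftrightarrow> res n < c0'" for n :: int
  proof
    assume "of_int n * \<theta> \<in> plus_rZ {0..<c0'} L"
    then obtain x and i :: int where x: "of_int n * \<theta> = x + L * of_int i" "0 \<le> x" "x < c0'"
      by (auto simp: plus_rZ_def)
    then have "cong_L (of_int n * \<theta>) x" unfolding cong_L_def by (auto simp: mult.commute)
    then have "cong_L (res n) x" using res_cong cong_L_trans by blast
    then have "res n = x" using x c0'_bounds res_bounds by (intro cong_L_eq) auto
    then show "res n < c0'" using x by simp
  next
    assume "res n < c0'"
    then have "res n \<in> {0..<c0'}" using res_bounds by simp
    moreover have "of_int n * \<theta> = res n + L * of_int \<lfloor>of_int n * \<theta> / L\<rfloor>" by (simp add: res_def)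
    ultimately show "of_int n * \<theta> \<in> plus_rZ {0..<c0'} L" unfolding plus_rZ_def by blast
  qed
  have card: "card {n::int. 1 \<le> n \<and> n \<le> int d1 + int d2 + 1 \<and>
              of_int n * (c1 - ((real d1 + real d2 + 1) * c1 - c0 + (real d1 + 1) * (b - a)) / a * (b - a)) \<in>
                plus_rZ {0..<c0 - (real d1 + 1) * (b - a)} (a - (real d1 + real d2 + 1) * (b - a))} = d1"
    unfolding m \<theta>_c1[symmetric] c0[symmetric] L[symmetric] mem N[symmetric] by (simp add: d1_def)
  have b1: "of_int k * b + (real d1 + 1) * (b - a) < c" using c0'_bounds c0 c_eq by simp
  have b2: "c < of_int k * b + b - (real d2 + 1) * (b - a)"
    using c0'_bounds c0 L c_eq by (simp add: algebra_simps)
  show ?thesis using that[OF X j2 b1 b2 card] .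
qed

end

section \<open>Assembling the two implications\<close>

theorem theorem2p4:
  fixes a b c :: real
  defines "k \<equiv> \<lfloor>c / b\<rfloor>"
  defines "c0 \<equiv> c - of_int k * b"
  defines "c1 \<equiv> of_int k * b - of_int \<lfloor>of_int k * b / a\<rfloor> * a"
  assumes "0 < a" "a < b" "b < c"
    and "b - a < c0" "c0 < a"
    and "k \<ge> 2"
    and "0 < c1" "c1 < 2 * a - b"
    and "a / b \<notin> \<rat>"
  shows "\<not> gabor_frame (indicator {0..<c}) a b \<longleftrightarrow>
    (\<exists>d1 d2 :: nat.
       (let X = c - (real d1 + 1) * (of_int k + 1) * (b - a) - (real d2 + 1) * of_int k * (b - a)
        in (\<exists>j::int. X = a * of_int j) \<and> X \<noteq> a) \<and>
       of_int k * b + (real d1 + 1) * (b - a) < c \<and>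
       c < of_int k * b + b - (real d2 + 1) * (b - a) \<and>
       (let m = ((real d1 + real d2 + 1) * c1 - c0 + (real d1 + 1) * (b - a)) / a
        in card {n::int. 1 \<le> n \<and> n \<le> int d1 + int d2 + 1 \<and>
              of_int n * (c1 - m * (b - a)) \<in>
                plus_rZ {0..<c0 - (real d1 + 1) * (b - a)} (a - (real d1 + real d2 + 1) * (b - a))}
            = d1))"
proof -
  define p where "p = \<lfloor>of_int k * b / a\<rfloor>"
  interpret hole_dynamics b a c k p c0 c1
  proof
    show "0 < b" "0 < c" "b - a < c0" "c0 < a" "2 \<le> k" "0 < c1" "c1 < 2 * a - b" "a / b \<notin> \<rat>" "a < b" "0 < a"
      using assms by auto
    show "c = of_int k * b + c0" by (simp add: c0_def)
    show "of_int k * b = of_int p * a + c1" by (simp add: c1_def p_def)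
  qed
  show ?thesis
  proof
    assume nf: "\<not> gabor_frame (indicator {0..<c}) a b"
    \<comment> \<open>For each \<open>N\<close> some coset, possibly depending on \<open>N\<close>,
      has a pair surviving \<open>N\<close> steps; \<open>S_pair\<close> upgrades this to pairs in
      \<open>S\<close> on every coset.\<close>
    have pair: "\<exists>t. pair N t 0" for N
      using nf frame_if_no_pair[of N] by blast
    interpret surviving_pairs b a c k p c0 c1
    proof
      show "\<exists>i\<in>window t 0. \<exists>j\<in>window t 0. i \<noteq> j \<and> t + of_int i * b \<in> S \<and> t + of_int j * b \<in> S" for t
        using S_pair[OF pair, of t] by metis
    qed
    obtain d1 d2 :: nat and j :: int where
      X: "c - (real d1 + 1) * (of_int k + 1) * (b - a) - (real d2 + 1) * of_int k * (b - a) = a * of_int j" "2 \<le> j"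
      and *: "of_int k * b + (real d1 + 1) * (b - a) < c" "c < of_int k * b + b - (real d2 + 1) * (b - a)"
      "card {n::int. 1 \<le> n \<and> n \<le> int d1 + int d2 + 1 \<and>
              of_int n * (c1 - ((real d1 + real d2 + 1) * c1 - c0 + (real d1 + 1) * (b - a)) / a * (b - a)) \<in>
                plus_rZ {0..<c0 - (real d1 + 1) * (b - a)} (a - (real d1 + real d2 + 1) * (b - a))} = d1"
      by (rule conditions)
    have "a * of_int j \<noteq> a" using X(2) a_pos by simp
    with X(1) * show "\<exists>d1 d2 :: nat.
       (let X = c - (real d1 + 1) * (of_int k + 1) * (b - a) - (real d2 + 1) * of_int k * (b - a)
        in (\<exists>j::int. X = a * of_int j) \<and> X \<noteq> a) \<and>
       of_int k * b + (real d1 + 1) * (b - a) < c \<and>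
       c < of_int k * b + b - (real d2 + 1) * (b - a) \<and>
       (let m = ((real d1 + real d2 + 1) * c1 - c0 + (real d1 + 1) * (b - a)) / a
        in card {n::int. 1 \<le> n \<and> n \<le> int d1 + int d2 + 1 \<and>
              of_int n * (c1 - m * (b - a)) \<in>
                plus_rZ {0..<c0 - (real d1 + 1) * (b - a)} (a - (real d1 + real d2 + 1) * (b - a))}
            = d1)"
      unfolding Let_def by (intro exI[of _ d1] exI[of _ d2] conjI exI[of _ j]) simp_all
  next
    assume "\<exists>d1 d2 :: nat.
       (let X = c - (real d1 + 1) * (of_int k + 1) * (b - a) - (real d2 + 1) * of_int k * (b - a)
        in (\<exists>j::int. X = a * of_int j) \<and> X \<noteq> a) \<and>
       of_int k * b + (real d1 + 1) * (b - a) < c \<and>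
       c < of_int k * b + b - (real d2 + 1) * (b - a) \<and>
       (let m = ((real d1 + real d2 + 1) * c1 - c0 + (real d1 + 1) * (b - a)) / a
        in card {n::int. 1 \<le> n \<and> n \<le> int d1 + int d2 + 1 \<and>
              of_int n * (c1 - m * (b - a)) \<in>
                plus_rZ {0..<c0 - (real d1 + 1) * (b - a)} (a - (real d1 + real d2 + 1) * (b - a))}
            = d1)"
    then obtain d1 d2 :: nat and j :: int where
      X: "c - (real d1 + 1) * (of_int k + 1) * (b - a) - (real d2 + 1) * of_int k * (b - a) = a * of_int j"
      "c - (real d1 + 1) * (of_int k + 1) * (b - a) - (real d2 + 1) * of_int k * (b - a) \<noteq> a"
      and *: "of_int k * b + (real d1 + 1) * (b - a) < c" "c < of_int k * b + b - (real d2 + 1) * (b - a)"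
      "card {n::int. 1 \<le> n \<and> n \<le> int d1 + int d2 + 1 \<and>
              of_int n * (c1 - ((real d1 + real d2 + 1) * c1 - c0 + (real d1 + 1) * (b - a)) / a * (b - a)) \<in>
                plus_rZ {0..<c0 - (real d1 + 1) * (b - a)} (a - (real d1 + real d2 + 1) * (b - a))} = d1"
      unfolding Let_def by (elim exE conjE) (rule that)
    have "j \<noteq> 1"
    proof
      assume "j = 1"
      then show False using X by simp
    qed
    show "\<not> gabor_frame (indicator {0..<c}) a b"
      by (rule not_frame_if_conditions[OF X(1) \<open>j \<noteq> 1\<close> *(1,2) refl *(3)])
  qed
qed

end
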